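(* Let $\zeta$-free notation be as in the context. For $0\le a\le 10$ put $$D_C(a,11):=\sum_{n\ge 0}\Big(M(a,11,n)-\tfrac{p(n)}{11}\Big)q^n .$$ Then, with $v_{11}$ as defined in the context, \begin{align*} D_{C}(0,11) &= v_{11}(10,-12,-2,8,6,4,-4,-6,-8,2),\\ D_{C}(1,11) &= v_{11}(-1,10,-2,-3,-5,4,7,5,3,2),\\ D_{C}(2,11) &= v_{11}(-1,-1,9,-3,6,-7,-4,-6,3,2),\\ D_{C}(3,11) &= v_{11}(-1,-1,-2,8,-5,4,-4,5,3,-9),\\ D_{C}(4,11) &= v_{11}(-1,-1,-2,-3,6,-7,7,5,-8,2),\\ D_{C}(5,11) &= v_{11}(-1,-1,-2,-3,-5,4,-4,-6,3,2). \end{align*}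
   Context: All series are formal power (or Laurent) series in $q$. $(x;q)_\infty=\prod_{i\ge0}(1-xq^i)$. For integers $a$ and $m>0$: $J_{a,m}:=(q^a;q^m)_\infty(q^{m-a};q^m)_\infty(q^m;q^m)_\infty$, $J_m:=(q^m;q^m)_\infty$, $P_i:=J_{i,11}$, $X_i:=J_{11i,121}$. $p(n)$ is the number of partitions of $n$ ($p(0)=1$). The crank of a partition $\pi$: let $\lambda(\pi)$ be its largest part, $\omega(\pi)$ its number of parts equal to $1$, and $\mu(\pi)$ its number of parts larger than $\omega(\pi)$; the crank is $\lambda(\pi)$ if $\omega(\pi)=0$ and $\mu(\pi)-\omega(\pi)$ otherwise. For $n\ge2$, $M(m,n)$ is the number of partitions of $n$ with crank $m$; for $n\le 1$ one sets $M(0,0)=1$, $M(0,1)=-1$, $M(1,1)=M(-1,1)=1$ and $M(m,n)=0$ otherwise (so $\sum_{n\ge0}\sum_m M(m,n)z^mq^n=\frac{(q;q)_\infty}{(zq;q)_\infty(z^{-1}q;q)_\infty}$). $M(a,r,n):=\sum_{m\equiv a \ (\mathrm{mod}\ r)}M(m,n)$. Define \begin{align*} v_{11}(a_0,a_1,a_2,a_3,a_4,a_5,a_7,a_8,a_9,a_{10}):=\frac{J_{121}^2}{11}\Big(& a_0\frac{1}{X_1}+a_1q\frac{X_5}{X_2X_3}+a_2q^2\frac{X_3}{X_1X_4}+a_3q^3\frac{X_2}{X_1X_3}+a_4q^4\frac{1}{X_2}\\ &+a_5q^5\frac{X_4}{X_2X_5}+a_7q^7\frac{1}{X_3}+a_8q^{19}\frac{X_1}{X_4X_5}+a_9q^9\frac{1}{X_4}+a_{10}q^{10}\frac{1}{X_5}\Big).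 \end{align*} *)

theory Defs
  imports "HOL-Computational_Algebra.Formal_Power_Series" "HOL-Library.Multiset"
begin

(* (q^a;q^m)_\<infinity> as a formal power series (meaningful for a \<ge> 1, m \<ge> 1):
   the n-th coefficient is that of the finite product \<Prod>_{i\<le>n}(1 - q^(a+m i)),
   which is already stable since all further factors are 1 + O(q^(n+1)). *)
definition qpoch :: "nat \<Rightarrow> nat \<Rightarrow> rat fps" where
  "qpoch a m = Abs_fps (\<lambda>n. fps_nth (\<Prod>i\<le>n. (1 - fps_X ^ (a + m * i))) n)"

definition Jam :: "nat \<Rightarrow> nat \<Rightarrow> rat fps" where
  "Jam a m = qpoch a m * qpoch (m - a) m * qpoch m m"

definition Jm :: "nat \<Rightarrow> rat fps" where
  "Jm m = qpoch m m"

definition Xi :: "nat \<Rightarrow> rat fps" where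
  "Xi i = Jam (11 * i) 121"

definition partitions :: "nat \<Rightarrow> nat multiset set" where
  "partitions n = {P. (\<forall>x\<in>#P. 0 < x) \<and> sum_mset P = n}"

definition num_partitions :: "nat \<Rightarrow> nat" where
  "num_partitions n = card (partitions n)"

definition crank :: "nat multiset \<Rightarrow> int" where
  "crank P = (let \<omega> = count P 1;
                  \<mu> = size (filter_mset (\<lambda>x. x > \<omega>) P)
              in if \<omega> = 0 then int (Max_mset P) else int \<mu> - int \<omega>)"

(* M(m,n) with the conventions for n \<le> 1 *)
definition crankM :: "int \<Rightarrow> nat \<Rightarrow> int" where
  "crankM m n =
     (if n \<ge> 2 then int (card {P \<in> partitions n. crank P = m})
      else if n = 0 then (if m = 0 then 1 else 0)
      else (if m = 0 then -1 else if m = 1 \<or> m = -1 then 1 else 0))"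

(* M(a,r,n) = \<Sum>_{m \<equiv> a (mod r)} M(m,n)  (sum over the finitely many nonzero terms) *)
definition crankMr :: "int \<Rightarrow> int \<Rightarrow> nat \<Rightarrow> int" where
  "crankMr a r n = (\<Sum>m | m mod r = a mod r \<and> crankM m n \<noteq> 0. crankM m n)"

definition DC :: "int \<Rightarrow> rat fps" where
  "DC a = Abs_fps (\<lambda>n. of_int (crankMr a 11 n) - of_nat (num_partitions n) / 11)"

definition v11 :: "int \<Rightarrow> int \<Rightarrow> int \<Rightarrow> int \<Rightarrow> int \<Rightarrow> int \<Rightarrow> int \<Rightarrow> int \<Rightarrow> int \<Rightarrow> int \<Rightarrow> rat fps" where
  "v11 a0 a1 a2 a3 a4 a5 a7 a8 a9 a10 =
     fps_const (1/11) * (Jm 121)^2 *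
     ( fps_const (of_int a0) * inverse (Xi 1)
     + fps_const (of_int a1) * fps_X^1 * Xi 5 * inverse (Xi 2 * Xi 3)
     + fps_const (of_int a2) * fps_X^2 * Xi 3 * inverse (Xi 1 * Xi 4)
     + fps_const (of_int a3) * fps_X^3 * Xi 2 * inverse (Xi 1 * Xi 3)
     + fps_const (of_int a4) * fps_X^4 * inverse (Xi 2)
     + fps_const (of_int a5) * fps_X^5 * Xi 4 * inverse (Xi 2 * Xi 5)
     + fps_const (of_int a7) * fps_X^7 * inverse (Xi 3)
     + fps_const (of_int a8) * fps_X^19 * Xi 1 * inverse (Xi 4 * Xi 5)
     + fps_const (of_int a9) * fps_X^9 * inverse (Xi 4)
     + fps_const (of_int a10) * fps_X^10 * inverse (Xi 5))"

end

theory Submission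
  imports Defs Complex_Main "HOL-Computational_Algebra.Computational_Algebra"
begin

text \<open>
  For a primitive 11th root of unity \<open>\<zeta>\<close>, the discrete Fourier transform of the deviations
  \<open>D\<^sub>C(a,11)\<close> is the crank generating function at \<open>\<zeta>\<close>, that is
  \<open>(q)\<^sub>\<infinity> / ((\<zeta>q)\<^sub>\<infinity> (\<zeta>\<^sup>-\<^sup>1q)\<^sub>\<infinity>)\<close>.
  Since the product of all \<open>(\<zeta>\<^sup>kq)\<^sub>\<infinity>\<close> is \<open>J\<^sub>1\<^sub>1\<close>, this equals
  \<open>(q)\<^sub>\<infinity>\<^sup>2 \<Prod>\<^sub>k (\<zeta>\<^sup>kq)\<^sub>\<infinity> (\<zeta>\<^sup>-\<^sup>kq)\<^sub>\<infinity> / J\<^sub>1\<^sub>1\<close> with \<open>k = 2, 3, 4, 5\<close>, and because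
  \<open>{2, 3, 4, 5} = {b, a - b, a + b, a}\<close> up to sign modulo 11 for \<open>a = 5\<close>, \<open>b = 2\<close>, Winquist's identity
  writes the numerator as an alternating sum over pairs of integers \<open>(X, Y)\<close>
  with weight \<open>q\<close> to the power \<open>(X\<^sup>2 + Y\<^sup>2 - 10) / 24\<close>.
  Splitting this sum by the residues of \<open>X\<close> and \<open>Y\<close> modulo 11, the antisymmetry under sign changes
  and exchange of \<open>X\<close> and \<open>Y\<close> leaves one sum for each of the ten pairs \<open>1 \<le> j < i \<le> 5\<close>, and that sum is
  again an instance of Winquist's identity, with base \<open>q\<^sup>1\<^sup>2\<^sup>1\<close>, whose product side is
  \<open>X\<^sub>i X\<^sub>j X\<^sub>i\<^sub>+\<^sub>j X\<^sub>i\<^sub>-\<^sub>j\<close>. The product \<open>X\<^sub>1 X\<^sub>2 X\<^sub>3 X\<^sub>4 X\<^sub>5 = J\<^sub>1\<^sub>1 J\<^sub>1\<^sub>2\<^sub>1\<^sup>4\<close> turns these products into the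
  ten quotients of \<open>v\<^sub>1\<^sub>1\<close>.
\<close>

section \<open>Congruence of power series and infinite products\<close>

text \<open>All series are formal with exponents in the natural numbers, so square roots, fractional
  exponents and negative exponents must not arise. Winquist's identity is therefore stated with
  \<open>u\<close> and \<open>v\<close> entering the products through their squares, with
  \<open>q\<close> replaced by its 24th power, and with powers of \<open>q\<close> on both sides
  that complete the squares. Its scale \<open>\<kappa>\<close> lets one theorem serve twice. For
  \<open>\<kappa> = 1\<close>, \<open>u = z ^ 8\<close>, \<open>v = z\<close> it expands the crank
  numerator: 8 is chosen because 2 times 8 is 5 modulo 11. For \<open>\<kappa> = 11\<close>,
  \<open>u = v = 1\<close> it evaluates each antisymmetrized residue sum. In the first use the theta
  series start at exponent 0 and leave constants 1 - z^5, 1 - z^2, 1 - z^7, 1 - z^3; dividing by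
  their product is a computation modulo the 11th cyclotomic polynomial and yields the small
  coefficients.

  The ten nontrivial roots of unity alone do not determine eleven deviations. The root 1 supplies
  the missing condition: the cranks then count all partitions, so the transform of the deviations
  vanishes, and so do the column sums of the coefficient table.\<close>

definition eqm :: "nat \<Rightarrow> 'a::comm_ring_1 fps \<Rightarrow> 'a fps \<Rightarrow> bool" where
  "eqm n f g \<longleftrightarrow> (\<forall>i<n. fps_nth f i = fps_nth g i)"

lemma eqm_refl [simp]: "eqm n f f"
  by (simp add: eqm_def)

lemma eqm_sym: "eqm n f g \<Longrightarrow> eqm n g f"
  by (simp add: eqm_def)

lemma eqm_trans [trans]: "eqm n f g \<Longrightarrow> eqm n g h \<Longrightarrow> eqm n f h"
  by (simp add: eqm_def)

lemma eqm_mono: "eqm n f g \<Longrightarrow> m \<le> n \<Longrightarrow> eqm m f g"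
  by (simp add: eqm_def)

lemma eqm_add: "eqm n f g \<Longrightarrow> eqm n f' g' \<Longrightarrow> eqm n (f + f') (g + g')"
  by (simp add: eqm_def)

lemma eqm_mult: "eqm n f g \<Longrightarrow> eqm n f' g' \<Longrightarrow> eqm n (f * f') (g * g')"
  by (auto simp: eqm_def fps_mult_nth intro!: sum.cong)

lemma eqm_sum: "(\<And>i. i \<in> I \<Longrightarrow> eqm n (f i) (g i)) \<Longrightarrow> eqm n (sum f I) (sum g I)"
  by (auto simp: eqm_def fps_sum_nth intro!: sum.cong)

lemma eqm_prod: "(\<And>i. i \<in> I \<Longrightarrow> eqm n (f i) (g i)) \<Longrightarrow> eqm n (prod f I) (prod g I)"
  by (induction I rule: infinite_finite_induct) (auto intro: eqm_mult)

lemma eqm_X_power: "n \<le> k \<Longrightarrow> eqm n (fps_X ^ k * f) 0"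
  by (simp add: eqm_def fps_X_power_mult_nth)

lemma eqm_imp_eq: "(\<And>n. eqm n f g) \<Longrightarrow> f = g"
  unfolding eqm_def by (metis fps_ext lessI)

definition qfac :: "'a::comm_ring_1 \<Rightarrow> nat \<Rightarrow> 'a fps" where
  "qfac u e = 1 - fps_const u * fps_X ^ e"

lemma eqm_qfac: "n \<le> e \<Longrightarrow> eqm n (qfac u e) 1"
  by (simp add: eqm_def qfac_def)

text \<open>The cut-off at index \<open>n\<close> copies that of \<open>qpoch\<close>, so the
  passage to complex coefficients is a coefficientwise identity. The start \<open>a = 0\<close> is
  allowed; theta series with leading factor 1 - u need it.\<close>

definition qprod :: "'a::comm_ring_1 \<Rightarrow> nat \<Rightarrow> nat \<Rightarrow> 'a fps" where
  "qprod u a m = Abs_fps (\<lambda>n. fps_nth (\<Prod>i\<le>n. qfac u (a + m * i)) n)"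

lemma eqm_qfac_prod:
  assumes "0 < m" "n \<le> M" "M \<le> N"
  shows "eqm n (\<Prod>i<N. qfac u (a + m * i)) (\<Prod>i<M. qfac u (a + m * i))"
proof -
  have *: "eqm n (qfac u (a + m * i)) 1" if "M \<le> i" for i
  proof (rule eqm_qfac)
    have "i \<le> m * i" using assms by simp
    with that assms show "n \<le> a + m * i" by linarith
  qed
  have "{..<N} = {..<M} \<union> {M..<N}" using assms by auto
  then have "(\<Prod>i<N. qfac u (a + m * i)) = (\<Prod>i<M. qfac u (a + m * i)) * (\<Prod>i\<in>{M..<N}. qfac u (a + m * i))"
    by (simp add: prod.union_disjoint ivl_disj_int(2))
  moreover have "eqm n (\<Prod>i\<in>{M..<N}. qfac u (a + m * i)) (\<Prod>i\<in>{M..<N}. 1)"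
    by (rule eqm_prod) (use * in auto)
  ultimately show ?thesis
    using eqm_mult[of n "\<Prod>i<M. qfac u (a + m * i)" _ "\<Prod>i\<in>{M..<N}. qfac u (a + m * i)" 1] by simp
qed

lemma eqm_qprod:
  assumes "0 < m" "n \<le> N"
  shows "eqm n (qprod u a m) (\<Prod>i<N. qfac u (a + m * i))"
  unfolding eqm_def
proof safe
  fix k assume "k < n"
  then have "eqm (Suc k) (\<Prod>i<N. qfac u (a + m * i)) (\<Prod>i<Suc k. qfac u (a + m * i))"
    using assms by (intro eqm_qfac_prod) auto
  then show "fps_nth (qprod u a m) k = fps_nth (\<Prod>i<N. qfac u (a + m * i)) k"
    unfolding eqm_def qprod_def lessThan_Suc_atMost by simp
qed

lemma qprod_nth_0 [simp]: "0 < a \<Longrightarrow> 0 < m \<Longrightarrow> fps_nth (qprod u a m) 0 = 1"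
  by (simp add: qprod_def qfac_def)

lemma qprod_Suc:
  assumes "0 < m"
  shows "qprod u a m = qfac u a * qprod u (a + m) m"
proof (rule eqm_imp_eq)
  fix n
  have "eqm n (qprod u a m) (\<Prod>i<Suc n. qfac u (a + m * i))"
    using assms by (intro eqm_qprod) auto
  also have "(\<Prod>i<Suc n. qfac u (a + m * i)) = qfac u a * (\<Prod>i<n. qfac u (a + m + m * i))"
    by (simp only: prod.lessThan_Suc_shift) (simp add: algebra_simps)
  also have "eqm n \<dots> (qfac u a * qprod u (a + m) m)"
    using assms by (intro eqm_mult eqm_refl eqm_sym[OF eqm_qprod]) auto
  finally show "eqm n (qprod u a m) (qfac u a * qprod u (a + m) m)" .
qed

lemma prod_blocks:
  fixes f :: "nat \<Rightarrow> 'a::comm_monoid_mult"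
  shows "(\<Prod>i<r * N. f i) = (\<Prod>j<r. \<Prod>i<N. f (j + r * i))"
proof (induction N)
  case (Suc N)
  have *: "(\<Prod>i<M + k. f i) = (\<Prod>i<M. f i) * (\<Prod>j<k. f (j + M))" for M k
    by (induction k) (simp_all add: ac_simps)
  have "(\<Prod>i<r * Suc N. f i) = (\<Prod>i<r * N + r. f i)"
    by (simp add: algebra_simps)
  also have "\<dots> = (\<Prod>i<r * N. f i) * (\<Prod>j<r. f (j + r * N))"
    using *[of "r * N" r] .
  also have "\<dots> = (\<Prod>j<r. \<Prod>i<Suc N. f (j + r * i))"
    by (simp add: Suc prod.distrib)
  finally show ?case .
qed auto

text \<open>Indices are grouped by residue modulo \<open>r\<close>; cutting the left side after
  \<open>r * n\<close> factors makes every residue class complete.\<close>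

lemma qprod_split:
  assumes "0 < m" "0 < r"
  shows "qprod u a m = (\<Prod>j<r. qprod u (a + m * j) (m * r))"
proof (rule eqm_imp_eq)
  fix n
  have "n \<le> r * n" using assms by simp
  then have "eqm n (qprod u a m) (\<Prod>i<r * n. qfac u (a + m * i))"
    using assms by (intro eqm_qprod) auto
  also have "(\<Prod>i<r * n. qfac u (a + m * i)) = (\<Prod>j<r. \<Prod>i<n. qfac u (a + m * j + m * r * i))"
    unfolding prod_blocks by (simp add: algebra_simps)
  also have "eqm n \<dots> (\<Prod>j<r. qprod u (a + m * j) (m * r))"
    using assms by (intro eqm_prod eqm_sym[OF eqm_qprod]) auto
  finally show "eqm n (qprod u a m) (\<Prod>j<r. qprod u (a + m * j) (m * r))" .
qed

section \<open>Formal sums over index sets\<close>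

text \<open>A coefficient is \<open>0\<close> if infinitely many indices share its exponent; \<open>adm\<close> excludes this.\<close>

definition gsum :: "'i set \<Rightarrow> ('i \<Rightarrow> int) \<Rightarrow> ('i \<Rightarrow> 'a::comm_ring_1) \<Rightarrow> 'a fps" where
  "gsum I e c = Abs_fps (\<lambda>n. \<Sum>i | i \<in> I \<and> e i = int n. c i)"

definition adm :: "'i set \<Rightarrow> ('i \<Rightarrow> int) \<Rightarrow> bool" where
  "adm I e \<longleftrightarrow> (\<forall>i\<in>I. 0 \<le> e i) \<and> (\<forall>n. finite {i \<in> I. e i = n})"

lemma admI:
  "(\<And>i. i \<in> I \<Longrightarrow> 0 \<le> e i) \<Longrightarrow> (\<And>n. finite {i \<in> I. e i = n}) \<Longrightarrow> adm I e"
  by (simp add: adm_def)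

lemma adm_nonneg: "adm I e \<Longrightarrow> i \<in> I \<Longrightarrow> 0 \<le> e i"
  by (simp add: adm_def)

lemma adm_finite: "adm I e \<Longrightarrow> finite {i \<in> I. e i = n}"
  by (simp add: adm_def)

lemma adm_int:
  assumes "\<And>i::int. i \<in> I \<Longrightarrow> \<bar>i\<bar> \<le> e i + b" "\<And>i. i \<in> I \<Longrightarrow> 0 \<le> e i"
  shows "adm I e"
proof (rule admI)
  fix n
  have "{i \<in> I. e i = n} \<subseteq> {-(n + b)..n + b}"
    using assms(1) by force
  then show "finite {i \<in> I. e i = n}"
    using finite_subset by blast
qed (use assms in auto)

lemma gsum_nth: "fps_nth (gsum I e c) n = (\<Sum>i | i \<in> I \<and> e i = int n. c i)"
  by (simp add: gsum_def)

lemma gsum_cong: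
  "(\<And>i. i \<in> I \<Longrightarrow> e i = e' i) \<Longrightarrow> (\<And>i. i \<in> I \<Longrightarrow> c i = c' i) \<Longrightarrow> gsum I e c = gsum I e' c'"
  by (auto simp: fps_eq_iff gsum_nth intro!: sum.cong)

lemma gsum_reindex:
  assumes "bij_betw h J I"
  shows "gsum I e c = gsum J (\<lambda>j. e (h j)) (\<lambda>j. c (h j))"
proof (rule fps_ext)
  fix n
  have "bij_betw h {j. j \<in> J \<and> e (h j) = int n} {i. i \<in> I \<and> e i = int n}"
    using assms by (auto simp: bij_betw_def inj_on_def)
  then show "fps_nth (gsum I e c) n = fps_nth (gsum J (\<lambda>j. e (h j)) (\<lambda>j. c (h j))) n"
    by (simp add: gsum_nth sum.reindex_bij_betw[symmetric])
qed

lemma gsum_partition: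
  assumes "adm I e" "finite R" "h ` I \<subseteq> R"
  shows "gsum I e c = (\<Sum>r\<in>R. gsum {i \<in> I. h i = r} e c)"
proof (rule fps_ext)
  fix n
  have "(\<Sum>i | i \<in> I \<and> e i = int n. c i)
      = (\<Sum>r\<in>R. \<Sum>i | i \<in> {i \<in> I. e i = int n} \<and> h i = r. c i)"
    by (subst sum.group) (use assms adm_finite[OF assms(1), of "int n"] in auto)
  also have "\<dots> = (\<Sum>r\<in>R. \<Sum>i | i \<in> {i \<in> I. h i = r} \<and> e i = int n. c i)"
    by (intro sum.cong) auto
  finally show "fps_nth (gsum I e c) n = fps_nth (\<Sum>r\<in>R. gsum {i \<in> I. h i = r} e c) n"
    by (simp add: gsum_nth fps_sum_nth)
qed

text \<open>The sum equals its own negative, and characteristic zero turns twice zero into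
  zero.\<close>

lemma gsum_involution:
  fixes c :: "'i \<Rightarrow> 'a::{comm_ring_1,ring_char_0,ring_no_zero_divisors}"
  assumes "bij_betw h I I" "\<And>i. i \<in> I \<Longrightarrow> e (h i) = e i" "\<And>i. i \<in> I \<Longrightarrow> c (h i) = - c i"
  shows "gsum I e c = 0"
proof (rule fps_ext)
  fix n
  have "fps_nth (gsum I e c) n = fps_nth (gsum I (\<lambda>j. e (h j)) (\<lambda>j. c (h j))) n"
    by (subst gsum_reindex[OF assms(1)]) (rule refl)
  also have "gsum I (\<lambda>j. e (h j)) (\<lambda>j. c (h j)) = gsum I e (\<lambda>j. - c j)"
    by (rule gsum_cong) (use assms in auto)
  also have "fps_nth \<dots> n = - fps_nth (gsum I e c) n"
    by (simp add: gsum_nth sum_negf)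
  finally show "fps_nth (gsum I e c) n = fps_nth 0 n"
    by (simp add: eq_neg_iff_add_eq_0 flip: mult_2)
qed

lemma gsum_const_mult: "fps_const a * gsum I e c = gsum I e (\<lambda>i. a * c i)"
  by (simp add: fps_eq_iff gsum_nth sum_distrib_left)

lemma gsum_X_power_mult:
  assumes "adm I e"
  shows "fps_X ^ k * gsum I e c = gsum I (\<lambda>i. e i + int k) c"
proof (rule fps_ext)
  fix n
  show "fps_nth (fps_X ^ k * gsum I e c) n = fps_nth (gsum I (\<lambda>i. e i + int k) c) n"
  proof (cases "n < k")
    case True
    then have *: "{i. i \<in> I \<and> e i + int k = int n} = {}" using adm_nonneg[OF assms] by force
    show ?thesis using True unfolding gsum_nth fps_X_power_mult_nth * by simp
  next
    case False
    then have "{i. i \<in> I \<and> e i + int k = int n} = {i. i \<in> I \<and> e i = int (n - k)}" by auto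
    then show ?thesis using False by (simp add: gsum_nth fps_X_power_mult_nth)
  qed
qed

text \<open>Nonnegative exponents bound each factor's exponent by the total, so a fibre is a finite
  union of rectangles \<open>F n k\<close>. The same decomposition, read with coefficients, is the
  Cauchy product.\<close>

lemma
  assumes "adm I e" "adm J f"
  shows adm_Times: "adm (I \<times> J) (\<lambda>(i, j). e i + f j)" (is ?A)
    and gsum_mult: "gsum I e c * gsum J f d = gsum (I \<times> J) (\<lambda>(i, j). e i + f j) (\<lambda>(i, j). c i * d j)" (is ?G)
proof -
  define F where "F n k = {i \<in> I. e i = k} \<times> {j \<in> J. f j = n - k}" for n k
  have fin: "finite (F n k)" for n k
    using assms by (simp add: F_def adm_finite)
  have *: "{p \<in> I \<times> J. (case p of (i, j) \<Rightarrow> e i + f j) = n} = (\<Union>k\<in>{0..n}. F n k)" for n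
    using assms by (force simp: F_def adm_def)
  show ?A
    by (rule admI) (use assms fin in \<open>auto simp: adm_nonneg *\<close>)
  show ?G
  proof (rule fps_ext)
    fix n
    have "fps_nth (gsum I e c * gsum J f d) n
        = (\<Sum>k=0..n. (\<Sum>i | i \<in> I \<and> e i = int k. c i) * (\<Sum>j | j \<in> J \<and> f j = int n - int k. d j))"
      unfolding fps_mult_nth gsum_nth by (intro sum.cong) (auto simp: of_nat_diff)
    also have "\<dots> = (\<Sum>k=0..n. \<Sum>(i,j)\<in>F (int n) (int k). c i * d j)"
      by (simp add: sum_product sum.cartesian_product F_def)
    also have "\<dots> = (\<Sum>k\<in>{0..int n}. \<Sum>(i,j)\<in>F (int n) k. c i * d j)"
      by (rule sum.reindex_bij_witness[of _ nat int]) auto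
    also have "\<dots> = (\<Sum>(i,j)\<in>(\<Union>k\<in>{0..int n}. F (int n) k). c i * d j)"
      by (rule sum.UNION_disjoint[symmetric]) (use fin in \<open>auto simp: F_def\<close>)
    also have "\<dots> = fps_nth (gsum (I \<times> J) (\<lambda>(i, j). e i + f j) (\<lambda>(i, j). c i * d j)) n"
      using *[of "int n"] by (simp add: gsum_nth)
    finally show "fps_nth (gsum I e c * gsum J f d) n = 
       fps_nth (gsum (I \<times> J) (\<lambda>(i, j). e i + f j) (\<lambda>(i, j). c i * d j)) n" .
  qed
qed

section \<open>Theta series as formal sums\<close>

definition sg :: "int \<Rightarrow> complex" where
  "sg k = (if even k then 1 else -1)"

definition theta :: "complex \<Rightarrow> nat \<Rightarrow> nat \<Rightarrow> complex fps" where
  "theta u s \<mu> = gsum UNIV (\<lambda>k. int \<mu> * (k * (k - 1)) + int s * k) (\<lambda>k. sg k * u powi k)"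

text \<open>For negative \<open>k\<close>, the bound \<open>s \<le> 2 * \<mu>\<close> reduces the
  exponent to at least \<mu> k (k + 1), the mirror image of the positive side. The linear growth is
  used both for admissibility and for the tail estimate in the triple product.\<close>

lemma theta_exponent_ge:
  assumes "0 < \<mu>" "s \<le> 2 * \<mu>"
  shows "\<bar>k\<bar> \<le> int \<mu> * (k * (k - 1)) + int s * k + 1"
    and "0 \<le> int \<mu> * (k * (k - 1)) + int s * k"
proof -
  consider "k \<ge> 1" | "k = 0" | "k \<le> -1" by linarith
  then have "\<bar>k\<bar> \<le> int \<mu> * (k * (k - 1)) + int s * k + 1 \<and> 0 \<le> int \<mu> * (k * (k - 1)) + int s * k"
  proof cases
    case 1
    have "1 * (k * (k - 1)) \<le> int \<mu> * (k * (k - 1))"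
      using assms 1 by (intro mult_right_mono) auto
    moreover have "0 * (k - 1) \<le> (k - 1) * (k - 1)" "0 * k \<le> int s * k"
      using 1 by (auto intro: mult_right_mono)
    then have "k - 1 \<le> k * (k - 1)" "0 \<le> int s * k" by (simp_all add: algebra_simps)
    ultimately show ?thesis using 1 by linarith
  next
    case 3
    have a: "int s * k \<ge> 2 * int \<mu> * k"
      using 3 assms by (intro mult_right_mono_neg) auto
    have "0 \<le> (- k - 1) * (- k - 1)" using 3 by (intro mult_nonneg_nonneg) auto
    then have b: "-k - 1 \<le> k * (k + 1)" by (simp add: algebra_simps)
    have c: "int \<mu> * (k * (k - 1)) + 2 * int \<mu> * k = int \<mu> * (k * (k + 1))"
      by (simp add: algebra_simps)
    have "1 * (k * (k + 1)) \<le> int \<mu> * (k * (k + 1))"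
      using assms b 3 by (intro mult_right_mono) linarith+
    with a b c 3 show ?thesis by linarith
  qed auto
  then show "\<bar>k\<bar> \<le> int \<mu> * (k * (k - 1)) + int s * k + 1" 
    "0 \<le> int \<mu> * (k * (k - 1)) + int s * k" by auto
qed

lemma adm_theta:
  "0 < \<mu> \<Longrightarrow> s \<le> 2 * \<mu> \<Longrightarrow> adm UNIV (\<lambda>k. int \<mu> * (k * (k - 1)) + int s * k)"
  by (rule adm_int[of _ _ 1]) (erule (1) theta_exponent_ge)+

section \<open>Jacobi's triple product identity\<close>

lemma fps_const_power_mult:
  fixes a b :: "'a::comm_ring_1"
  shows "(fps_const a * fps_X ^ m) * (fps_const b * fps_X ^ n) = fps_const (a * b) * fps_X ^ (m + n)"
  by (simp add: power_add fps_const_mult[symmetric] ac_simps del: fps_const_mult)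

context
  fixes \<mu> s :: nat and u :: complex
  assumes mu: "0 < \<mu>" and s: "s \<le> 2 * \<mu>" and u: "u \<noteq> 0"
begin

definition q_fact :: "nat \<Rightarrow> complex fps" where
  "q_fact n = (\<Prod>i<n. qfac 1 (2 * \<mu> + 2 * \<mu> * i))"

text \<open>The value 0 at negative arguments, as for the reciprocal gamma function, lets the
  recurrences hold without boundary cases.\<close>

definition q_fact_inv :: "int \<Rightarrow> complex fps" where
  "q_fact_inv n = (if n < 0 then 0 else inverse (q_fact (nat n)))"

text \<open>This is the Gaussian binomial coefficient of \<open>2 * N\<close> over
  \<open>N + k\<close> in base \<open>q ^ (2 * \<mu>)\<close>, indexed from its centre.\<close>

definition q_binom :: "nat \<Rightarrow> int \<Rightarrow> complex fps" where
  "q_binom N k = q_fact (2 * N) * q_fact_inv (int N + k) * q_fact_inv (int N - k)"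

definition theta_term :: "int \<Rightarrow> complex fps" where
  "theta_term k = fps_const (sg k * u powi k) * fps_X ^ nat (int \<mu> * (k * (k - 1)) + int s * k)"

lemma q_fact_nth_0: "fps_nth (q_fact n) 0 = 1"
  unfolding q_fact_def using mu by (induction n) (auto simp: qfac_def)

lemma q_fact_mult_inverse: "q_fact n * inverse (q_fact n) = 1"
  by (simp add: inverse_mult_eq_1' q_fact_nth_0)

lemma q_fact_Suc: "q_fact (Suc n) = q_fact n * qfac 1 (2 * \<mu> * Suc n)"
  by (simp add: q_fact_def algebra_simps)

lemma q_fact_inv_pred: "q_fact_inv (n - 1) = q_fact_inv n * qfac 1 (2 * \<mu> * nat n)"
proof -
  consider "n < 0" | "n = 0" | k where "n = int (Suc k)"
    by (metis linorder_cases not0_implies_Suc nonneg_int_cases of_nat_0 order_less_imp_le)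
  then show ?thesis
  proof cases
    case 3
    then have n: "q_fact_inv n = inverse (q_fact (Suc k))" "nat n = Suc k" 
      by (simp_all add: q_fact_inv_def nat_add_distrib)
    have *: "q_fact_inv n * qfac 1 (2 * \<mu> * nat n) * q_fact k = 1"
      using q_fact_mult_inverse[of "Suc k"] unfolding n q_fact_Suc by (simp only: ac_simps)
    have "q_fact_inv n * qfac 1 (2 * \<mu> * nat n) * (q_fact k * inverse (q_fact k)) = inverse (q_fact k)"
      using * by (simp flip: mult.assoc)
    then show ?thesis using 3 by (simp add: q_fact_mult_inverse q_fact_inv_def)
  qed (auto simp: q_fact_inv_def qfac_def)
qed

lemma q_binom_eq_0: "int N < \<bar>k\<bar> \<Longrightarrow> q_binom N k = 0"
  by (auto simp: q_binom_def q_fact_inv_def)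

text \<open>Two Pascal steps taken together, so that the coefficient stays centred. With the common
  factors removed, what remains is the identity \<open>key\<close> in powers of \<open>p\<close>
  with \<open>a + b = 2 * N + 2\<close>.\<close>

lemma q_binom_Suc:
  assumes "\<bar>k\<bar> \<le> int N + 1"
  shows "q_binom (Suc N) k = q_binom N k * (1 + fps_X ^ (2 * \<mu> * (2 * N + 1)))
     + fps_X ^ (2 * \<mu> * nat (int N + 1 - k)) * q_binom N (k - 1)
     + fps_X ^ (2 * \<mu> * nat (int N + 1 + k)) * q_binom N (k + 1)"
proof -
  define a b where "a = nat (int N + 1 + k)" and "b = nat (int N + 1 - k)"
  define p :: "complex fps" where "p = fps_X ^ (2 * \<mu>)"
  have ab: "int a = int N + 1 + k" "int b = int N + 1 - k" "a + b = 2 * N + 2"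
    using assms by (auto simp: a_def b_def)
  have qf: "qfac 1 (2 * \<mu> * n) = 1 - p ^ n" for n
    by (simp add: qfac_def p_def power_mult)
  have "2 * Suc N = Suc (Suc (2 * N))" by simp
  then have F: "q_fact (2 * Suc N) = q_fact (2 * N) * (1 - p ^ (2 * N + 1)) * (1 - p ^ (2 * N + 2))"
    using q_fact_Suc[of "2 * N"] q_fact_Suc[of "Suc (2 * N)"] by (simp only: qf) simp
  define x y where "x = q_fact_inv (int a)" and "y = q_fact_inv (int b)"
  have x1: "q_fact_inv (int a - 1) = x * (1 - p ^ a)"
    using q_fact_inv_pred[of "int a"] by (simp add: x_def qf)
  have y1: "q_fact_inv (int b - 1) = y * (1 - p ^ b)"
    using q_fact_inv_pred[of "int b"] by (simp add: y_def qf)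
  have x2: "q_fact_inv (int a - 2) = x * (1 - p ^ a) * (1 - p ^ (a - 1))"
    using q_fact_inv_pred[of "int a - 1"] x1 by (simp add: nat_diff_distrib' qf)
  have y2: "q_fact_inv (int b - 2) = y * (1 - p ^ b) * (1 - p ^ (b - 1))"
    using q_fact_inv_pred[of "int b - 1"] y1 by (simp add: nat_diff_distrib' qf)
  \<comment> \<open>The cases a = 0 and b = 0 are separate because \<open>a - 1\<close> and
    \<open>b - 1\<close> are truncated; there the factor 1 - p^0 kills the affected terms.\<close>
  have key: "(1 - p ^ (2 * N + 1)) * (1 - p ^ (2 * N + 2)) = (1 - p ^ a) * (1 - p ^ b) * (1 + p ^ (2 * N + 1))
     + p ^ b * (1 - p ^ a) * (1 - p ^ (a - 1)) + p ^ a * (1 - p ^ b) * (1 - p ^ (b - 1))"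
  proof (cases a)
    case 0
    with ab have "b = 2 * N + 2" by simp
    with 0 show ?thesis by simp
  next
    case (Suc a')
    show ?thesis
    proof (cases b)
      case 0
      with ab have "a = 2 * N + 2" by simp
      with 0 show ?thesis by simp
    next
      case b: (Suc b')
      have "2 * N + 1 = Suc (a' + b')" "2 * N + 2 = Suc (Suc (a' + b'))"
        using ab b Suc by auto
      then show ?thesis unfolding Suc b
        by (simp add: power_add algebra_simps)
    qed
  qed
  have q1: "q_binom (Suc N) k = q_fact (2 * N) * x * y * ((1 - p ^ (2 * N + 1)) * (1 - p ^ (2 * N + 2)))"
    unfolding q_binom_def F x_def y_def ab(1,2) by (simp add: algebra_simps)
  have q2: "q_binom N k = q_fact (2 * N) * (x * (1 - p ^ a)) * (y * (1 - p ^ b))"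
    unfolding q_binom_def x1[symmetric] y1[symmetric] ab(1,2) by simp
  have q3: "q_binom N (k - 1) = q_fact (2 * N) * (x * (1 - p ^ a) * (1 - p ^ (a - 1))) * y"
    unfolding q_binom_def x2[symmetric] y_def ab(1,2) by (simp add: algebra_simps)
  have q4: "q_binom N (k + 1) = q_fact (2 * N) * x * (y * (1 - p ^ b) * (1 - p ^ (b - 1)))"
    unfolding q_binom_def y2[symmetric] x_def ab(1,2) by (simp add: algebra_simps)
  have q5: "fps_X ^ (2 * \<mu> * n) = p ^ n" for n
    by (simp add: p_def power_mult)
  show ?thesis
    unfolding q1 key a_def[symmetric] b_def[symmetric] q2 q3 q4 q5 by (simp add: algebra_simps)
qed

text \<open>The power of \<open>q\<close> attached to the lower neighbour in
  \<open>q_binom_Suc\<close> converts term \<open>k\<close> into term \<open>k - 1\<close> times a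
  factor independent of \<open>k\<close>. That factor is the one by which the finite product
  grows.\<close>

lemma theta_term_shift_up:
  assumes "k \<le> int N + 1"
  shows "theta_term k * fps_X ^ (2 * \<mu> * nat (int N + 1 - k))
    = - theta_term (k - 1) * (fps_const u * fps_X ^ (s + 2 * \<mu> * N))"
proof -
  have "sg k * u powi k = - (sg (k - 1) * u powi (k - 1) * u)"
    using u by (auto simp: sg_def power_int_diff)
  moreover have "nat (int \<mu> * (k * (k - 1)) + int s * k) + 2 * \<mu> * nat (int N + 1 - k)
    = nat (int \<mu> * ((k - 1) * (k - 1 - 1)) + int s * (k - 1)) + (s + 2 * \<mu> * N)"
    using assms theta_exponent_ge(2)[OF mu s, of k] theta_exponent_ge(2)[OF mu s, of "k - 1"]
    by (simp add: nat_eq_iff of_nat_eq_iff[where 'a=int, symmetric] del: of_nat_eq_iff) (simp add: algebra_simps)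
  moreover have "theta_term k * fps_X ^ (2 * \<mu> * nat (int N + 1 - k)) = fps_const (sg k * u powi k) *
     fps_X ^ (nat (int \<mu> * (k * (k - 1)) + int s * k) + 2 * \<mu> * nat (int N + 1 - k))"
    by (simp add: theta_term_def power_add mult.assoc)
  ultimately show ?thesis
    by (simp only: theta_term_def mult_minus_left fps_const_power_mult fps_const_neg[symmetric])
qed

lemma theta_term_shift_down:
  assumes "- k \<le> int N + 1"
  shows "theta_term k * fps_X ^ (2 * \<mu> * nat (int N + 1 + k))
    = - theta_term (k + 1) * (fps_const (1 / u) * fps_X ^ (2 * \<mu> - s + 2 * \<mu> * N))"
proof -
  have "sg k * u powi k = - (sg (k + 1) * u powi (k + 1) * (1 / u))"
    using u by (auto simp: sg_def power_int_add)
  moreover have "nat (int \<mu> * (k * (k - 1)) + int s * k) + 2 * \<mu> * nat (int N + 1 + k)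
    = nat (int \<mu> * ((k + 1) * (k + 1 - 1)) + int s * (k + 1)) + (2 * \<mu> - s + 2 * \<mu> * N)"
    using assms s theta_exponent_ge(2)[OF mu s, of k] theta_exponent_ge(2)[OF mu s, of "k + 1"]
    by (simp add: nat_eq_iff of_nat_diff of_nat_eq_iff[where 'a=int, symmetric] del: of_nat_eq_iff) (simp add: algebra_simps)
  moreover have "theta_term k * fps_X ^ (2 * \<mu> * nat (int N + 1 + k)) = fps_const (sg k * u powi k) *
     fps_X ^ (nat (int \<mu> * (k * (k - 1)) + int s * k) + 2 * \<mu> * nat (int N + 1 + k))"
    by (simp add: theta_term_def power_add mult.assoc)
  ultimately show ?thesis
    by (simp only: theta_term_def mult_minus_left fps_const_power_mult fps_const_neg[symmetric])
qed

text \<open>Induction on \<open>N\<close>: the new factors contribute (1 - x)(1 - y) = 1 + xy - x -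
  y, and the three terms of \<open>q_binom_Suc\<close> supply 1 + xy, -x and -y after shifting
  \<open>k\<close>.\<close>

lemma finite_jacobi_triple_product:
  "(\<Prod>i<N. qfac u (s + 2 * \<mu> * i)) * (\<Prod>i<N. qfac (1 / u) (2 * \<mu> - s + 2 * \<mu> * i))
    = (\<Sum>k\<in>{- int N..int N}. theta_term k * q_binom N k)"
proof (induction N)
  case 0
  show ?case by (simp add: theta_term_def q_binom_def q_fact_inv_def q_fact_mult_inverse q_fact_def sg_def)
next
  case (Suc N)
  define S where "S = (\<Sum>k\<in>{- int N..int N}. theta_term k * q_binom N k)"
  define x y where "x = fps_const u * fps_X ^ (s + 2 * \<mu> * N)"
    and "y = fps_const (1 / u) * fps_X ^ (2 * \<mu> - s + 2 * \<mu> * N)"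
  define p2 :: "complex fps" where "p2 = fps_X ^ (2 * \<mu> * (2 * N + 1))"
  have xy: "x * y = p2"
    unfolding x_def y_def fps_const_power_mult p2_def using s u by (simp add: algebra_simps)
  have S: "(\<Sum>k\<in>A. theta_term k * q_binom N k) = S" if "finite A" "{- int N..int N} \<subseteq> A" for A
    unfolding S_def using that by (intro sum.mono_neutral_right) (auto simp: q_binom_eq_0)
  let ?I = "{- int (Suc N)..int (Suc N)}"
  have "(\<Sum>k\<in>?I. theta_term k * q_binom (Suc N) k)
     = (\<Sum>k\<in>?I. (1 + p2) * (theta_term k * q_binom N k)
         - x * (theta_term (k - 1) * q_binom N (k - 1)) - y * (theta_term (k + 1) * q_binom N (k + 1)))"
  proof (rule sum.cong)
    fix k assume k: "k \<in> ?I"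
    have "theta_term k * q_binom (Suc N) k = (1 + p2) * (theta_term k * q_binom N k)
       + (theta_term k * fps_X ^ (2 * \<mu> * nat (int N + 1 - k))) * q_binom N (k - 1)
       + (theta_term k * fps_X ^ (2 * \<mu> * nat (int N + 1 + k))) * q_binom N (k + 1)"
      using k by (subst q_binom_Suc) (auto simp: p2_def algebra_simps)
    also have "\<dots> = (1 + p2) * (theta_term k * q_binom N k)
         - x * (theta_term (k - 1) * q_binom N (k - 1)) - y * (theta_term (k + 1) * q_binom N (k + 1))"
    proof -
      have kk: "k \<le> int N + 1" "- k \<le> int N + 1" using k by auto
      show ?thesis
        unfolding theta_term_shift_up[OF kk(1)] theta_term_shift_down[OF kk(2)] x_def[symmetric] y_def[symmetric]
        by (simp add: algebra_simps)
    qed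
    finally show "theta_term k * q_binom (Suc N) k = \<dots>" .
  qed simp
  also have "\<dots> = (1 + p2) * (\<Sum>k\<in>?I. theta_term k * q_binom N k)
      - x * (\<Sum>k\<in>?I. theta_term (k - 1) * q_binom N (k - 1))
      - y * (\<Sum>k\<in>?I. theta_term (k + 1) * q_binom N (k + 1))"
    by (simp add: sum_subtractf sum_distrib_left)
  also have "(\<Sum>k\<in>?I. theta_term (k - 1) * q_binom N (k - 1)) = (\<Sum>k\<in>{- int N - 2..int N}. theta_term k * q_binom N k)"
    by (rule sum.reindex_bij_witness[of _ "\<lambda>k. k + 1" "\<lambda>k. k - 1"]) auto
  also have "(\<Sum>k\<in>?I. theta_term (k + 1) * q_binom N (k + 1)) = (\<Sum>k\<in>{- int N..int N + 2}. theta_term k * q_binom N k)"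
    by (rule sum.reindex_bij_witness[of _ "\<lambda>k. k - 1" "\<lambda>k. k + 1"]) auto
  also have "(1 + p2) * (\<Sum>k\<in>?I. theta_term k * q_binom N k)
      - x * (\<Sum>k\<in>{- int N - 2..int N}. theta_term k * q_binom N k)
      - y * (\<Sum>k\<in>{- int N..int N + 2}. theta_term k * q_binom N k) = (1 + p2) * S - x * S - y * S"
    by (subst (1 2 3) S) auto
  also have "\<dots> = S * ((1 - x) * (1 - y))"
    unfolding xy[symmetric] by (simp add: algebra_simps)
  also have "S = (\<Prod>i<N. qfac u (s + 2 * \<mu> * i)) * (\<Prod>i<N. qfac (1 / u) (2 * \<mu> - s + 2 * \<mu> * i))"
    unfolding S_def Suc ..
  finally show ?case
    by (simp add: x_def y_def qfac_def ac_simps)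
qed

theorem jacobi_triple_product:
  "theta u s \<mu> = qprod u s (2 * \<mu>) * qprod (1 / u) (2 * \<mu> - s) (2 * \<mu>) * qprod 1 (2 * \<mu>) (2 * \<mu>)"
proof (rule eqm_imp_eq)
  fix n :: nat
  \<comment> \<open>For |k| at most n, both N + k and N - k are at least n, so every q-factorial
    involved agrees with the infinite product below order n. For larger |k| the theta term itself
    has exponent at least n.\<close>
  define N where "N = 2 * n"
  define Q where "Q = qprod (1::complex) (2 * \<mu>) (2 * \<mu>)"
  have Q: "eqm n (q_fact M) Q" if "n \<le> M" for M
    unfolding Q_def q_fact_def using mu that by (intro eqm_sym[OF eqm_qprod]) auto
  have trm: "eqm n (theta_term k * q_binom N k * Q) (theta_term k)" if k: "\<bar>k\<bar> \<le> int N" for k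
  proof (cases "\<bar>k\<bar> \<le> int n")
    case True
    define a b where "a = nat (int N + k)" and "b = nat (int N - k)"
    have ab: "n \<le> a" "n \<le> b" "0 \<le> int N + k" "0 \<le> int N - k"
      using True by (auto simp: a_def b_def N_def)
    have "eqm n (q_fact (2 * N) * Q) (q_fact a * q_fact b)"
      using ab by (intro eqm_mult eqm_trans[OF Q eqm_sym[OF Q]] eqm_sym[OF Q]) (auto simp: N_def)
    from eqm_mult[OF this eqm_refl[of n "inverse (q_fact a) * inverse (q_fact b)"]]
    have "eqm n (q_binom N k * Q) (q_fact a * inverse (q_fact a) * (q_fact b * inverse (q_fact b)))"
      using ab by (simp add: q_binom_def q_fact_inv_def a_def b_def ac_simps)
    from eqm_mult[OF eqm_refl[of n "theta_term k"] this] show ?thesis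
      by (simp add: q_fact_mult_inverse mult.assoc)
  next
    case False
    have "n \<le> nat (int \<mu> * (k * (k - 1)) + int s * k)"
      using False theta_exponent_ge(1)[OF mu s, of k] by linarith
    then have *: "eqm n (theta_term k * f) 0" for f
      using eqm_X_power[of n "nat (int \<mu> * (k * (k - 1)) + int s * k)" "fps_const (sg k * u powi k) * f"]
      by (simp add: theta_term_def mult.left_commute mult.assoc)
    show ?thesis
      using *[of "q_binom N k * Q"] *[of 1] eqm_trans eqm_sym by (metis mult.assoc mult.right_neutral)
  qed
  have "eqm n (qprod u s (2 * \<mu>) * qprod (1 / u) (2 * \<mu> - s) (2 * \<mu>) * Q)
     ((\<Prod>i<N. qfac u (s + 2 * \<mu> * i)) * (\<Prod>i<N. qfac (1 / u) (2 * \<mu> - s + 2 * \<mu> * i)) * Q)"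
    using mu by (intro eqm_mult eqm_qprod eqm_refl) (auto simp: N_def)
  also have "\<dots> = (\<Sum>k\<in>{- int N..int N}. theta_term k * q_binom N k * Q)"
    by (simp add: finite_jacobi_triple_product sum_distrib_right)
  also have "eqm n \<dots> (\<Sum>k\<in>{- int N..int N}. theta_term k)"
    by (rule eqm_sum) (use trm in auto)
  also have "eqm n \<dots> (theta u s \<mu>)"
    unfolding eqm_def
  proof safe
    fix i assume i: "i < n"
    let ?e = "\<lambda>k. int \<mu> * (k * (k - 1)) + int s * k"
    have "fps_nth (\<Sum>k\<in>{- int N..int N}. theta_term k) i
        = (\<Sum>k\<in>{- int N..int N}. if ?e k = int i then sg k * u powi k else 0)"
      unfolding fps_sum_nth theta_term_def
      by (intro sum.cong) (use theta_exponent_ge(2)[OF mu s] in \<open>auto simp: nat_eq_iff\<close>)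
    also have "\<dots> = (\<Sum>k\<in>{k \<in> {- int N..int N}. ?e k = int i}. sg k * u powi k)"
      by (rule sum.inter_filter[symmetric]) simp
    also have "{k \<in> {- int N..int N}. ?e k = int i} = {k \<in> UNIV. ?e k = int i}"
    proof -
      have "- int N \<le> k \<and> k \<le> int N" if "?e k = int i" for k
        using theta_exponent_ge(1)[OF mu s, of k] i that unfolding N_def by linarith
      then show ?thesis by auto
    qed
    finally show "fps_nth (\<Sum>k\<in>{- int N..int N}. theta_term k) i = fps_nth (theta u s \<mu>) i"
      by (simp add: theta_def gsum_nth)
  qed
  finally show "eqm n (theta u s \<mu>) (qprod u s (2 * \<mu>) * qprod (1 / u) (2 * \<mu> - s) (2 * \<mu>) * qprod 1 (2 * \<mu>) (2 * \<mu>))"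
    unfolding Q_def by (rule eqm_sym)
qed

end

section \<open>Winquist's identity\<close>

lemma sg_add: "sg (a + b) = sg a * sg b"
  by (auto simp: sg_def)

lemma sg_add_even: "sg (a + 2 * b) = sg a"
  by (simp add: sg_def)

lemma sg_one_minus: "sg (1 - a) = - sg a"
  by (simp add: sg_def)

text \<open>The squared expression is one coordinate of the lattice sum. For
  \<open>\<kappa> = 1\<close>, \<open>i = 0\<close> it runs through a class modulo 6; for
  \<open>\<kappa> = 11\<close> it runs through a class modulo 66, which is the refinement by
  residues modulo 11.\<close>

definition sq_series :: "complex \<Rightarrow> nat \<Rightarrow> nat \<Rightarrow> int \<Rightarrow> complex fps" where
  "sq_series u \<kappa> i c = gsum UNIV (\<lambda>M. (int \<kappa> * (6 * M + c) + 6 * int i)\<^sup>2) (\<lambda>M. sg M * u powi (6 * M + c))"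

lemma abs_le_square_int: "\<bar>x\<bar> \<le> (x::int)\<^sup>2"
proof (cases "x = 0")
  case False
  then have "1 * \<bar>x\<bar> \<le> \<bar>x\<bar> * \<bar>x\<bar>" by (intro mult_right_mono) auto
  then show ?thesis by (simp add: power2_eq_square)
qed auto

lemma adm_square:
  assumes "0 < a"
  shows "adm UNIV (\<lambda>M::int. (a * M + b)\<^sup>2)"
proof (rule adm_int[of _ _ "\<bar>b\<bar>"])
  fix M :: int
  have "1 * \<bar>M\<bar> \<le> a * \<bar>M\<bar>" using assms by (intro mult_right_mono) auto
  also have "\<dots> = \<bar>a * M\<bar>" using assms by (simp add: abs_mult)
  also have "\<bar>a * M\<bar> \<le> \<bar>a * M + b\<bar> + \<bar>b\<bar>" by linarith
  finally show "\<bar>M\<bar> \<le> (a * M + b)\<^sup>2 + \<bar>b\<bar>" using abs_le_square_int[of "a * M + b"] by linarith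
qed auto

lemma adm_sq_series:
  assumes "0 < \<kappa>"
  shows "adm UNIV (\<lambda>M. (int \<kappa> * (6 * M + c) + 6 * int i)\<^sup>2)"
  using adm_square[of "6 * int \<kappa>" "int \<kappa> * c + 6 * int i"] assms by (simp add: algebra_simps)

lemma sq_series_shift:
  "sq_series u \<kappa> i (c + 6) = - sq_series u \<kappa> i c"
proof -
  have b: "bij_betw (\<lambda>M::int. M - 1) UNIV UNIV"
    by (rule bij_betwI[of _ _ _ "\<lambda>M. M + 1"]) auto
  have "sq_series u \<kappa> i (c + 6) = gsum UNIV (\<lambda>M. (int \<kappa> * (6 * M + c) + 6 * int i)\<^sup>2) (\<lambda>M. (-1) * (sg M * u powi (6 * M + c)))"
    unfolding sq_series_def
  proof (subst gsum_reindex[OF b], rule gsum_cong)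
    fix M :: int
    have *: "6 * (M - 1) + (c + 6) = 6 * M + c" by simp
    show "(int \<kappa> * (6 * (M - 1) + (c + 6)) + 6 * int i)\<^sup>2 = (int \<kappa> * (6 * M + c) + 6 * int i)\<^sup>2"
      unfolding * ..
    show "sg (M - 1) * u powi (6 * (M - 1) + (c + 6)) = (-1) * (sg M * u powi (6 * M + c))"
      unfolding * by (simp add: sg_def)
  qed
  also have "\<dots> = - sq_series u \<kappa> i c"
    unfolding gsum_const_mult[symmetric] sq_series_def by (simp flip: fps_const_neg)
  finally show ?thesis .
qed

lemma gsum_mult4:
  assumes "adm I1 e1" "adm I2 e2" "adm I3 e3" "adm I4 e4"
  shows "gsum I1 e1 c1 * gsum I2 e2 c2 * (gsum I3 e3 c3 * gsum I4 e4 c4) =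
    gsum ((I1 \<times> I2) \<times> (I3 \<times> I4)) (\<lambda>((a, b), (c, d)). e1 a + e2 b + (e3 c + e4 d))
      (\<lambda>((a, b), (c, d)). c1 a * c2 b * (c3 c * c4 d))"
  unfolding gsum_mult[OF assms(1,2)] gsum_mult[OF assms(3,4)]
    gsum_mult[OF adm_Times[OF assms(1,2)] adm_Times[OF assms(3,4)]]
  by (rule gsum_cong) auto

lemma adm_mult4:
  assumes "adm I1 e1" "adm I2 e2" "adm I3 e3" "adm I4 e4"
  shows "adm ((I1 \<times> I2) \<times> (I3 \<times> I4)) (\<lambda>((a, b), (c, d)). e1 a + e2 b + (e3 c + e4 d))"
proof -
  have "(\<lambda>((a, b), (c, d)). e1 a + e2 b + (e3 c + e4 d)) = (\<lambda>(i, j). (case i of (a, b) \<Rightarrow> e1 a + e2 b) + (case j of (c, d) \<Rightarrow> e3 c + e4 d))"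
    by auto
  then show ?thesis
    using adm_Times[OF adm_Times[OF assms(1,2)] adm_Times[OF assms(3,4)]] by simp
qed

text \<open>The residues 2a, 4a and 6a modulo 6a exhaust the multiples of 2a, so the triple product
  collapses to one product; the two values of \<open>s\<close> merely exchange its first two
  factors.\<close>

lemma euler_pentagonal:
  assumes "0 < a" "s = 2 * a \<or> s = 4 * a"
  shows "theta 1 s (3 * a) = qprod 1 (2 * a) (2 * a)"
proof -
  have "qprod (1::complex) (2 * a) (2 * a) = (\<Prod>j<3. qprod 1 (2 * a + 2 * a * j) (2 * a * 3))"
    using assms by (intro qprod_split) auto
  also have "\<dots> = qprod 1 (2 * a) (6 * a) * qprod 1 (4 * a) (6 * a) * qprod 1 (6 * a) (6 * a)"
    by (simp add: numeral_3_eq_3 eval_nat_numeral algebra_simps)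
  finally show ?thesis
    using assms by (subst jacobi_triple_product) (auto simp: algebra_simps)
qed

text \<open>The coefficient vectors of \<open>M\<close>, \<open>P\<close>, \<open>x\<close>,
  \<open>y\<close> are (1,0,1,1), (0,1,1,-1), (-1,-1,1,0), (-1,1,0,1): pairwise orthogonal, of
  squared length 3. They span a sublattice of index 9 whose cosets are labelled by
  \<open>(r, s)\<close>, and they diagonalize the quadratic form. The offset \<open>\<delta>\<close>
  only recentres \<open>x\<close>.\<close>

definition lattice_map :: "int \<Rightarrow> int \<Rightarrow> int \<Rightarrow> (int \<times> int) \<times> (int \<times> int) \<Rightarrow> (int \<times> int) \<times> (int \<times> int)" where
  "lattice_map r s \<delta> = (\<lambda>((M, P), (x, y)).
     ((r - (x + \<delta>) - y + M, s - (x + \<delta>) + y + P), (x + \<delta> + M + P, y + M - P)))"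

text \<open>The forms k + m + n and l + m - n are the inner products with the first two vectors and
  take the values 3M + r and 3P + s. Division by 3 thus recovers \<open>M\<close> and
  \<open>P\<close>, after which \<open>x\<close> and \<open>y\<close> are read off from
  \<open>m\<close> and \<open>n\<close>.\<close>

lemma bij_lattice_map:
  assumes "r \<in> {0, 1, 2}" "s \<in> {0, 1, 2}"
  shows "bij_betw (lattice_map r s \<delta>) UNIV
    {p \<in> UNIV. (case p of ((k, l), (m, n)) \<Rightarrow> ((k + m + n) mod 3, (l + m - n) mod 3)) = (r, s)}"
proof -
  define g :: "(int \<times> int) \<times> (int \<times> int) \<Rightarrow> (int \<times> int) \<times> (int \<times> int)" where
    "g = (\<lambda>((k, l), (m, n)). let M = (k + m + n) div 3; P = (l + m - n) div 3
      in ((M, P), (m - M - P - \<delta>, n - M + P)))"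
  let ?C = "{p \<in> UNIV. (case p of ((k, l), (m, n)) \<Rightarrow> ((k + m + n) mod 3, (l + m - n) mod 3)) = (r, s)}"
  have 1: "(M + (M + (M + r))) div 3 = M" "(M + (M + (M + r))) mod 3 = r"
     "(M + (M + (M + s))) div 3 = M" "(M + (M + (M + s))) mod 3 = s"
     "(r + M * 3) div 3 = M" "(r + M * 3) mod 3 = r"
     "(s + M * 3) div 3 = M" "(s + M * 3) mod 3 = s" for M
    using assms by auto
  show ?thesis
  proof (rule bij_betwI[where g = g])
    show "lattice_map r s \<delta> \<in> UNIV \<rightarrow> ?C"
      using 1 by (auto simp: lattice_map_def algebra_simps)
    show "g (lattice_map r s \<delta> p) = p" for p
      using 1 by (cases p) (auto simp: g_def lattice_map_def Let_def algebra_simps)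
    show "lattice_map r s \<delta> (g p) = p" if p: "p \<in> ?C" for p
    proof -
      obtain k l m n where klmn: "p = ((k, l), (m, n))" by (metis surj_pair)
      define M P where "M = (k + m + n) div 3" and "P = (l + m - n) div 3"
      have kl: "k + m + n = 3 * M + r" "l + m - n = 3 * P + s"
        using p klmn by (auto simp: M_def P_def)
      have g: "g p = ((M, P), (m - M - P - \<delta>, n - M + P))"
        unfolding klmn g_def M_def P_def by (simp add: Let_def)
      show ?thesis
        unfolding g by (simp add: lattice_map_def klmn) (use kl in linarith)
    qed
  qed simp
qed

text \<open>
  Expanding the four theta series gives a sum over \<open>(k, l, m, n)\<close>. On each class of \<open>k + m + n\<close> and
  \<open>l + m - n\<close> modulo 3 the quadratic form splits into four one-variable forms; five of the nine classes
  cancel under a reflection, and in the other four two of the factors are Euler's pentagonal series.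
\<close>

theorem winquist:
  fixes u v :: complex and \<kappa> i j :: nat
  assumes uv: "u \<noteq> 0" "v \<noteq> 0" and ij: "0 < \<kappa>" "j \<le> i" "i + j \<le> \<kappa>"
  defines "P \<equiv> qprod 1 (24 * \<kappa>\<^sup>2) (24 * \<kappa>\<^sup>2)"
  shows "fps_X ^ (10 * \<kappa>\<^sup>2 + 36 * i\<^sup>2 + 36 * j\<^sup>2) *
      (theta (u\<^sup>2) (24 * \<kappa> * i) (12 * \<kappa>\<^sup>2) * theta (v\<^sup>2) (24 * \<kappa> * j) (12 * \<kappa>\<^sup>2) *
       (theta (u\<^sup>2 * v\<^sup>2) (24 * \<kappa> * (i + j)) (12 * \<kappa>\<^sup>2) * theta (u\<^sup>2 / v\<^sup>2) (24 * \<kappa> * (i - j)) (12 * \<kappa>\<^sup>2)))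
    = fps_const (u ^ 3 * v) * fps_X ^ (36 * \<kappa> * i + 12 * \<kappa> * j) * P\<^sup>2 *
      (sq_series u \<kappa> i (-3) * (sq_series v \<kappa> j (-1) - sq_series v \<kappa> j 1)
        - (sq_series u \<kappa> i (-1) - sq_series u \<kappa> i 1) * sq_series v \<kappa> j (-3))"
proof -
  define K I J where "K = int \<kappa>" and "I = int i" and "J = int j"
  define E where "E = (\<lambda>((k, l), (m, n)). 12 * K\<^sup>2 * (k * (k - 1) + l * (l - 1) + m * (m - 1) + n * (n - 1))
    + 24 * K * I * (k + m + n) + 24 * K * J * (l + m - n) + (10 * K\<^sup>2 + 36 * I\<^sup>2 + 36 * J\<^sup>2))"
  define c where "c = (\<lambda>((k, l), (m, n)). sg (k + l + m + n) * u powi (2 * (k + m + n)) * v powi (2 * (l + m - n)))"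
  have bound: "24 * \<kappa> * a \<le> 2 * (12 * \<kappa>\<^sup>2)" if "a \<le> \<kappa>" for a
    using that by (simp add: power2_eq_square)
  have mu: "0 < 12 * \<kappa>\<^sup>2" using ij by simp
  have adms: "adm UNIV (\<lambda>k. int (12 * \<kappa>\<^sup>2) * (k * (k - 1)) + int (24 * \<kappa> * a) * k)" if "a \<le> \<kappa>" for a
    by (rule adm_theta[OF mu bound[OF that]])
  have le: "i \<le> \<kappa>" "j \<le> \<kappa>" "i + j \<le> \<kappa>" "i - j \<le> \<kappa>" using ij by auto
  let ?C = "10 * \<kappa>\<^sup>2 + 36 * i\<^sup>2 + 36 * j\<^sup>2" and ?B = "36 * \<kappa> * i + 12 * \<kappa> * j"
  define F where "F = (\<lambda>((k, l), (m, n)). (int (12 * \<kappa>\<^sup>2) * (k * (k - 1)) + int (24 * \<kappa> * i) * k)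
      + (int (12 * \<kappa>\<^sup>2) * (l * (l - 1)) + int (24 * \<kappa> * j) * l)
      + ((int (12 * \<kappa>\<^sup>2) * (m * (m - 1)) + int (24 * \<kappa> * (i + j)) * m)
      + (int (12 * \<kappa>\<^sup>2) * (n * (n - 1)) + int (24 * \<kappa> * (i - j)) * n)))"
  have admF: "adm UNIV F"
    using adm_mult4[OF adms[OF le(1)] adms[OF le(2)] adms[OF le(3)] adms[OF le(4)]] by (simp add: F_def)
  have FE: "F p + int ?C = E p" for p
    unfolding F_def E_def K_def I_def J_def using ij by (auto simp: split_def algebra_simps of_nat_diff)
  have th: "theta (u\<^sup>2) (24 * \<kappa> * i) (12 * \<kappa>\<^sup>2) * theta (v\<^sup>2) (24 * \<kappa> * j) (12 * \<kappa>\<^sup>2) *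
       (theta (u\<^sup>2 * v\<^sup>2) (24 * \<kappa> * (i + j)) (12 * \<kappa>\<^sup>2) * theta (u\<^sup>2 / v\<^sup>2) (24 * \<kappa> * (i - j)) (12 * \<kappa>\<^sup>2))
     = gsum UNIV F c"
  proof -
    have "(case p of ((k, l), (m, n)) \<Rightarrow> sg k * (u\<^sup>2) powi k * (sg l * (v\<^sup>2) powi l)
       * (sg m * (u\<^sup>2 * v\<^sup>2) powi m * (sg n * (u\<^sup>2 / v\<^sup>2) powi n))) = c p" for p
    proof -
      obtain k l m n where [simp]: "p = ((k, l), (m, n))" by (metis surj_pair)
      have "u powi (2 * (k + m + n)) = (u\<^sup>2) powi k * (u\<^sup>2) powi m * (u\<^sup>2) powi n"
        using uv by (simp add: power_int_mult power_int_add)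
      moreover have "v powi (2 * (l + m - n)) = (v\<^sup>2) powi l * (v\<^sup>2) powi m / (v\<^sup>2) powi n"
        using uv by (simp add: power_int_mult power_int_add power_int_diff)
      ultimately show ?thesis
        by (simp add: c_def sg_add power_int_mult_distrib power_int_divide_distrib)
    qed
    then show ?thesis
      unfolding theta_def gsum_mult4[OF adms[OF le(1)] adms[OF le(2)] adms[OF le(3)] adms[OF le(4)]] UNIV_Times_UNIV F_def
      by (intro gsum_cong) auto
  qed
  have thE: "fps_X ^ ?C * gsum UNIV F c = gsum UNIV E c"
    unfolding gsum_X_power_mult[OF admF] FE ..
  have admE: "adm UNIV E"
  proof (rule admI)
    show "0 \<le> E p" for p
      using adm_nonneg[OF admF UNIV_I, of p] FE[of p] of_nat_0_le_iff[of ?C, where 'a = int] by linarith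
    show "finite {p \<in> UNIV. E p = n}" for n
      using adm_finite[OF admF, of "n - int ?C"] FE by (simp add: eq_diff_eq)
  qed
  define cls where "cls r s = gsum {p \<in> UNIV. (case p of ((k, l), (m, n)) \<Rightarrow> ((k + m + n) mod 3, (l + m - n) mod 3)) = (r, s)} E c"
    for r s
  have cls: "cls r s = gsum UNIV (\<lambda>p. E (lattice_map r s \<delta> p)) (\<lambda>p. c (lattice_map r s \<delta> p))"
    if "r \<in> {0, 1, 2}" "s \<in> {0, 1, 2}" for r s \<delta>
    unfolding cls_def by (rule gsum_reindex[OF bij_lattice_map[OF that]])
  have total: "gsum UNIV E c = (\<Sum>(r, s)\<in>{0, 1, 2} \<times> {0, 1, 2}. cls r s)"
  proof -
    have "x mod 3 = 0 \<or> x mod 3 = 1 \<or> x mod 3 = 2" for x :: int by presburger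
    then show ?thesis unfolding cls_def
      by (subst gsum_partition[OF admE, of "{0, 1, 2} \<times> {0, 1, 2}"
            "\<lambda>((k, l), (m, n)). ((k + m + n) mod 3, (l + m - n) mod 3)"])
         (auto simp: split_def intro!: sum.cong)
  qed
  define hx :: "(int \<times> int) \<times> (int \<times> int) \<Rightarrow> (int \<times> int) \<times> (int \<times> int)" where
    "hx = (\<lambda>((M, P), (x, y)). ((M, P), (1 - x, y)))"
  have cval: "c (lattice_map r s \<delta> ((M, P), (x, y))) =
      sg (r + s + \<delta>) * sg M * sg P * sg x * sg y * u powi (2 * (3 * M + r)) * v powi (2 * (3 * P + s))" for r s \<delta> M P x y
  proof -
    have e: "r - (x + \<delta>) - y + M + (s - (x + \<delta>) + y + P) + (x + \<delta> + M + P) + (y + M - P)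
        = ((r + s + \<delta>) + M + P + x + y) + 2 * (M - \<delta> - x)"
      "r - (x + \<delta>) - y + M + (x + \<delta> + M + P) + (y + M - P) = 3 * M + r"
      "s - (x + \<delta>) + y + P + (x + \<delta> + M + P) - (y + M - P) = 3 * P + s"
      by simp_all
    show ?thesis
      unfolding c_def lattice_map_def prod.case e sg_add_even sg_add[of _ y] sg_add[of _ x] sg_add[of _ P] sg_add[of _ M] by simp
  qed
  \<comment> \<open>\<open>Q\<close> is the part of the exponent carrying the factor
    \<open>12 * K\<^sup>2\<close>. It has no mixed terms, and its linear coefficients in
    \<open>x\<close> and \<open>y\<close> decide which classes cancel.\<close>
  define Q where "Q r s x y M P = 3 * (M * (M - 1)) + 2 * M * r + 3 * (P * (P - 1)) + 2 * P * (s + 1) + r * (r - 1) + s * (s - 1)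
      + (3 * (x * x) + (1 - 2 * r - 2 * s) * x) + (3 * (y * y) + (2 * s - 2 * r - 1) * y)" for r s x y M P :: int
  have Eval: "E (lattice_map r s \<delta> ((M, P), (x, y))) = 12 * K\<^sup>2 * Q r s (x + \<delta>) y M P
      + 24 * K * I * (3 * M + r) + 24 * K * J * (3 * P + s) + (10 * K\<^sup>2 + 36 * I\<^sup>2 + 36 * J\<^sup>2)" for r s \<delta> M P x y
  proof -
    define z where "z = x + \<delta>"
    have "(r - z - y + M) * (r - z - y + M - 1) + (s - z + y + P) * (s - z + y + P - 1)
        + (z + M + P) * (z + M + P - 1) + (y + M - P) * (y + M - P - 1) = Q r s z y M P"
      unfolding Q_def by algebra
    moreover have "r - z - y + M + (z + M + P) + (y + M - P) = 3 * M + r"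
      "s - z + y + P + (z + M + P) - (y + M - P) = 3 * P + s"
      by simp_all
    ultimately show ?thesis
      unfolding E_def lattice_map_def prod.case z_def by (simp only:)
  qed
  define hy :: "(int \<times> int) \<times> (int \<times> int) \<Rightarrow> (int \<times> int) \<times> (int \<times> int)" where
    "hy = (\<lambda>((M, P), (x, y)). ((M, P), (x, 1 - y)))"
  \<comment> \<open>When r + s = 2, the x-part is 3x(x - 1), invariant under x -> 1 - x, whereas the
    sign changes.\<close>
  have vanish1: "cls r s = 0" if rs: "r \<in> {0, 1, 2}" "s \<in> {0, 1, 2}" "r + s = 2" for r s
    unfolding cls[OF rs(1,2), of 0]
  proof (rule gsum_involution[where h = hx])
    show "bij_betw hx UNIV UNIV"
      by (rule bij_betwI[where g = hx]) (auto simp: hx_def)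
    have s: "s = 2 - r" using rs by simp
    show "E (lattice_map r s 0 (hx p)) = E (lattice_map r s 0 p)" for p
    proof -
      obtain M P x y where p: "p = ((M, P), (x, y))" by (metis surj_pair)
      have "Q r s (1 - x + 0) y M P = Q r s (x + 0) y M P"
        unfolding Q_def s by algebra
      then show ?thesis
        unfolding p hx_def prod.case Eval by (simp only:)
    qed
    show "c (lattice_map r s 0 (hx p)) = - c (lattice_map r s 0 p)" for p
      by (auto simp: hx_def hy_def cval sg_one_minus split: prod.splits)
  qed
  \<comment> \<open>When r = s + 1, the y-part is 3y(y - 1), and the reflection y -> 1 - y cancels
    the class.\<close>
  have vanish2: "cls r s = 0" if rs: "r \<in> {0, 1, 2}" "s \<in> {0, 1, 2}" "r = s + 1" for r s
    unfolding cls[OF rs(1,2), of 0]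
  proof (rule gsum_involution[where h = hy])
    show "bij_betw hy UNIV UNIV"
      by (rule bij_betwI[where g = hy]) (auto simp: hy_def)
    show "E (lattice_map r s 0 (hy p)) = E (lattice_map r s 0 p)" for p
    proof -
      obtain M P x y where p: "p = ((M, P), (x, y))" by (metis surj_pair)
      have "Q r s (x + 0) (1 - y) M P = Q r s (x + 0) y M P"
        unfolding Q_def rs(3) by algebra
      then show ?thesis
        unfolding p hy_def prod.case Eval by (simp only:)
    qed
    show "c (lattice_map r s 0 (hy p)) = - c (lattice_map r s 0 p)" for p
      by (auto simp: hx_def hy_def cval sg_one_minus split: prod.splits)
  qed
  have adm_pent: "adm UNIV (\<lambda>k. int (36 * \<kappa>\<^sup>2) * (k * (k - 1)) + int t * k)"
    if "t \<in> {24 * \<kappa>\<^sup>2, 48 * \<kappa>\<^sup>2}" for t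
    using that ij by (intro adm_theta) auto
  have pent: "theta 1 t (36 * \<kappa>\<^sup>2) = P" if "t \<in> {24 * \<kappa>\<^sup>2, 48 * \<kappa>\<^sup>2}" for t
    using euler_pentagonal[of "12 * \<kappa>\<^sup>2" t] that ij by (auto simp: P_def)
  have factor: "cls r s = fps_const (sg (r + s + \<delta>) * (u ^ 3 * v)) * fps_X ^ ?B * P\<^sup>2 *
      (sq_series u \<kappa> i (2 * r - 3) * sq_series v \<kappa> j (2 * s - 1))"
    if rs: "r \<in> {0, 1, 2}" "s \<in> {0, 1, 2}" and t: "t \<in> {24 * \<kappa>\<^sup>2, 48 * \<kappa>\<^sup>2}" "t' \<in> {24 * \<kappa>\<^sup>2, 48 * \<kappa>\<^sup>2}"
      and expo: "\<And>M P x y. E (lattice_map r s \<delta> ((M, P), (x, y))) =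
         (K * (6 * M + (2 * r - 3)) + 6 * I)\<^sup>2 + (K * (6 * P + (2 * s - 1)) + 6 * J)\<^sup>2
         + ((36 * K\<^sup>2 * (x * (x - 1)) + int t * x) + (36 * K\<^sup>2 * (y * (y - 1)) + int t' * y)) + (36 * K * I + 12 * K * J)"
    for r s \<delta> t t'
  proof -
    note A = adm_sq_series[OF ij(1), of "2 * r - 3" i] adm_sq_series[OF ij(1), of "2 * s - 1" j] adm_pent[OF t(1)] adm_pent[OF t(2)]
    have "fps_const (sg (r + s + \<delta>) * (u ^ 3 * v)) * (fps_X ^ ?B *
      (sq_series u \<kappa> i (2 * r - 3) * sq_series v \<kappa> j (2 * s - 1) * (theta 1 t (36 * \<kappa>\<^sup>2) * theta 1 t' (36 * \<kappa>\<^sup>2))))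
      = cls r s"
      unfolding sq_series_def theta_def gsum_mult4[OF A]
      unfolding gsum_X_power_mult[OF adm_mult4[OF A]] gsum_const_mult cls[OF rs, of \<delta>]
      unfolding UNIV_Times_UNIV
    proof (rule gsum_cong, goal_cases)
      case (1 p)
      obtain M P x y where p: "p = ((M, P), (x, y))" by (metis surj_pair)
      show ?case
        unfolding p expo by (simp add: K_def I_def J_def)
    next
      case (2 p)
      obtain M P x y where p: "p = ((M, P), (x, y))" by (metis surj_pair)
      have "u powi (2 * (3 * M + r)) = u ^ 3 * u powi (6 * M + (2 * r - 3))"
        using uv power_int_add[of u 3 "6 * M + (2 * r - 3)"] by (simp add: algebra_simps)
      moreover have "v powi (2 * (3 * P + s)) = v * v powi (6 * P + (2 * s - 1))"
        using uv power_int_add[of v 1 "6 * P + (2 * s - 1)"] by (simp add: algebra_simps)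
      moreover have "c (lattice_map r s \<delta> p) = sg (r + s + \<delta>) * sg M * sg P * sg x * sg y * u powi (2 * (3 * M + r)) * v powi (2 * (3 * P + s))"
        unfolding p by (rule cval)
      ultimately show ?case
        unfolding p by simp
    qed
    then show ?thesis
      unfolding pent[OF t(1)] pent[OF t(2)] by (simp add: power2_eq_square ac_simps)
  qed
  \<comment> \<open>In the surviving classes the y-coefficient 2s - 2r - 1 is 1 or -1, giving
    \<open>48 * \<kappa>\<^sup>2\<close> or \<open>24 * \<kappa>\<^sup>2\<close>. The x-coefficient
    1 - 2r - 2s is so only for r + s at most 1; for r + s = 3, 4 it is -5, -7, and the offset
    \<open>\<delta> = 1\<close> turns it into 1, -1.\<close>
  note Elm = Eval Q_def K_def[symmetric] of_nat_mult of_nat_power of_nat_numeral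
  have c00: "cls 0 0 = fps_const (u ^ 3 * v) * fps_X ^ ?B * P\<^sup>2 * (sq_series u \<kappa> i (-3) * sq_series v \<kappa> j (-1))"
    by (subst factor[of 0 0 "48 * \<kappa>\<^sup>2" "24 * \<kappa>\<^sup>2" 0]) (simp_all add: Elm, simp_all add: sg_def algebra_simps power2_eq_square)
  have c01: "cls 0 1 = - (fps_const (u ^ 3 * v) * fps_X ^ ?B * P\<^sup>2 * (sq_series u \<kappa> i (-3) * sq_series v \<kappa> j 1))"
    by (subst factor[of 0 1 "24 * \<kappa>\<^sup>2" "48 * \<kappa>\<^sup>2" 0]) (simp_all add: Elm, simp_all add: sg_def algebra_simps power2_eq_square flip: fps_const_neg)
  have c12: "cls 1 2 = fps_const (u ^ 3 * v) * fps_X ^ ?B * P\<^sup>2 * (sq_series u \<kappa> i (-1) * sq_series v \<kappa> j 3)"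
    by (subst factor[of 1 2 "48 * \<kappa>\<^sup>2" "48 * \<kappa>\<^sup>2" 1]) (simp_all add: Elm, simp_all add: sg_def algebra_simps power2_eq_square)
  have c22: "cls 2 2 = - (fps_const (u ^ 3 * v) * fps_X ^ ?B * P\<^sup>2 * (sq_series u \<kappa> i 1 * sq_series v \<kappa> j 3))"
    by (subst factor[of 2 2 "24 * \<kappa>\<^sup>2" "24 * \<kappa>\<^sup>2" 1]) (simp_all add: Elm, simp_all add: sg_def algebra_simps power2_eq_square flip: fps_const_neg)
  have v3: "sq_series v \<kappa> j 3 = - sq_series v \<kappa> j (-3)"
    using sq_series_shift[of v \<kappa> j "-3"] by simp
  have "{0, 1, 2} \<times> {0, 1, 2} = {(0, 0), (0, 1), (0, 2), (1, 0), (1, 1), (1, 2), (2, 0), (2, 1), (2, 2) :: int \<times> int}"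
    by auto
  then have "gsum UNIV E c = cls 0 0 + cls 0 1 + cls 1 2 + cls 2 2"
    unfolding total by (simp add: vanish1 vanish2)
  then show ?thesis
    unfolding th thE c00 c01 c12 c22 v3 by (simp add: algebra_simps)
qed

section \<open>The crank generating function\<close>

declare of_nat_sum_mset [simp del]

lemma sum_mset_ge:
  fixes P :: "nat multiset"
  shows "x \<in># P \<Longrightarrow> x \<le> sum_mset P"
  by (induction P) auto

lemma size_le_sum_mset:
  fixes P :: "nat multiset"
  shows "\<forall>x\<in>#P. 0 < x \<Longrightarrow> size P \<le> sum_mset P"
  by (induction P) force+

lemma finite_partitions: "finite (partitions n)"
proof -
  have "partitions n \<subseteq> mset ` {xs. set xs \<subseteq> {..n} \<and> length xs \<le> n}"
  proof
    fix P assume P: "P \<in> partitions n"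
    obtain xs where xs: "P = mset xs" by (metis ex_mset)
    have "set xs \<subseteq> {..n}" "length xs \<le> n"
      using P sum_mset_ge[of _ P] size_le_sum_mset[of P] by (auto simp: xs partitions_def)
    then show "P \<in> mset ` {xs. set xs \<subseteq> {..n} \<and> length xs \<le> n}"
      using xs by auto
  qed
  then show ?thesis
    using finite_lists_length_le[of "{..n}" n] finite_subset by blast
qed

section \<open>Weighted partition series and the q-binomial theorem\<close>

definition part_gf :: "nat set \<Rightarrow> (nat \<Rightarrow> complex) \<Rightarrow> complex fps" where
  "part_gf A w = gsum {P. set_mset P \<subseteq> A} (\<lambda>P. int (sum_mset P)) (\<lambda>P. prod_mset (image_mset w P))"

lemma adm_part_gf:
  assumes "0 \<notin> A"
  shows "adm {P. set_mset P \<subseteq> A} (\<lambda>P. int (sum_mset P))"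
proof (rule admI)
  fix n
  have "{P \<in> {P. set_mset P \<subseteq> A}. int (sum_mset P) = n} \<subseteq> partitions (nat n)"
    using assms by (auto simp: partitions_def intro!: Nat.gr0I)
  then show "finite {P \<in> {P. set_mset P \<subseteq> A}. int (sum_mset P) = n}"
    using finite_partitions finite_subset by blast
qed auto

text \<open>Either \<open>k\<close> does not occur as a part, or one copy of it can be removed at
  the cost of \<open>w k\<close> and \<open>q ^ k\<close>.\<close>

lemma part_gf_remove:
  assumes "0 \<notin> A" "k \<in> A"
  shows "part_gf A w * qfac (w k) k = part_gf (A - {k}) w"
proof -
  let ?I = "{P. set_mset P \<subseteq> A}" and ?e = "\<lambda>P. int (sum_mset P)" and ?c = "\<lambda>P. prod_mset (image_mset w P)"
  have "part_gf A w = gsum {P \<in> ?I. (k \<in># P) = True} ?e ?c + gsum {P \<in> ?I. (k \<in># P) = False} ?e ?c"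
    unfolding part_gf_def
    by (subst gsum_partition[OF adm_part_gf[OF assms(1)], of "{True, False}" "\<lambda>P. k \<in># P" ?c]) auto
  also have "{P \<in> ?I. (k \<in># P) = False} = {P. set_mset P \<subseteq> A - {k}}"
    by auto
  also have "gsum {P \<in> ?I. (k \<in># P) = True} ?e ?c = gsum ?I (\<lambda>P. ?e P + int k) (\<lambda>P. w k * ?c P)"
  proof -
    have "bij_betw (add_mset k) ?I {P \<in> ?I. (k \<in># P) = True}"
      by (rule bij_betwI[where g = "\<lambda>P. P - {#k#}"]) (use assms in \<open>auto dest: in_diffD\<close>)
    from gsum_reindex[OF this, of ?e ?c] show ?thesis by (simp add: add.commute)
  qed
  also have "\<dots> = fps_const (w k) * (fps_X ^ k * part_gf A w)"
    unfolding part_gf_def gsum_X_power_mult[OF adm_part_gf[OF assms(1)]] gsum_const_mult ..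
  finally have "part_gf A w = fps_const (w k) * (fps_X ^ k * part_gf A w) + part_gf (A - {k}) w"
    unfolding part_gf_def[of "A - {k}"] .
  then show ?thesis
    by (simp add: qfac_def right_diff_distrib diff_eq_eq ac_simps)
qed

lemma part_gf_remove_finite:
  assumes "finite B" "0 \<notin> A" "B \<subseteq> A"
  shows "part_gf A w * (\<Prod>k\<in>B. qfac (w k) k) = part_gf (A - B) w"
  using assms(1,3)
proof (induction B)
  case (insert k B)
  have "part_gf A w * (\<Prod>k\<in>insert k B. qfac (w k) k) = part_gf (A - B) w * qfac (w k) k"
    using insert by (simp add: ac_simps flip: insert.IH)
  also have "\<dots> = part_gf (A - B - {k}) w"
    using insert assms by (intro part_gf_remove) auto
  also have "A - B - {k} = A - insert k B" by auto
  finally show ?case .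
qed simp

lemma eqm_part_gf:
  assumes "A \<subseteq> {N..}" "0 \<notin> A"
  shows "eqm N (part_gf A w) 1"
  unfolding eqm_def
proof safe
  fix n assume n: "n < N"
  have "{P. P \<in> {P. set_mset P \<subseteq> A} \<and> int (sum_mset P) = int n} = (if n = 0 then {{#}} else {})"
  proof -
    have *: "P = {#}" if "set_mset P \<subseteq> A" "sum_mset P = n" for P
    proof (rule ccontr)
      assume "P \<noteq> {#}"
      then obtain x where "x \<in># P" by blast
      with that sum_mset_ge[of x P] assms n show False by auto
    qed
    have "(set_mset P \<subseteq> A \<and> int (sum_mset P) = int n) = (P = {#} \<and> n = 0)" for P
    proof
      assume "set_mset P \<subseteq> A \<and> int (sum_mset P) = int n"
      then have P: "set_mset P \<subseteq> A" "sum_mset P = n" by auto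
      then show "P = {#} \<and> n = 0" using *[OF P] by simp
    qed simp
    then show ?thesis by simp
  qed
  then show "fps_nth (part_gf A w) n = fps_nth 1 n"
    by (simp add: part_gf_def gsum_nth)
qed

text \<open>A truncated Cauchy identity: \<open>c n\<close> is (a;q)_n / (q;q)_n, and the series in
  t = vq is the quotient of the products for at and t. The recurrence of \<open>c\<close> amounts to
  T(t)(1 - t) = T(qt)(1 - at); iterating it moves t to order \<open>Suc M\<close>, where only the
  constant term is visible.\<close>

lemma q_binomial_theorem:
  fixes c :: "nat \<Rightarrow> 'a::comm_ring_1 fps"
  assumes c0: "c 0 = 1" and c: "\<And>n. c (Suc n) * (1 - fps_X ^ Suc n) = c n * (1 - a * fps_X ^ n)"
  shows "eqm (Suc M) ((\<Sum>n\<le>M. c n * (fps_const v * fps_X) ^ n) * (\<Prod>k<M. qfac v (Suc k)))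
    (\<Prod>k<M. 1 - a * fps_const v * fps_X ^ Suc k)"
proof -
  define \<tau> where "\<tau> k = fps_const v * fps_X ^ Suc k" for k
  define T where "T k = (\<Sum>n\<le>M. c n * \<tau> k ^ n)" for k
  have pow: "\<tau> k ^ n = fps_X ^ (Suc k * n) * fps_const v ^ n" for k n
    by (simp add: \<tau>_def power_mult_distrib power_mult[symmetric] power_add mult.commute)
  \<comment> \<open>Cutting the series at \<open>M\<close> spoils the functional equation only by a
    multiple of \<tau>^(M + 1), which starts at order \<open>Suc M\<close> or later.\<close>
  have step: "eqm (Suc M) (T k * (1 - \<tau> k)) (T (Suc k) * (1 - a * \<tau> k))" for k
  proof -
    have \<tau>Suc: "\<tau> (Suc k) ^ n = \<tau> k ^ n * fps_X ^ n" for n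
      by (simp add: \<tau>_def power_mult_distrib algebra_simps)
    have tel: "(\<Sum>n\<le>m. c n * (1 - fps_X ^ n) * \<tau> k ^ n) + \<tau> k ^ Suc m * (c m * (1 - a * fps_X ^ m))
        = \<tau> k * (\<Sum>n\<le>m. c n * (1 - a * fps_X ^ n) * \<tau> k ^ n)" for m
    proof (induction m)
      case (Suc m)
      have "(\<Sum>n\<le>Suc m. c n * (1 - fps_X ^ n) * \<tau> k ^ n)
          = (\<Sum>n\<le>m. c n * (1 - fps_X ^ n) * \<tau> k ^ n) + c (Suc m) * (1 - fps_X ^ Suc m) * \<tau> k ^ Suc m"
        by simp
      also have "\<dots> = \<tau> k * (\<Sum>n\<le>m. c n * (1 - a * fps_X ^ n) * \<tau> k ^ n)"
        unfolding c Suc.IH[symmetric] by (simp add: ac_simps)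
      finally show ?case by (simp add: algebra_simps)
    qed (simp add: c0)
    have "T k - T (Suc k) = (\<Sum>n\<le>M. c n * (1 - fps_X ^ n) * \<tau> k ^ n)"
      unfolding T_def \<tau>Suc by (simp add: algebra_simps sum_subtractf)
    moreover have "T k - a * T (Suc k) = (\<Sum>n\<le>M. c n * (1 - a * fps_X ^ n) * \<tau> k ^ n)"
      unfolding T_def \<tau>Suc by (simp add: algebra_simps sum_subtractf sum_distrib_left)
    ultimately have "T k - T (Suc k) + \<tau> k ^ Suc M * (c M * (1 - a * fps_X ^ M)) = \<tau> k * (T k - a * T (Suc k))"
      using tel[of M] by simp
    then have *: "T k * (1 - \<tau> k) + \<tau> k ^ Suc M * (c M * (1 - a * fps_X ^ M)) = T (Suc k) * (1 - a * \<tau> k)"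
      by (simp add: algebra_simps)
    have "eqm (Suc M) (\<tau> k ^ Suc M * (c M * (1 - a * fps_X ^ M))) 0"
      unfolding pow mult.assoc by (rule eqm_X_power) simp
    from eqm_add[OF eqm_refl this, of "T k * (1 - \<tau> k)"] show ?thesis
      unfolding * by (simp add: eqm_sym)
  qed
  have "eqm (Suc M) (T 0 * (\<Prod>k<K. 1 - \<tau> k)) (T K * (\<Prod>k<K. 1 - a * \<tau> k))" for K
  proof (induction K)
    case (Suc K)
    have "eqm (Suc M) (T 0 * (\<Prod>k<K. 1 - \<tau> k) * (1 - \<tau> K)) (T K * (\<Prod>k<K. 1 - a * \<tau> k) * (1 - \<tau> K))"
      by (rule eqm_mult[OF Suc eqm_refl])
    also have "\<dots> = T K * (1 - \<tau> K) * (\<Prod>k<K. 1 - a * \<tau> k)"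
      by (simp add: ac_simps)
    also have "eqm (Suc M) \<dots> (T (Suc K) * (1 - a * \<tau> K) * (\<Prod>k<K. 1 - a * \<tau> k))"
      by (rule eqm_mult[OF step eqm_refl])
    finally show ?case by (simp add: ac_simps)
  qed simp
  then have "eqm (Suc M) (T 0 * (\<Prod>k<M. 1 - \<tau> k)) (T M * (\<Prod>k<M. 1 - a * \<tau> k))" .
  also have "eqm (Suc M) \<dots> (1 * (\<Prod>k<M. 1 - a * \<tau> k))"
  proof (rule eqm_mult[OF _ eqm_refl])
    have "eqm (Suc M) (\<Sum>n\<le>M. c n * \<tau> M ^ n) (\<Sum>n\<le>M. if n = 0 then 1 else 0)"
    proof (rule eqm_sum)
      fix n
      show "eqm (Suc M) (c n * \<tau> M ^ n) (if n = 0 then 1 else 0)"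
      proof (cases n)
        case (Suc m)
        have "c n * \<tau> M ^ n = fps_X ^ (Suc M * n) * (fps_const v ^ n * c n)"
          unfolding pow by (simp add: ac_simps)
        then show ?thesis
          using eqm_X_power[of "Suc M" "Suc M * n" "fps_const v ^ n * c n"] Suc by simp
      qed (simp add: c0)
    qed
    then show "eqm (Suc M) (T M) 1" by (simp add: T_def)
  qed
  finally show ?thesis
    by (simp add: T_def \<tau>_def qfac_def mult.assoc)
qed

section \<open>Cranks of partitions sorted by ones and by largest part\<close>

definition crank_poly :: "complex \<Rightarrow> nat \<Rightarrow> complex" where
  "crank_poly z n = (\<Sum>m | crankM m n \<noteq> 0. of_int (crankM m n) * z powi m)"

lemma crank_support:
  "{m. crankM m n \<noteq> 0} = (if 2 \<le> n then crank ` partitions n else if n = 0 then {0} else {0, 1, -1})"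
  using finite_partitions[of n] by (auto simp: crankM_def)

lemma finite_crank_support: "finite {m. crankM m n \<noteq> 0}"
  unfolding crank_support using finite_partitions by simp

lemma crank_poly_0: "crank_poly z 0 = 1"
  unfolding crank_poly_def crank_support by (simp add: crankM_def)

lemma crank_poly_1: "crank_poly z 1 = z + 1 / z - 1"
  unfolding crank_poly_def crank_support by (simp add: crankM_def power_int_minus field_simps)

lemma crank_poly_ge_2:
  assumes "2 \<le> n"
  shows "crank_poly z n = (\<Sum>P\<in>partitions n. z powi crank P)"
proof -
  have "(\<Sum>P\<in>partitions n. z powi crank P) = (\<Sum>m\<in>crank ` partitions n. \<Sum>P\<in>{P \<in> partitions n. crank P = m}. z powi crank P)"
    by (rule sum.image_gen[OF finite_partitions])
  also have "\<dots> = (\<Sum>m\<in>crank ` partitions n. of_int (crankM m n) * z powi m)"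
    by (rule sum.cong) (use assms in \<open>auto simp: crankM_def\<close>)
  finally show ?thesis
    unfolding crank_poly_def crank_support using assms by simp
qed

lemma prod_mset_if:
  "prod_mset (image_mset (\<lambda>x. if Q x then z else 1) P) = z ^ size (filter_mset Q P)"
  by (induction P) auto

text \<open>The \<open>w\<close> ones are stripped and account for z^(-w). Since \<open>w\<close> is
  positive, all parts above \<open>w\<close> survive, and giving each of them the weight
  \<open>z\<close> records \<mu>.\<close>

lemma crank_sum_ones:
  assumes "0 < w" "z \<noteq> 0"
  shows "(\<Sum>P | P \<in> partitions n \<and> count P 1 = w. z powi crank P)
    = fps_nth (fps_const (z powi (- int w)) * (fps_X ^ w * part_gf {2..} (\<lambda>x. if w < x then z else 1))) n"
proof -
  have "(\<Sum>P | P \<in> partitions n \<and> count P 1 = w. z powi crank P)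
    = (\<Sum>P | P \<in> {P. set_mset P \<subseteq> {2..}} \<and> int (sum_mset P) + int w = int n.
         z powi (- int w) * prod_mset (image_mset (\<lambda>x. if w < x then z else 1) P))"
  proof (rule sum.reindex_bij_witness[of _ "\<lambda>P. replicate_mset w 1 + P" "\<lambda>P. filter_mset (\<lambda>x. x \<noteq> 1) P"])
    fix P assume "P \<in> {P. P \<in> partitions n \<and> count P 1 = w}"
    then have P: "\<forall>x\<in>#P. 0 < x" "sum_mset P = n" "count P 1 = w" by (auto simp: partitions_def)
    have split: "replicate_mset w 1 + filter_mset (\<lambda>x. x \<noteq> 1) P = P"
      using multiset_partition[of P "\<lambda>x. x = 1"] P(3) by (simp add: filter_eq_replicate_mset)
    then show "replicate_mset w 1 + filter_mset (\<lambda>x. x \<noteq> 1) P = P" .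
    have "sum_mset P = w + sum_mset (filter_mset (\<lambda>x. x \<noteq> 1) P)"
      by (subst split[symmetric]) (simp add: sum_mset_replicate_mset)
    moreover have "set_mset (filter_mset (\<lambda>x. x \<noteq> 1) P) \<subseteq> {2..}"
      using P(1) by force
    ultimately show "filter_mset (\<lambda>x. x \<noteq> 1) P \<in> {P. P \<in> {P. set_mset P \<subseteq> {2..}} \<and> int (sum_mset P) + int w = int n}"
      using P(2) by simp
    have "filter_mset (\<lambda>x. w < x) (filter_mset (\<lambda>x. x \<noteq> 1) P) = filter_mset (\<lambda>x. w < x) P"
      using assms by (auto simp: filter_filter_mset intro!: filter_mset_cong)
    then show "z powi (- int w) * prod_mset (image_mset (\<lambda>x. if w < x then z else 1) (filter_mset (\<lambda>x. x \<noteq> 1) P)) = z powi crank P"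
      unfolding prod_mset_if using P(3) assms by (simp add: crank_def Let_def power_int_diff power_int_minus field_simps)
  next
    fix P assume "P \<in> {P. P \<in> {P. set_mset P \<subseteq> {2..}} \<and> int (sum_mset P) + int w = int n}"
    then have P: "\<forall>x\<in>#P. 2 \<le> x" "sum_mset P + w = n" by auto
    then have "1 \<notin># P" by force
    moreover have "filter_mset (\<lambda>x. x \<noteq> 1) P = P"
      using P by (intro filter_mset_eq_conv[THEN iffD2]) auto
    ultimately show "filter_mset (\<lambda>x. x \<noteq> 1) (replicate_mset w 1 + P) = P"
       "replicate_mset w 1 + P \<in> {P. P \<in> partitions n \<and> count P 1 = w}"
      using P by (auto simp: partitions_def sum_mset_replicate_mset count_eq_zero_iff)
  qed
  then show ?thesis
    unfolding part_gf_def by (subst gsum_X_power_mult[OF adm_part_gf]) (simp_all add: gsum_nth sum_distrib_left)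
qed

text \<open>Without ones the crank is the largest part \<open>l\<close>; removing one copy of it
  leaves an arbitrary partition into parts from 2 to \<open>l\<close>.\<close>

lemma crank_sum_no_ones:
  assumes "2 \<le> l"
  shows "(\<Sum>P | P \<in> partitions n \<and> count P 1 = 0 \<and> P \<noteq> {#} \<and> Max_mset P = l. z powi crank P)
    = fps_nth (fps_const (z ^ l) * (fps_X ^ l * part_gf {2..l} (\<lambda>x. 1))) n"
proof -
  have "(\<Sum>P | P \<in> partitions n \<and> count P 1 = 0 \<and> P \<noteq> {#} \<and> Max_mset P = l. z powi crank P)
    = (\<Sum>P | P \<in> {P. set_mset P \<subseteq> {2..l}} \<and> int (sum_mset P) + int l = int n. z ^ l)"
  proof (rule sum.reindex_bij_witness[of _ "\<lambda>P. add_mset l P" "\<lambda>P. P - {#l#}"])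
    fix P assume "P \<in> {P. P \<in> partitions n \<and> count P 1 = 0 \<and> P \<noteq> {#} \<and> Max_mset P = l}"
    then have P: "\<forall>x\<in>#P. 0 < x" "sum_mset P = n" "1 \<notin># P" "P \<noteq> {#}" "Max_mset P = l" "count P 1 = 0"
      by (auto simp: partitions_def count_eq_zero_iff)
    have l: "l \<in># P" using P Max_in[of "set_mset P"] by auto
    then show "add_mset l (P - {#l#}) = P" by simp
    have "x \<in> {2..l}" if "x \<in># P" for x
    proof -
      have "x \<noteq> 0" "x \<noteq> 1" using that P by auto
      moreover have "x \<le> l" using that P Max_ge[of "set_mset P" x] by auto
      ultimately show ?thesis by auto
    qed
    moreover have "sum_mset P = l + sum_mset (P - {#l#})"
      using l by (simp flip: sum_mset.add_mset)
    ultimately show "P - {#l#} \<in> {P. P \<in> {P. set_mset P \<subseteq> {2..l}} \<and> int (sum_mset P) + int l = int n}"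
      using P(2) by (auto dest: in_diffD)
    show "z ^ l = z powi crank P"
      using P by (simp add: crank_def)
  next
    fix P assume "P \<in> {P. P \<in> {P. set_mset P \<subseteq> {2..l}} \<and> int (sum_mset P) + int l = int n}"
    then have P: "set_mset P \<subseteq> {2..l}" "sum_mset P + l = n" by auto
    have "Max (insert l (set_mset P)) = l"
      using P by (intro Max_eqI) auto
    moreover have "1 \<notin># P" using P by auto
    ultimately show "add_mset l P \<in> {P. P \<in> partitions n \<and> count P 1 = 0 \<and> P \<noteq> {#} \<and> Max_mset P = l}"
      using P assms by (auto simp: partitions_def count_eq_zero_iff)
  qed simp
  then show ?thesis
    unfolding part_gf_def by (subst gsum_X_power_mult[OF adm_part_gf]) (simp_all add: gsum_nth sum_distrib_left)
qed


text \<open>The leading polynomial encodes the conventional values for n = 0 and n = 1, except for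
  1/z at n = 1, which the term \<open>w = 1\<close> already produces. Larger \<open>l\<close> and
  \<open>w\<close> are invisible up to order \<open>N\<close>.\<close>

lemma eqm_crank_gf:
  assumes z: "z \<noteq> 0"
  shows "eqm (Suc N) (Abs_fps (crank_poly z))
    (1 - fps_X + fps_const z * fps_X
     + (\<Sum>l\<in>{2..N}. fps_const (z ^ l) * (fps_X ^ l * part_gf {2..l} (\<lambda>x. 1)))
     + (\<Sum>w\<in>{1..N}. fps_const (z powi (- int w)) * (fps_X ^ w * part_gf {2..} (\<lambda>x. if w < x then z else 1))))"
  (is "eqm _ _ (_ + sum ?L _ + sum ?W _)")
  unfolding eqm_def
proof safe
  fix n assume n: "n < Suc N"
  have L: "fps_nth (sum ?L {2..N}) n = (\<Sum>l\<in>{2..n}. fps_nth (?L l) n)"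
    unfolding fps_sum_nth using n by (intro sum.mono_neutral_right) (auto simp: fps_X_power_mult_nth)
  have W: "fps_nth (sum ?W {1..N}) n = (\<Sum>w\<in>{1..n}. fps_nth (?W w) n)"
    unfolding fps_sum_nth using n by (intro sum.mono_neutral_right) (auto simp: fps_X_power_mult_nth)
  consider "n = 0" | "n = 1" | "2 \<le> n" by linarith
  then show "fps_nth (Abs_fps (crank_poly z)) n
     = fps_nth (1 - fps_X + fps_const z * fps_X + sum ?L {2..N} + sum ?W {1..N}) n"
  proof cases
    case 1
    then show ?thesis using L W by (simp add: crank_poly_0)
  next
    case 2
    have "fps_nth (part_gf {2..} w) 0 = 1" for w
      using eqm_part_gf[of "{2..}" 2 w] by (simp add: eqm_def)
    then show ?thesis using 2 L W
      by (simp add: crank_poly_1[unfolded One_nat_def] power_int_minus field_simps)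
  next
    case 3
    let ?P0 = "{P \<in> partitions n. count P 1 = 0}" and ?P1 = "{P \<in> partitions n. count P 1 \<noteq> 0}"
    have fin: "finite ?P0" "finite ?P1" using finite_partitions by auto
    have ne: "P \<noteq> {#}" if "P \<in> partitions n" for P
      using that 3 by (auto simp: partitions_def)
    have "(\<Sum>P\<in>?P0. z powi crank P) = (\<Sum>l\<in>{2..n}. \<Sum>P | P \<in> ?P0 \<and> Max_mset P = l. z powi crank P)"
    proof (rule sum.group[symmetric])
      show "Max_mset ` ?P0 \<subseteq> {2..n}"
      proof safe
        fix P assume P: "P \<in> partitions n" "count P 1 = 0"
        then have "Max_mset P \<in># P" using ne by simp
        moreover have "1 \<notin># P" "0 \<notin># P" using P by (auto simp: count_eq_zero_iff partitions_def)
        ultimately have "Max_mset P \<noteq> 0" "Max_mset P \<noteq> 1" "Max_mset P \<le> sum_mset P"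
          using sum_mset_ge by metis+
        then show "Max_mset P \<in> {2..n}" using P by (auto simp: partitions_def)
      qed
    qed (use fin in auto)
    also have "\<dots> = (\<Sum>l\<in>{2..n}. \<Sum>P | P \<in> partitions n \<and> count P 1 = 0 \<and> P \<noteq> {#} \<and> Max_mset P = l. z powi crank P)"
      using ne by (intro sum.cong) auto
    also have "\<dots> = (\<Sum>l\<in>{2..n}. fps_nth (?L l) n)"
      by (intro sum.cong refl crank_sum_no_ones) auto
    finally have 0: "(\<Sum>P\<in>?P0. z powi crank P) = (\<Sum>l\<in>{2..n}. fps_nth (?L l) n)" .
    have "(\<Sum>P\<in>?P1. z powi crank P) = (\<Sum>w\<in>{1..n}. \<Sum>P | P \<in> ?P1 \<and> count P 1 = w. z powi crank P)"
    proof (rule sum.group[symmetric])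
      have "count P 1 \<le> n" if "P \<in> partitions n" for P
        using that count_le_size[of P 1] size_le_sum_mset[of P] by (auto simp: partitions_def)
      then show "(\<lambda>P. count P 1) ` ?P1 \<subseteq> {1..n}" by fastforce
    qed (use fin in auto)
    also have "\<dots> = (\<Sum>w\<in>{1..n}. \<Sum>P | P \<in> partitions n \<and> count P 1 = w. z powi crank P)"
      by (intro sum.cong) auto
    also have "\<dots> = (\<Sum>w\<in>{1..n}. fps_nth (?W w) n)"
      using z by (intro sum.cong refl crank_sum_ones) auto
    finally have 1: "(\<Sum>P\<in>?P1. z powi crank P) = (\<Sum>w\<in>{1..n}. fps_nth (?W w) n)" .
    have "(\<Sum>P\<in>?P0 \<union> ?P1. z powi crank P) = (\<Sum>P\<in>?P0. z powi crank P) + (\<Sum>P\<in>?P1. z powi crank P)"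
      by (rule sum.union_disjoint[OF fin]) blast
    moreover have "?P0 \<union> ?P1 = partitions n" by blast
    ultimately have "(\<Sum>P\<in>partitions n. z powi crank P) = (\<Sum>P\<in>?P0. z powi crank P) + (\<Sum>P\<in>?P1. z powi crank P)"
      by simp
    moreover have "fps_nth (1 - fps_X + fps_const z * fps_X) n = 0"
      using 3 by simp
    ultimately show ?thesis
      unfolding fps_add_nth L W 0 1 using crank_poly_ge_2[OF 3, of z] by simp
  qed
qed

text \<open>
  Following Andrews and Garvan: partitions without ones contribute \<open>(1 - q) / (zq)\<^sub>\<infinity>\<close> by Euler's
  identity, and the whole sum becomes \<open>(1 - q) / (zq)\<^sub>\<infinity>\<close> times a \<open>q\<close>-binomial series in \<open>q / z\<close>.
\<close>

theorem crank_generating_function: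
  assumes z: "z \<noteq> 0"
  shows "Abs_fps (crank_poly z) * (qprod z 1 1 * qprod (1 / z) 1 1) = qprod 1 1 1"
proof (rule eqm_imp_eq)
  fix m :: nat
  define N where "N = Suc m"
  define Z where "Z u n = (\<Prod>k<n. qfac u (Suc k))" for u :: complex and n
  define IF where "IF n = inverse (Z 1 n)" for n
  have Z1: "fps_nth (Z 1 n) 0 = 1" for n
    unfolding Z_def by (induction n) (auto simp: qfac_def)
  have IF: "Z 1 n * IF n = 1" "IF n * Z 1 n = 1" for n
    by (simp_all add: IF_def Z1 inverse_mult_eq_1 inverse_mult_eq_1')
  have Zprod: "Z u n = (\<Prod>k\<in>{1..n}. qfac u k)" for u n
    by (simp add: Z_def prod.atLeast1_atMost_eq)
  have Z_ins: "(\<Prod>k\<in>{1..n}. qfac u k) = qfac u 1 * (\<Prod>k\<in>{2..n}. qfac u k)" if "1 \<le> n" for u :: complex and n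
    using that by (subst prod.atLeast_Suc_atMost) (auto simp: numeral_2_eq_2)
  have q1: "qfac (1::complex) 1 = 1 - fps_X" by (simp add: qfac_def)
  have recip: "IF (Suc n) * (1 - fps_X ^ Suc n) = IF n" for n
  proof -
    have "IF (Suc n) * (1 - fps_X ^ Suc n) = IF (Suc n) * (1 - fps_X ^ Suc n) * (Z 1 n * IF n)"
      by (simp add: IF)
    also have "\<dots> = IF (Suc n) * Z 1 (Suc n) * IF n"
      by (simp add: Z_def qfac_def ac_simps)
    finally show ?thesis by (simp add: IF)
  qed
  have L: "part_gf {2..l} (\<lambda>x. 1) = (1 - fps_X) * IF l" if "1 \<le> l" for l
  proof -
    have "part_gf {2..l} (\<lambda>x. 1) * Z 1 l = (1 - fps_X) * (part_gf {2..l} (\<lambda>x. 1) * (\<Prod>k\<in>{2..l}. qfac 1 k))"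
      unfolding Zprod Z_ins[OF that] q1 by (simp add: ac_simps)
    also have "part_gf {2..l} (\<lambda>x. 1) * (\<Prod>k\<in>{2..l}. qfac 1 k) = part_gf {} (\<lambda>x. 1)"
      using part_gf_remove_finite[of "{2..l}" "{2..l}" "\<lambda>x. 1"] by simp
    also have "part_gf {} (\<lambda>x. 1) = 1"
      by (rule eqm_imp_eq) (rule eqm_part_gf, auto)
    finally have "part_gf {2..l} (\<lambda>x. 1) * Z 1 l * IF l = (1 - fps_X) * IF l" by simp
    then show ?thesis by (simp add: mult.assoc IF)
  qed
  \<comment> \<open>Parts from 2 to \<open>w\<close> have weight 1 and later parts weight
    \<open>z\<close>. Multiplying by (zq)_N and (q)_w therefore leaves 1 - q, the factor (zq)_w and
    a series in parts beyond \<open>N\<close>, which is 1 to the order considered.\<close>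
  have W: "eqm (Suc N) (part_gf {2..} (\<lambda>x. if w < x then z else 1) * Z z N) ((1 - fps_X) * Z z w * IF w)"
    if w: "w \<in> {1..N}" for w
  proof -
    define f where "f = (\<lambda>x. if w < x then z else 1)"
    have split: "{2..N} = {2..w} \<union> {Suc w..N}" "{2..w} \<inter> {Suc w..N} = {}" using w by auto
    have fa: "(\<Prod>k\<in>{2..N}. qfac (f k) k) = (\<Prod>k\<in>{2..w}. qfac 1 k) * (\<Prod>k\<in>{Suc w..N}. qfac z k)"
      unfolding split(1) by (subst prod.union_disjoint) (auto simp: f_def intro!: arg_cong2[where f = "(*)"] prod.cong)
    have fb: "part_gf {2..} f * (\<Prod>k\<in>{2..N}. qfac (f k) k) = part_gf {Suc N..} f"
    proof -
      have "{2..} - {2..N} = {Suc N..}" using w by auto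
      then show ?thesis using part_gf_remove_finite[of "{2..N}" "{2..}" f] by auto
    qed
    have fc: "Z z N = Z z w * (\<Prod>k\<in>{Suc w..N}. qfac z k)"
    proof -
      have "{1..N} = {1..w} \<union> {Suc w..N}" using w by auto
      then show ?thesis unfolding Zprod by (simp add: prod.union_disjoint)
    qed
    have fd: "Z 1 w = (1 - fps_X) * (\<Prod>k\<in>{2..w}. qfac 1 k)"
    proof -
      have "1 \<le> w" using w by simp
      from Z_ins[OF this, of 1] show ?thesis unfolding Zprod q1 .
    qed
    have "part_gf {2..} f * Z z N * Z 1 w = (1 - fps_X) * Z z w * (part_gf {2..} f * (\<Prod>k\<in>{2..N}. qfac (f k) k))"
      unfolding fa fc fd by (simp only: ac_simps)
    then have *: "part_gf {2..} f * Z z N * Z 1 w = (1 - fps_X) * Z z w * part_gf {Suc N..} f"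
      unfolding fb .
    have "part_gf {2..} f * Z z N = part_gf {2..} f * Z z N * (Z 1 w * IF w)"
      by (simp add: IF)
    also have "\<dots> = (part_gf {2..} f * Z z N * Z 1 w) * IF w" by (simp only: mult.assoc)
    also have "\<dots> = (1 - fps_X) * Z z w * IF w * part_gf {Suc N..} f"
      unfolding * by (simp add: ac_simps)
    also have "eqm (Suc N) \<dots> ((1 - fps_X) * Z z w * IF w * 1)"
      by (intro eqm_mult eqm_refl eqm_part_gf) auto
    finally show ?thesis by (simp add: f_def)
  qed
  define S where "S = (\<Sum>w\<le>N. (Z z w * IF w) * (fps_const (1 / z) * fps_X) ^ w)"
  \<comment> \<open>The coefficients 1/(q)_n satisfy the recurrence with a = 0.\<close>
  have euler: "eqm (Suc N) ((\<Sum>l\<le>N. IF l * (fps_const z * fps_X) ^ l) * Z z N) 1"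
    using q_binomial_theorem[of IF 0 N z] recip by (simp add: Z_def[symmetric] IF_def) (simp add: Z_def)
  \<comment> \<open>Here the coefficients are (zq)_n / (q)_n, with a = zq and argument q/z. Their
    product is q^2, so \<open>z\<close> disappears from the right side.\<close>
  have qbin: "eqm (Suc N) (S * Z (1 / z) N) (\<Prod>k<N. qfac 1 (Suc (Suc k)))"
  proof -
    have "Z z (Suc n) * IF (Suc n) * (1 - fps_X ^ Suc n) = Z z n * IF n * (1 - fps_const z * fps_X * fps_X ^ n)" for n
      using recip[of n] by (simp add: Z_def qfac_def mult.assoc)
    moreover have "1 - fps_const z * fps_X * fps_const (1 / z) * fps_X ^ Suc k = qfac 1 (Suc (Suc k))" for k
    proof -
      have "fps_const z * fps_X * fps_const (1 / z) * fps_X ^ Suc k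
          = (fps_const z * fps_const (1 / z)) * fps_X ^ Suc (Suc k)"
        by (simp only: power_Suc ac_simps)
      also have "fps_const z * fps_const (1 / z) = 1" using z by simp
      finally show ?thesis by (simp add: qfac_def)
    qed
    moreover have "Z z 0 * IF 0 = 1" by (simp add: IF_def Z_def)
    ultimately show ?thesis
      using q_binomial_theorem[of "\<lambda>w. Z z w * IF w" "fps_const z * fps_X" N "1 / z"] by (simp add: S_def Z_def)
  qed
  have pw: "fps_const (z ^ l) * fps_X ^ l = (fps_const z * fps_X) ^ l" for l
    by (simp add: power_mult_distrib)
  have pw': "fps_const (z powi (- int l)) * fps_X ^ l = (fps_const (1 / z) * fps_X) ^ l" for l
    by (simp add: power_mult_distrib power_int_minus field_simps)
  have N1: "{..N} = insert 0 (insert 1 {2..N})" "{..N} = insert 0 {1..N}"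
    by (auto simp: N_def)
  \<comment> \<open>The conventional values at n = 0 and n = 1 are exactly the terms l = 0 and l = 1
    of Euler's series: (1 - q)(1 + zq/(1 - q)) = 1 - q + zq.\<close>
  have "1 - fps_X + fps_const z * fps_X + (\<Sum>l\<in>{2..N}. fps_const (z ^ l) * (fps_X ^ l * part_gf {2..l} (\<lambda>x. 1)))
     = (1 - fps_X) * (\<Sum>l\<le>N. IF l * (fps_const z * fps_X) ^ l)"
  proof -
    have "(\<Sum>l\<in>{2..N}. fps_const (z ^ l) * (fps_X ^ l * part_gf {2..l} (\<lambda>x. 1)))
        = (1 - fps_X) * (\<Sum>l\<in>{2..N}. IF l * (fps_const z * fps_X) ^ l)"
      unfolding sum_distrib_left
    proof (rule sum.cong)
      fix l assume "l \<in> {2..N}"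
      then have "1 \<le> l" by simp
      then show "fps_const (z ^ l) * (fps_X ^ l * part_gf {2..l} (\<lambda>x. 1)) = (1 - fps_X) * (IF l * (fps_const z * fps_X) ^ l)"
        unfolding pw[symmetric] L[OF \<open>1 \<le> l\<close>] by (simp only: ac_simps)
    qed simp
    moreover have "IF 0 = 1" by (simp add: IF_def Z_def)
    moreover have "(1 - fps_X) * IF 1 = 1" using recip[of 0] by (simp add: IF_def Z_def mult.commute)
    ultimately show ?thesis
      unfolding N1(1) by (simp add: distrib_left mult.assoc[symmetric])
  qed
  then have "eqm (Suc N) (Abs_fps (crank_poly z))
    ((1 - fps_X) * (\<Sum>l\<le>N. IF l * (fps_const z * fps_X) ^ l)
     + (\<Sum>w\<in>{1..N}. (fps_const (1 / z) * fps_X) ^ w * part_gf {2..} (\<lambda>x. if w < x then z else 1)))"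
    using eqm_crank_gf[OF z, of N] by (simp add: pw'[symmetric] mult.assoc)
  from eqm_mult[OF this eqm_refl[of "Suc N" "Z z N"]]
  have "eqm (Suc N) (Abs_fps (crank_poly z) * Z z N) ((1 - fps_X) * ((\<Sum>l\<le>N. IF l * (fps_const z * fps_X) ^ l) * Z z N)
     + (\<Sum>w\<in>{1..N}. (fps_const (1 / z) * fps_X) ^ w * (part_gf {2..} (\<lambda>x. if w < x then z else 1) * Z z N)))"
    by (simp add: distrib_right sum_distrib_right mult.assoc)
  also have "eqm (Suc N) \<dots> ((1 - fps_X) * 1 + (\<Sum>w\<in>{1..N}. (fps_const (1 / z) * fps_X) ^ w * ((1 - fps_X) * Z z w * IF w)))"
    by (intro eqm_add eqm_mult eqm_refl eqm_sum euler W)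
  also have "\<dots> = (1 - fps_X) * S"
  proof -
    have "S = 1 + (\<Sum>w\<in>{1..N}. (Z z w * IF w) * (fps_const (1 / z) * fps_X) ^ w)"
      unfolding S_def N1(2) by (subst sum.insert) (auto simp: IF_def Z_def)
    then show ?thesis by (simp add: distrib_left sum_distrib_left ac_simps)
  qed
  finally have "eqm (Suc N) (Abs_fps (crank_poly z) * Z z N * Z (1 / z) N) ((1 - fps_X) * S * Z (1 / z) N)"
    by (rule eqm_mult[OF _ eqm_refl])
  also have "(1 - fps_X) * S * Z (1 / z) N = (1 - fps_X) * (S * Z (1 / z) N)" by (simp only: mult.assoc)
  also have "eqm (Suc N) \<dots> ((1 - fps_X) * (\<Prod>k<N. qfac 1 (Suc (Suc k))))"
    by (intro eqm_mult eqm_refl qbin)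
  also have "(1 - fps_X) * (\<Prod>k<N. qfac 1 (Suc (Suc k))) = Z 1 (Suc N)"
    unfolding Z_def prod.lessThan_Suc_shift by (simp add: q1[symmetric])
  finally have main: "eqm m (Abs_fps (crank_poly z) * Z z N * Z (1 / z) N) (Z 1 (Suc N))"
    by (rule eqm_mono) (simp add: N_def)
  have qZ: "eqm m (qprod u 1 1) (Z u n)" if "m \<le> n" for u n
    using eqm_qprod[of 1 m n u 1] that by (simp add: Z_def)
  have "eqm m (Abs_fps (crank_poly z) * (qprod z 1 1 * qprod (1 / z) 1 1)) (Abs_fps (crank_poly z) * (Z z N * Z (1 / z) N))"
    by (intro eqm_mult eqm_refl qZ) (auto simp: N_def)
  also have "\<dots> = Abs_fps (crank_poly z) * Z z N * Z (1 / z) N" by (simp only: mult.assoc)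
  also note main
  also have "eqm m (Z 1 (Suc N)) (qprod 1 1 1)"
    by (rule eqm_sym[OF qZ]) (simp add: N_def)
  finally show "eqm m (Abs_fps (crank_poly z) * (qprod z 1 1 * qprod (1 / z) 1 1)) (qprod 1 1 1)" .
qed

section \<open>Dissection modulo 11\<close>

text \<open>Putting M = 11M' + i + d gives 6M + c = 11(6M' + c') + 6i, and \<open>u ^ 11 = 1\<close>
  leaves only the power 6i of \<open>u\<close>. The shift \<open>d\<close> is there to make c + 6d
  divisible by 11.\<close>

lemma sq_series_dissect:
  assumes u: "u ^ 11 = 1" and c: "11 * c' = c + 6 * d"
  shows "sq_series u 1 0 c = (\<Sum>i<11. fps_const (sg (int i + d) * u ^ (6 * i)) * sq_series 1 11 i c')"
proof -
  let ?e = "\<lambda>M. (int 1 * (6 * M + c) + 6 * int 0)\<^sup>2" and ?w = "\<lambda>M. sg M * u powi (6 * M + c)"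
  have u0: "u \<noteq> 0" using u by auto
  have lt: "nat ((M - d) mod 11) < 11" for M :: int
    using pos_mod_bound[of 11 "M - d"] by linarith
  have "sq_series u 1 0 c = (\<Sum>i<11. gsum {M \<in> UNIV. nat ((M - d) mod 11) = i} ?e ?w)"
    unfolding sq_series_def by (rule gsum_partition[OF adm_sq_series]) (use lt in auto)
  also have "\<dots> = (\<Sum>i<11. fps_const (sg (int i + d) * u ^ (6 * i)) * sq_series 1 11 i c')"
  proof (rule sum.cong)
    fix i :: nat assume i: "i \<in> {..<11}"
    have b: "bij_betw (\<lambda>M'. 11 * M' + int i + d) UNIV {M \<in> UNIV. nat ((M - d) mod 11) = i}"
    proof (rule bij_betwI[where g = "\<lambda>M. (M - d) div 11"])
      show "(\<lambda>M'. 11 * M' + int i + d) \<in> UNIV \<rightarrow> {M \<in> UNIV. nat ((M - d) mod 11) = i}"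
        using i by auto
      show "(11 * M' + int i + d - d) div 11 = M'" for M' using i by auto
      show "11 * ((M - d) div 11) + int i + d = M" if "M \<in> {M \<in> UNIV. nat ((M - d) mod 11) = i}" for M
      proof -
        have "(M - d) mod 11 = int i" using that pos_mod_sign[of 11 "M - d"] by auto
        then show ?thesis using mult_div_mod_eq[of 11 "M - d"] by linarith
      qed
    qed simp
    have "gsum {M \<in> UNIV. nat ((M - d) mod 11) = i} ?e ?w
        = gsum UNIV (\<lambda>M'. (int 11 * (6 * M' + c') + 6 * int i)\<^sup>2)
            (\<lambda>M'. sg (int i + d) * u ^ (6 * i) * (sg M' * 1 powi (6 * M' + c')))"
    proof (subst gsum_reindex[OF b], rule gsum_cong)
      fix M' :: int
      have x: "6 * (11 * M' + int i + d) + c = 11 * (6 * M' + c') + int (6 * i)"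
        using c by simp
      show "(int 1 * (6 * (11 * M' + int i + d) + c) + 6 * int 0)\<^sup>2 = (int 11 * (6 * M' + c') + 6 * int i)\<^sup>2"
        unfolding x by simp
      have "u powi (11 * (6 * M' + c') + int (6 * i)) = (u ^ 11) powi (6 * M' + c') * u ^ (6 * i)"
        using u0 by (simp add: power_int_add power_int_mult power_mult)
      then have "u powi (11 * (6 * M' + c') + int (6 * i)) = u ^ (6 * i)"
        unfolding u by simp
      moreover have "sg (11 * M' + int i + d) = sg (int i + d) * sg M'"
      proof -
        have "11 * M' + int i + d = (int i + d) + M' + 2 * (5 * M')" by simp
        then show ?thesis unfolding sg_add_even sg_add[of "int i + d" M', symmetric] by (metis sg_add_even)
      qed
      ultimately show "sg (11 * M' + int i + d) * u powi (6 * (11 * M' + int i + d) + c)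
          = sg (int i + d) * u ^ (6 * i) * (sg M' * 1 powi (6 * M' + c'))"
        unfolding x by simp
    qed
    then show "gsum {M \<in> UNIV. nat ((M - d) mod 11) = i} ?e ?w
        = fps_const (sg (int i + d) * u ^ (6 * i)) * sq_series 1 11 i c'"
      unfolding sq_series_def gsum_const_mult .
  qed simp
  finally show ?thesis .
qed

text \<open>M -> -1 - M negates the squared expression after exchanging \<open>i\<close> with
  \<open>11 - i\<close> and \<open>c\<close> with \<open>- c\<close>; the sign of the coefficient
  flips.\<close>

lemma sq_series_reflect:
  assumes "i \<le> 11"
  shows "sq_series 1 11 (11 - i) c = - sq_series 1 11 i (- c)"
proof -
  have b: "bij_betw (\<lambda>M::int. - 1 - M) UNIV UNIV"
    by (rule bij_betwI[of _ _ _ "\<lambda>M. - 1 - M"]) auto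
  have "sq_series 1 11 i (- c) = gsum UNIV (\<lambda>M. (int 11 * (6 * M + c) + 6 * int (11 - i))\<^sup>2) (\<lambda>M. (-1) * (sg M * 1 powi (6 * M + c)))"
    unfolding sq_series_def
  proof (subst gsum_reindex[OF b], rule gsum_cong)
    fix M :: int
    have *: "int 11 * (6 * (- 1 - M) + - c) + 6 * int i = - (int 11 * (6 * M + c) + 6 * int (11 - i))"
      using assms by (simp add: of_nat_diff)
    show "(int 11 * (6 * (- 1 - M) + - c) + 6 * int i)\<^sup>2 = (int 11 * (6 * M + c) + 6 * int (11 - i))\<^sup>2"
      unfolding * by (rule power2_minus)
    show "sg (- 1 - M) * 1 powi (6 * (- 1 - M) + - c) = (-1) * (sg M * 1 powi (6 * M + c))"
      by (simp add: sg_def)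
  qed
  also have "\<dots> = - sq_series 1 11 (11 - i) c"
    unfolding gsum_const_mult[symmetric] sq_series_def by (simp flip: fps_const_neg)
  finally show ?thesis by simp
qed

lemma sq_series_0_minus: "sq_series 1 11 0 (- c) = sq_series 1 11 0 c"
proof -
  have b: "bij_betw (\<lambda>M::int. - M) UNIV UNIV"
    by (rule bij_betwI[of _ _ _ "\<lambda>M. - M"]) auto
  show ?thesis
    unfolding sq_series_def
  proof (subst gsum_reindex[OF b], rule gsum_cong)
    fix M :: int
    have *: "int 11 * (6 * - M + - c) + 6 * int 0 = - (int 11 * (6 * M + c) + 6 * int 0)"
      by simp
    show "(int 11 * (6 * - M + - c) + 6 * int 0)\<^sup>2 = (int 11 * (6 * M + c) + 6 * int 0)\<^sup>2"
      unfolding * by (rule power2_minus)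
  qed (simp add: sg_def)
qed

text \<open>\<open>Psi\<close> collects lattice coordinates divisible by 3, and \<open>Chi\<close>
  the signed coordinates prime to 3. These are the two ingredients of the right side of Winquist's
  identity.\<close>

definition Psi :: "nat \<Rightarrow> complex fps" where
  "Psi i = sq_series 1 11 i (- 3)"

definition Chi :: "nat \<Rightarrow> complex fps" where
  "Chi i = sq_series 1 11 i (- 1) - sq_series 1 11 i 1"

lemma Psi_reflect: "i \<le> 11 \<Longrightarrow> Psi (11 - i) = Psi i"
  using sq_series_shift[of 1 11 i "- 3"] by (simp add: Psi_def sq_series_reflect)

lemma Chi_reflect: "i \<le> 11 \<Longrightarrow> Chi (11 - i) = Chi i"
  by (simp add: Chi_def sq_series_reflect)

lemma Psi_0: "Psi 0 = 0"
proof -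
  have "Psi 0 = - Psi 0"
    using sq_series_shift[of 1 11 0 "- 3"] sq_series_0_minus[of 3] by (simp add: Psi_def)
  then show ?thesis by (simp add: eq_neg_iff_add_eq_0 flip: mult_2)
qed

lemma Chi_0: "Chi 0 = 0"
  using sq_series_0_minus[of 1] by (simp add: Chi_def)

lemma sum_lessThan_11: "(\<Sum>i<11. f i) = f 0 + f 1 + f 2 + f 3 + f 4 + f 5 + f 6 + f 7 + f 8 + f 9 + f (10::nat)"
  by (simp add: eval_nat_numeral)

lemma prod_lessThan_11: "(\<Prod>i<11. f i) = f 0 * f 1 * f 2 * f 3 * f 4 * f 5 * f 6 * f 7 * f 8 * f 9 * f (10::nat)"
  by (simp add: eval_nat_numeral)

text \<open>The shift -5 reproduces the class, since -3 - 30 = 11 times -3. Residue 0 drops out, and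
  residues i and 11 - i combine with opposite signs.\<close>

lemma Psi_dissect:
  assumes "u ^ 11 = 1"
  shows "sq_series u 1 0 (- 3) = fps_const (u ^ 6 - u ^ 60) * Psi 1 + fps_const (u ^ 54 - u ^ 12) * Psi 2
    + fps_const (u ^ 18 - u ^ 48) * Psi 3 + fps_const (u ^ 42 - u ^ 24) * Psi 4 + fps_const (u ^ 30 - u ^ 36) * Psi 5"
proof -
  have "sq_series u 1 0 (- 3) = (\<Sum>i<11. fps_const (sg (int i + - 5) * u ^ (6 * i)) * Psi i)"
    unfolding Psi_def by (rule sq_series_dissect[OF assms]) simp
  then show ?thesis
    using Psi_reflect[of 1] Psi_reflect[of 2] Psi_reflect[of 3] Psi_reflect[of 4] Psi_reflect[of 5]
    unfolding sum_lessThan_11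
    by (simp add: Psi_0 sg_def algebra_simps flip: fps_const_neg fps_const_sub)
qed

text \<open>The shifts 2 and -2 interchange the classes -1 and 1. The resulting sign makes the
  coefficients coincide with those for \<open>Psi\<close>, which is what allows the antisymmetric
  combination to be regrouped into minors.\<close>

lemma Chi_dissect:
  assumes "u ^ 11 = 1"
  shows "sq_series u 1 0 (- 1) - sq_series u 1 0 1 = fps_const (u ^ 6 - u ^ 60) * Chi 1 + fps_const (u ^ 54 - u ^ 12) * Chi 2
    + fps_const (u ^ 18 - u ^ 48) * Chi 3 + fps_const (u ^ 42 - u ^ 24) * Chi 4 + fps_const (u ^ 30 - u ^ 36) * Chi 5"
proof -
  have 1: "sq_series u 1 0 (- 1) = (\<Sum>i<11. fps_const (sg (int i + 2) * u ^ (6 * i)) * sq_series 1 11 i 1)"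
    by (rule sq_series_dissect[OF assms]) simp
  have 2: "sq_series u 1 0 1 = (\<Sum>i<11. fps_const (sg (int i + - 2) * u ^ (6 * i)) * sq_series 1 11 i (- 1))"
    by (rule sq_series_dissect[OF assms]) simp
  have "sq_series u 1 0 (- 1) - sq_series u 1 0 1 = (\<Sum>i<11. - fps_const (sg (int i) * u ^ (6 * i)) * Chi i)"
    unfolding 1 2 sum_subtractf[symmetric]
    by (rule sum.cong) (auto simp: Chi_def sg_def algebra_simps simp flip: fps_const_neg)
  then show ?thesis
    using Chi_reflect[of 1] Chi_reflect[of 2] Chi_reflect[of 3] Chi_reflect[of 4] Chi_reflect[of 5]
    unfolding sum_lessThan_11
    by (simp add: Chi_0 sg_def algebra_simps flip: fps_const_neg fps_const_sub)
qed

text \<open>\<open>Yt s\<close> is \<open>X\<^sub>s\<close> with \<open>q\<close> replaced by \<open>q\<^sup>2\<^sup>4\<close>.\<close>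

definition Yt :: "nat \<Rightarrow> complex fps" where
  "Yt s = theta 1 (264 * s) 1452"

lemma Yt_eq:
  assumes "s \<le> 11"
  shows "Yt s = qprod 1 (264 * s) 2904 * qprod 1 (2904 - 264 * s) 2904 * qprod 1 2904 2904"
  using jacobi_triple_product[of 1452 "264 * s" 1] assms by (simp add: Yt_def)

lemma Yt_reflect: "s \<le> 11 \<Longrightarrow> Yt (11 - s) = Yt s"
  by (simp add: Yt_eq algebra_simps diff_mult_distrib2)

text \<open>Winquist's identity at \<open>\<kappa> = 11\<close>, \<open>u = v = 1\<close>. The
  hypothesis on \<open>e\<close> expresses the exponent left by completing the squares without
  subtraction; the common power of \<open>q\<close> then cancels.\<close>

lemma Psi_Chi_product:
  assumes "j \<le> i" "i + j \<le> 11" and e: "1210 + 36 * i\<^sup>2 + 36 * j\<^sup>2 = 396 * i + 132 * j + e"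
  shows "(qprod 1 2904 2904)\<^sup>2 * (Psi i * Chi j - Chi i * Psi j) = fps_X ^ e * (Yt i * Yt j * Yt (i + j) * Yt (i - j))"
proof -
  have "fps_X ^ (396 * i + 132 * j + e) * (Yt i * Yt j * (Yt (i + j) * Yt (i - j)))
      = fps_X ^ (396 * i + 132 * j) * (qprod 1 2904 2904)\<^sup>2 * (Psi i * Chi j - Chi i * Psi j)"
    using winquist[of 1 1 11 j i] assms(1,2) by (simp add: Yt_def Psi_def Chi_def e)
  then have "fps_X ^ (396 * i + 132 * j) * (fps_X ^ e * (Yt i * Yt j * Yt (i + j) * Yt (i - j)))
      = fps_X ^ (396 * i + 132 * j) * ((qprod 1 2904 2904)\<^sup>2 * (Psi i * Chi j - Chi i * Psi j))"
    by (simp add: power_add mult.assoc)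
  then show ?thesis by simp
qed

text \<open>Splitting \<open>qprod 1 264 264\<close> into residues modulo 2904 yields the pairs s,
  11 - s and the residue 0. The five series carry one full product each; residue 0 accounts for one,
  leaving the fourth power.\<close>

lemma Yt_product:
  "Yt 1 * Yt 2 * Yt 3 * Yt 4 * Yt 5 = qprod 1 264 264 * qprod 1 2904 2904 ^ 4"
proof -
  have "qprod (1::complex) 264 264 = (\<Prod>j<11. qprod 1 (264 + 264 * j) (264 * 11))"
    by (rule qprod_split) auto
  also have "\<dots> = qprod 1 264 2904 * qprod 1 528 2904 * qprod 1 792 2904 * qprod 1 1056 2904 * qprod 1 1320 2904
     * qprod 1 1584 2904 * qprod 1 1848 2904 * qprod 1 2112 2904 * qprod 1 2376 2904 * qprod 1 2640 2904 * qprod 1 2904 2904"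
    unfolding prod_lessThan_11 by simp
  finally show ?thesis
    by (simp add: Yt_eq power4_eq_xxxx ac_simps)
qed

section \<open>Products over the eleventh roots of unity\<close>

lemma root_of_unity_11_power_neq_1:
  fixes z :: complex
  assumes z: "z ^ 11 = 1" "z \<noteq> 1" and d: "0 < d" "d < 11"
  shows "z ^ d \<noteq> 1"
proof
  assume zd: "z ^ d = 1"
  have "\<not> 11 dvd d" using d by (auto dest: dvd_imp_le)
  moreover have "prime (11::nat)"
    by simp
  ultimately have "coprime d 11" by (metis coprime_commute prime_imp_coprime)
  then obtain x y where "d * x = 11 * y + 1"
    using coprime_bezout_strong[of d 11] by auto
  then have "z ^ (d * x) = z ^ (11 * y + 1)" by simp
  then show False using zd z by (simp add: power_mult power_add)
qed

lemma inj_on_powers_11: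
  fixes z :: complex
  assumes z: "z ^ 11 = 1" "z \<noteq> 1"
  shows "inj_on (\<lambda>k. z ^ k) {..<11}"
proof (rule linorder_inj_onI)
  fix x y :: nat assume xy: "x < y" "x \<in> {..<11}" "y \<in> {..<11}"
  have z0: "z \<noteq> 0" using z by auto
  have "z ^ (y - x) \<noteq> 1" using xy by (intro root_of_unity_11_power_neq_1[OF z]) auto
  moreover have "z ^ y = z ^ x * z ^ (y - x)" using xy by (simp flip: power_add)
  ultimately show "z ^ x \<noteq> z ^ y" using z0 by auto
qed auto

text \<open>Both polynomials have degree at most 11 and agree at twelve points: at 0 and at the
  eleven powers of \<open>z\<close>.\<close>

lemma prod_roots_of_unity_11:
  fixes z :: complex
  assumes z: "z ^ 11 = 1" "z \<noteq> 1"
  shows "(\<Prod>k<11. [:1, - (z ^ k):]) = 1 - monom 1 11"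
proof (rule poly_eqI_degree[where A = "insert 0 ((\<lambda>k. z ^ k) ` {..<11})"])
  have z0: "z \<noteq> 0" using z by auto
  have "card ((\<lambda>k. z ^ k) ` {..<11}) = 11"
    by (subst card_image[OF inj_on_powers_11[OF z]]) simp
  moreover have "0 \<notin> (\<lambda>k. z ^ k) ` {..<11}" using z0 by auto
  ultimately have card: "card (insert 0 ((\<lambda>k. z ^ k) ` {..<11})) = 12" by simp
  have "degree (\<Prod>k<11. [:1, - (z ^ k):]) \<le> (\<Sum>k<11. degree [:1, - (z ^ k):])"
    using degree_prod_sum_le[of "{..<11}" "\<lambda>k. [:1, - (z ^ k):]"] by (simp add: comp_def)
  also have "\<dots> \<le> (\<Sum>k<(11::nat). 1)" by (intro sum_mono) simp
  finally show "degree (\<Prod>k<11. [:1, - (z ^ k):]) < card (insert 0 ((\<lambda>k. z ^ k) ` {..<11}))"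
    unfolding card by simp
  have "degree (1 - monom (1::complex) 11) \<le> 11"
    by (rule degree_diff_le) (auto simp: degree_monom_le)
  then show "degree (1 - monom (1::complex) 11) < card (insert 0 ((\<lambda>k. z ^ k) ` {..<11}))"
    unfolding card by simp
  fix x assume "x \<in> insert 0 ((\<lambda>k. z ^ k) ` {..<11})"
  then consider "x = 0" | j where "j < 11" "x = z ^ j" by auto
  then show "poly (\<Prod>k<11. [:1, - (z ^ k):]) x = poly (1 - monom 1 11) x"
  proof cases
    case 1
    then show ?thesis by (simp add: poly_prod poly_monom)
  next
    case 2
    let ?k = "(11 - j) mod 11"
    have "z ^ j * z ^ ?k = 1"
    proof (cases "j = 0")
      case False
      with 2 show ?thesis using z by (simp flip: power_add)
    qed simp
    then have "poly (\<Prod>k<11. [:1, - (z ^ k):]) x = 0"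
      unfolding poly_prod 2 by (intro prod_zero bexI[of _ ?k]) auto
    moreover have "poly (1 - monom 1 11) x = 1 - (z ^ 11) ^ j"
      unfolding 2 by (simp add: poly_monom flip: power_mult) (simp add: mult.commute)
    ultimately show ?thesis using z by simp
  qed
qed

lemma prod_qfac_roots:
  fixes z :: complex
  assumes z: "z ^ 11 = 1" "z \<noteq> 1" and e: "0 < e"
  shows "(\<Prod>k<11. qfac (z ^ k) e) = qfac 1 (11 * e)"
proof -
  have X0: "fps_nth (fps_X ^ e :: complex fps) 0 = 0" using e by simp
  have "fps_of_poly (\<Prod>k<11. [:1, - (z ^ k):]) = fps_of_poly (1 - monom 1 11)"
    unfolding prod_roots_of_unity_11[OF z] ..
  then have "(\<Prod>k<11. 1 - fps_const (z ^ k) * fps_X) = 1 - fps_X ^ 11"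
    by (simp add: fps_of_poly_prod fps_of_poly_diff fps_of_poly_monom' fps_of_poly_linear' flip: fps_const_neg)
  then have "(\<Prod>k<11. 1 - fps_const (z ^ k) * fps_X) oo fps_X ^ e = (1 - fps_X ^ 11) oo fps_X ^ e"
    by simp
  then show ?thesis
    using X0 by (simp add: fps_compose_prod_distrib fps_compose_sub_distrib fps_compose_mult_distrib
        fps_compose_power[symmetric] qfac_def power_mult[symmetric] mult.commute)
qed

lemma prod_qprod_roots:
  fixes z :: complex
  assumes z: "z ^ 11 = 1" "z \<noteq> 1"
  shows "(\<Prod>k<11. qprod (z ^ k) 24 24) = qprod 1 264 264"
proof (rule eqm_imp_eq)
  fix n
  have "eqm n (\<Prod>k<11. qprod (z ^ k) 24 24) (\<Prod>k<11. \<Prod>i<n. qfac (z ^ k) (24 + 24 * i))"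
    by (intro eqm_prod eqm_qprod) auto
  also have "\<dots> = (\<Prod>i<n. \<Prod>k<11. qfac (z ^ k) (24 + 24 * i))"
    by (rule prod.swap)
  also have "\<dots> = (\<Prod>i<n. qfac 1 (264 + 264 * i))"
    by (simp add: prod_qfac_roots[OF z])
  also have "eqm n \<dots> (qprod 1 264 264)"
    by (intro eqm_sym[OF eqm_qprod]) auto
  finally show "eqm n (\<Prod>k<11. qprod (z ^ k) 24 24) (qprod 1 264 264)" .
qed

section \<open>Dilation of q and transfer from rational to complex coefficients\<close>

lemma eqm_dilate:
  assumes "eqm n f g"
  shows "eqm n (f oo fps_X ^ 24) (g oo fps_X ^ 24)"
  using assms by (auto simp: eqm_def fps_nth_compose_X_power elim!: dvdE)

lemma qprod_dilate:
  fixes u :: complex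
  assumes "0 < m"
  shows "qprod u a m oo fps_X ^ 24 = qprod u (24 * a) (24 * m)"
proof (rule eqm_imp_eq)
  fix n
  have X0: "fps_nth (fps_X ^ 24 :: complex fps) 0 = 0" by simp
  have "eqm n (qprod u a m oo fps_X ^ 24) ((\<Prod>i<n. qfac u (a + m * i)) oo fps_X ^ 24)"
    using assms by (intro eqm_dilate eqm_qprod) auto
  also have "(\<Prod>i<n. qfac u (a + m * i)) oo fps_X ^ 24 = (\<Prod>i<n. qfac u (24 * a + 24 * m * i))"
    using X0 by (simp add: fps_compose_prod_distrib fps_compose_sub_distrib fps_compose_mult_distrib
        fps_compose_power[symmetric] qfac_def power_mult[symmetric] algebra_simps)
  also have "eqm n \<dots> (qprod u (24 * a) (24 * m))"
    using assms by (intro eqm_sym[OF eqm_qprod]) auto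
  finally show "eqm n (qprod u a m oo fps_X ^ 24) (qprod u (24 * a) (24 * m))" .
qed

definition fps_of_rat :: "rat fps \<Rightarrow> complex fps" where
  "fps_of_rat f = Abs_fps (\<lambda>n. of_rat (fps_nth f n))"

lemma fps_of_rat_nth [simp]: "fps_nth (fps_of_rat f) n = of_rat (fps_nth f n)"
  by (simp add: fps_of_rat_def)

lemma fps_of_rat_add: "fps_of_rat (f + g) = fps_of_rat f + fps_of_rat g"
  by (simp add: fps_eq_iff of_rat_add)

lemma fps_of_rat_mult: "fps_of_rat (f * g) = fps_of_rat f * fps_of_rat g"
  by (simp add: fps_eq_iff fps_mult_nth of_rat_sum of_rat_mult)

lemma fps_of_rat_const: "fps_of_rat (fps_const c) = fps_const (of_rat c)"
  by (simp add: fps_eq_iff)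

lemma fps_of_rat_1: "fps_of_rat 1 = 1"
  by (simp add: fps_eq_iff)

lemma fps_of_rat_X: "fps_of_rat fps_X = fps_X"
  by (simp add: fps_eq_iff fps_X_def)

lemma fps_of_rat_power: "fps_of_rat (f ^ n) = fps_of_rat f ^ n"
  by (induction n) (simp_all add: fps_of_rat_1 fps_of_rat_mult)

lemma fps_of_rat_diff: "fps_of_rat (f - g) = fps_of_rat f - fps_of_rat g"
  by (simp add: fps_eq_iff of_rat_diff)

lemma fps_of_rat_prod: "fps_of_rat (prod f A) = (\<Prod>x\<in>A. fps_of_rat (f x))"
  by (induction A rule: infinite_finite_induct) (simp_all add: fps_of_rat_1 fps_of_rat_mult)

lemma fps_of_rat_qpoch: "fps_of_rat (qpoch a m) = qprod 1 a m"
proof (rule fps_ext)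
  fix n
  have "fps_of_rat (\<Prod>i\<le>n. (1 - fps_X ^ (a + m * i))) = (\<Prod>i\<le>n. qfac 1 (a + m * i))"
    by (simp add: fps_of_rat_prod fps_of_rat_diff fps_of_rat_1 fps_of_rat_power fps_of_rat_X qfac_def)
  from arg_cong[OF this, of "\<lambda>f. fps_nth f n"]
  show "fps_nth (fps_of_rat (qpoch a m)) n = fps_nth (qprod 1 a m) n"
    by (simp add: qpoch_def qprod_def)
qed

text \<open>The substitution \<open>q \<mapsto> q\<^sup>2\<^sup>4\<close> makes the exponents in Winquist's identity sums of two squares.\<close>

definition dil :: "rat fps \<Rightarrow> complex fps" where
  "dil f = fps_of_rat f oo fps_X ^ 24"

lemma X24: "fps_nth (fps_X ^ 24 :: complex fps) 0 = 0"
  by simp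

lemma dil_add: "dil (f + g) = dil f + dil g"
  by (simp add: dil_def fps_of_rat_add fps_compose_add_distrib)

lemma dil_mult: "dil (f * g) = dil f * dil g"
  unfolding dil_def fps_of_rat_mult by (rule fps_compose_mult_distrib[OF X24])

lemma dil_const: "dil (fps_const c) = fps_const (of_rat c)"
  by (simp add: dil_def fps_of_rat_const)

lemma dil_X_power: "dil (fps_X ^ n) = fps_X ^ (24 * n)"
  by (simp add: dil_def fps_of_rat_power fps_of_rat_X fps_compose_power[OF X24, symmetric] power_mult)

lemma dil_power: "dil (f ^ n) = dil f ^ n"
  unfolding dil_def fps_of_rat_power by (rule fps_compose_power[OF X24, symmetric])

lemma dil_inverse:
  assumes "fps_nth f 0 \<noteq> 0"
  shows "dil (inverse f) = inverse (dil f)"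
proof -
  have "dil (inverse f) * dil f = dil 1"
    using assms by (simp add: inverse_mult_eq_1 flip: dil_mult)
  also have "dil 1 = 1" using dil_X_power[of 0] by simp
  finally show ?thesis
    by (metis fps_inverse_unique mult.commute)
qed

lemma dil_qpoch: "0 < m \<Longrightarrow> dil (qpoch a m) = qprod 1 (24 * a) (24 * m)"
  by (simp add: dil_def fps_of_rat_qpoch qprod_dilate)

lemma dil_Jm: "dil (Jm 121) = qprod 1 2904 2904"
  by (simp add: Jm_def dil_qpoch)

lemma dil_Xi: "s \<le> 11 \<Longrightarrow> dil (Xi s) = Yt s"
  by (simp add: Xi_def Jam_def dil_mult dil_qpoch Yt_eq diff_mult_distrib2)

lemma qpoch_nth_0: "0 < a \<Longrightarrow> fps_nth (qpoch a m) 0 = 1"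
  by (simp add: qpoch_def)

lemma Xi_nth_0: "0 < s \<Longrightarrow> s < 11 \<Longrightarrow> fps_nth (Xi s) 0 = 1"
  by (simp add: Xi_def Jam_def qpoch_nth_0)

lemma Yt_nth_0: "0 < s \<Longrightarrow> s < 11 \<Longrightarrow> fps_nth (Yt s) 0 = 1"
  by (simp add: Yt_eq)

text \<open>Positions 6 to 9 belong to \<open>a7\<close> to \<open>a10\<close>: undilated, the
  prefactors have exponents 0, 1, 2, 3, 4, 5, 7, 19, 9, 10, and the residue 6 modulo 11 does not
  occur.\<close>

definition Q11 :: "nat \<Rightarrow> complex fps" where
  "Q11 k = [inverse (Yt 1),
     fps_X ^ 24 * Yt 5 * inverse (Yt 2 * Yt 3),
     fps_X ^ 48 * Yt 3 * inverse (Yt 1 * Yt 4),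
     fps_X ^ 72 * Yt 2 * inverse (Yt 1 * Yt 3),
     fps_X ^ 96 * inverse (Yt 2),
     fps_X ^ 120 * Yt 4 * inverse (Yt 2 * Yt 5),
     fps_X ^ 168 * inverse (Yt 3),
     fps_X ^ 456 * Yt 1 * inverse (Yt 4 * Yt 5),
     fps_X ^ 216 * inverse (Yt 4),
     fps_X ^ 240 * inverse (Yt 5)] ! k"

lemma dil_v11:
  "dil (v11 a0 a1 a2 a3 a4 a5 a7 a8 a9 a10) = fps_const (1 / 11) * (qprod 1 2904 2904)\<^sup>2 *
    (fps_const (of_int a0) * Q11 0 + fps_const (of_int a1) * Q11 1 + fps_const (of_int a2) * Q11 2
     + fps_const (of_int a3) * Q11 3 + fps_const (of_int a4) * Q11 4 + fps_const (of_int a5) * Q11 5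
     + fps_const (of_int a7) * Q11 6 + fps_const (of_int a8) * Q11 7 + fps_const (of_int a9) * Q11 8
     + fps_const (of_int a10) * Q11 9)"
  unfolding v11_def dil_add dil_mult dil_const dil_X_power dil_power[of "Jm 121"]
  by (simp add: dil_inverse dil_mult Xi_nth_0 dil_Xi dil_Jm Q11_def of_rat_divide mult.assoc)

section \<open>The crank series at a nontrivial eleventh root of unity\<close>

lemma sum_powers_11_eq_0:
  fixes z :: complex
  assumes "z ^ 11 = 1" "z \<noteq> 1"
  shows "1 + z + z ^ 2 + z ^ 3 + z ^ 4 + z ^ 5 + z ^ 6 + z ^ 7 + z ^ 8 + z ^ 9 + z ^ 10 = 0"
proof -
  have "(1 - z) * (1 + z + z ^ 2 + z ^ 3 + z ^ 4 + z ^ 5 + z ^ 6 + z ^ 7 + z ^ 8 + z ^ 9 + z ^ 10) = 1 - z ^ 11"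
    by algebra
  then show ?thesis using assms by simp
qed

lemma theta_at_constant:
  assumes "a \<noteq> 0"
  shows "theta a 0 12 = fps_const (1 - a) * (qprod a 24 24 * qprod (1 / a) 24 24) * qprod 1 24 24"
proof -
  have "qprod a 0 24 = fps_const (1 - a) * qprod a 24 24"
    by (subst qprod_Suc) (auto simp: qfac_def simp flip: fps_const_sub)
  then show ?thesis
    using jacobi_triple_product[of 12 0 a] assms by (simp add: mult.assoc)
qed

text \<open>Diagonal terms cancel and the others pair up into 2 by 2 minors. The larger index stands
  first, as \<open>Psi_Chi_product\<close> requires, and the order of the pairs is that of
  \<open>Q11\<close>.\<close>

lemma antisymmetric_sum:
  fixes a1 :: "'a::comm_ring_1"
  shows "(a1 * p1 + a2 * p2 + a3 * p3 + a4 * p4 + a5 * p5) * (b1 * c1 + b2 * c2 + b3 * c3 + b4 * c4 + b5 * c5)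
    - (a1 * c1 + a2 * c2 + a3 * c3 + a4 * c4 + a5 * c5) * (b1 * p1 + b2 * p2 + b3 * p3 + b4 * p4 + b5 * p5)
    = (a5 * b2 - a2 * b5) * (p5 * c2 - c5 * p2)
      + (a5 * b1 - a1 * b5) * (p5 * c1 - c5 * p1)
      + (a5 * b3 - a3 * b5) * (p5 * c3 - c5 * p3)
      + (a4 * b2 - a2 * b4) * (p4 * c2 - c4 * p2)
      + (a4 * b1 - a1 * b4) * (p4 * c1 - c4 * p1)
      + (a4 * b3 - a3 * b4) * (p4 * c3 - c4 * p3)
      + (a5 * b4 - a4 * b5) * (p5 * c4 - c5 * p4)
      + (a2 * b1 - a1 * b2) * (p2 * c1 - c2 * p1)
      + (a3 * b2 - a2 * b3) * (p3 * c2 - c3 * p2)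
      + (a3 * b1 - a1 * b3) * (p3 * c1 - c3 * p1)"
  by (simp add: algebra_simps)

text \<open>Each displayed coefficient is z^3 times a minor of the dissection coefficients, divided
  by the constant \<open>K\<close> and reduced modulo the 11th cyclotomic polynomial.\<close>

theorem crank_dissection:
  fixes z :: complex
  assumes z: "z ^ 11 = 1" "z \<noteq> 1"
  defines "C \<equiv> Abs_fps (crank_poly z) oo fps_X ^ 24"
  shows "C * qprod 1 264 264 * (qprod 1 2904 2904)\<^sup>2 = fps_const (1) * (fps_X ^ 0 * (Yt 5 * Yt 2 * Yt 7 * Yt 3))
      + fps_const (- (1) + z + z ^ 10) * (fps_X ^ 24 * (Yt 5 * Yt 1 * Yt 6 * Yt 4))
      + fps_const (z ^ 2 + z ^ 9) * (fps_X ^ 48 * (Yt 5 * Yt 3 * Yt 8 * Yt 2))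
      + fps_const (1 + z ^ 3 + z ^ 8) * (fps_X ^ 72 * (Yt 4 * Yt 2 * Yt 6 * Yt 2))
      + fps_const (1 + z ^ 2 + z ^ 4 + z ^ 7 + z ^ 9) * (fps_X ^ 96 * (Yt 4 * Yt 1 * Yt 5 * Yt 3))
      + fps_const (- (z ^ 2) - z ^ 4 - z ^ 7 - z ^ 9) * (fps_X ^ 120 * (Yt 4 * Yt 3 * Yt 7 * Yt 1))
      + fps_const (z + z ^ 4 + z ^ 7 + z ^ 10) * (fps_X ^ 168 * (Yt 5 * Yt 4 * Yt 9 * Yt 1))
      + fps_const (z + z ^ 3 + z ^ 4 + z ^ 7 + z ^ 8 + z ^ 10) * (fps_X ^ 456 * (Yt 2 * Yt 1 * Yt 3 * Yt 1))
      + fps_const (- (1) - z ^ 4 - z ^ 7) * (fps_X ^ 216 * (Yt 3 * Yt 2 * Yt 5 * Yt 1))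
      + fps_const (- (z ^ 3) - z ^ 8) * (fps_X ^ 240 * (Yt 3 * Yt 1 * Yt 4 * Yt 2))"
proof -
  define P J where "P = qprod (1::complex) 24 24" and "J = qprod (1::complex) 2904 2904"
  define R where "R k = qprod (z ^ k) 24 24 * qprod (1 / z ^ k) 24 24" for k
  define K where "K = (1 - z ^ 5) * (1 - z ^ 2) * (1 - z ^ 7) * (1 - z ^ 3)"
  define S where "S = sq_series (z ^ 8) 1 0 (- 3) * (sq_series z 1 0 (- 1) - sq_series z 1 0 1)
    - (sq_series (z ^ 8) 1 0 (- 1) - sq_series (z ^ 8) 1 0 1) * sq_series z 1 0 (- 3)"
  have z0: "z \<noteq> 0" using z by auto
  have red: "z ^ n = z ^ (n mod 11)" for n
  proof -
    have "z ^ n = z ^ (11 * (n div 11) + n mod 11)" by simp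
    also have "\<dots> = z ^ (n mod 11)" unfolding power_add power_mult z by simp
    finally show ?thesis .
  qed
  have K0: "K \<noteq> 0"
    unfolding K_def using root_of_unity_11_power_neq_1[OF z] by simp
  have P0: "P \<noteq> 0"
  proof
    assume "P = 0"
    moreover have "fps_nth P 0 = 1" by (simp add: P_def)
    ultimately show False by simp
  qed
  have inv: "1 / z ^ k = z ^ (11 - k)" if "k \<le> 11" for k
  proof -
    have "z ^ k * z ^ (11 - k) = 1" using that z by (simp flip: power_add)
    then show ?thesis using z0 by (simp add: field_simps)
  qed
  have R7: "R 7 = R 4"
    using inv[of 4] inv[of 7] by (simp add: R_def mult.commute)
  \<comment> \<open>The factor with k = 0 is \<open>P\<close>, and the factors for k and 11 - k
    combine to \<open>R k\<close>.\<close>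
  have prodR: "P * (R 1 * R 2 * R 3 * R 4 * R 5) = qprod 1 264 264"
    using prod_qprod_roots[OF z] inv[of 1] inv[of 2] inv[of 3] inv[of 4] inv[of 5]
    unfolding prod_lessThan_11 by (simp add: R_def P_def ac_simps)
  have crank: "C * R 1 = P"
  proof -
    have "(Abs_fps (crank_poly z) * (qprod z 1 1 * qprod (1 / z) 1 1)) oo fps_X ^ 24 = qprod 1 1 1 oo fps_X ^ 24"
      unfolding crank_generating_function[OF z0] ..
    then show ?thesis
      by (simp add: fps_compose_mult_distrib[OF X24] qprod_dilate C_def R_def P_def)
  qed
  have th: "theta (z ^ k) 0 12 = fps_const (1 - z ^ k) * R k * P" for k
    using theta_at_constant[of "z ^ k"] z0 by (simp add: R_def P_def)
  have u2: "(z ^ 8)\<^sup>2 = z ^ 5" "(z ^ 8)\<^sup>2 * z\<^sup>2 = z ^ 7" "(z ^ 8)\<^sup>2 / z\<^sup>2 = z ^ 3"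
    using z0 red[of 16] red[of 18] red[of 14]
    by (simp_all add: power_mult[symmetric] power_add[symmetric] power_diff[symmetric])
  have zz: "(z ^ 8) ^ 3 * z = z ^ 3"
    using red[of 25] by (simp add: power_mult[symmetric] power_Suc2[symmetric])
  have "fps_X ^ 10 * (theta (z ^ 5) 0 12 * theta (z ^ 2) 0 12 * (theta (z ^ 7) 0 12 * theta (z ^ 3) 0 12))
      = fps_const (z ^ 3) * P\<^sup>2 * S"
    using winquist[of "z ^ 8" z 1 0 0] z0 unfolding u2(2,3) unfolding u2(1) zz by (simp add: S_def P_def)
  then have "P\<^sup>2 * (fps_X ^ 10 * fps_const K * (P\<^sup>2 * (R 2 * R 3 * R 4 * R 5))) = P\<^sup>2 * (fps_const (z ^ 3) * S)"
    unfolding th R7 K_def by (simp add: ac_simps power2_eq_square flip: fps_const_mult)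
  then have "fps_X ^ 10 * fps_const K * (P\<^sup>2 * (R 2 * R 3 * R 4 * R 5)) = fps_const (z ^ 3) * S"
    using P0 by simp
  \<comment> \<open>One copy of \<open>P\<close> is replaced by \<open>C * R 1\<close>; the other
    completes the product over all eleven roots.\<close>
  moreover have "P\<^sup>2 * (R 2 * R 3 * R 4 * R 5) = C * qprod 1 264 264"
    unfolding prodR[symmetric] power2_eq_square by (simp add: ac_simps flip: crank)
  ultimately have CS: "fps_X ^ 10 * fps_const K * (C * qprod 1 264 264) = fps_const (z ^ 3) * S"
    by simp
  define a1 where "a1 = z ^ 4 - z ^ 7"
  define a2 where "a2 = z ^ 3 - z ^ 8"
  define a3 where "a3 = z ^ 1 - z ^ 10"
  define a4 where "a4 = z ^ 6 - z ^ 5"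
  define a5 where "a5 = z ^ 9 - z ^ 2"
  define b1 where "b1 = z ^ 6 - z ^ 5"
  define b2 where "b2 = z ^ 10 - z ^ 1"
  define b3 where "b3 = z ^ 7 - z ^ 4"
  define b4 where "b4 = z ^ 9 - z ^ 2"
  define b5 where "b5 = z ^ 8 - z ^ 3"
  have a: "(z ^ 8) ^ 6 - (z ^ 8) ^ 60 = a1" "(z ^ 8) ^ 54 - (z ^ 8) ^ 12 = a2" "(z ^ 8) ^ 18 - (z ^ 8) ^ 48 = a3" "(z ^ 8) ^ 42 - (z ^ 8) ^ 24 = a4" "(z ^ 8) ^ 30 - (z ^ 8) ^ 36 = a5"
    unfolding a1_def a2_def a3_def a4_def a5_def power_mult[symmetric] using red[of 48] red[of 96] red[of 144] red[of 192] red[of 240] red[of 288] red[of 336] red[of 384] red[of 432] red[of 480] by simp_all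
  have b: "z ^ 6 - z ^ 60 = b1" "z ^ 54 - z ^ 12 = b2" "z ^ 18 - z ^ 48 = b3" "z ^ 42 - z ^ 24 = b4" "z ^ 30 - z ^ 36 = b5"
    unfolding b1_def b2_def b3_def b4_def b5_def power_mult[symmetric] using red[of 12] red[of 18] red[of 24] red[of 30] red[of 36] red[of 42] red[of 48] red[of 54] red[of 60] by simp_all
  have u11: "(z ^ 8) ^ 11 = 1"
    using red[of 88] by (simp add: power_mult[symmetric])
  have S: "S = fps_const (a5 * b2 - a2 * b5) * (Psi 5 * Chi 2 - Chi 5 * Psi 2)
      + fps_const (a5 * b1 - a1 * b5) * (Psi 5 * Chi 1 - Chi 5 * Psi 1)
      + fps_const (a5 * b3 - a3 * b5) * (Psi 5 * Chi 3 - Chi 5 * Psi 3)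
      + fps_const (a4 * b2 - a2 * b4) * (Psi 4 * Chi 2 - Chi 4 * Psi 2)
      + fps_const (a4 * b1 - a1 * b4) * (Psi 4 * Chi 1 - Chi 4 * Psi 1)
      + fps_const (a4 * b3 - a3 * b4) * (Psi 4 * Chi 3 - Chi 4 * Psi 3)
      + fps_const (a5 * b4 - a4 * b5) * (Psi 5 * Chi 4 - Chi 5 * Psi 4)
      + fps_const (a2 * b1 - a1 * b2) * (Psi 2 * Chi 1 - Chi 2 * Psi 1)
      + fps_const (a3 * b2 - a2 * b3) * (Psi 3 * Chi 2 - Chi 3 * Psi 2)
      + fps_const (a3 * b1 - a1 * b3) * (Psi 3 * Chi 1 - Chi 3 * Psi 1)"
    unfolding S_def Psi_dissect[OF u11] Chi_dissect[OF u11] Psi_dissect[OF z(1)] Chi_dissect[OF z(1)] a b antisymmetric_sum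
    by (simp only: fps_const_mult fps_const_sub)
  \<comment> \<open>Every exponent exceeds by 10 a multiple of 24. The 10 is the one brought in by
    \<open>winquist\<close> at \<open>\<kappa> = 1\<close>, \<open>i = j = 0\<close> and cancels
    against it.\<close>
  have pr: "J\<^sup>2 * (Psi 5 * Chi 2 - Chi 5 * Psi 2) = fps_X ^ 10 * (Yt 5 * Yt 2 * Yt 7 * Yt 3)"
    "J\<^sup>2 * (Psi 5 * Chi 1 - Chi 5 * Psi 1) = fps_X ^ 34 * (Yt 5 * Yt 1 * Yt 6 * Yt 4)"
    "J\<^sup>2 * (Psi 5 * Chi 3 - Chi 5 * Psi 3) = fps_X ^ 58 * (Yt 5 * Yt 3 * Yt 8 * Yt 2)"
    "J\<^sup>2 * (Psi 4 * Chi 2 - Chi 4 * Psi 2) = fps_X ^ 82 * (Yt 4 * Yt 2 * Yt 6 * Yt 2)"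
    "J\<^sup>2 * (Psi 4 * Chi 1 - Chi 4 * Psi 1) = fps_X ^ 106 * (Yt 4 * Yt 1 * Yt 5 * Yt 3)"
    "J\<^sup>2 * (Psi 4 * Chi 3 - Chi 4 * Psi 3) = fps_X ^ 130 * (Yt 4 * Yt 3 * Yt 7 * Yt 1)"
    "J\<^sup>2 * (Psi 5 * Chi 4 - Chi 5 * Psi 4) = fps_X ^ 178 * (Yt 5 * Yt 4 * Yt 9 * Yt 1)"
    "J\<^sup>2 * (Psi 2 * Chi 1 - Chi 2 * Psi 1) = fps_X ^ 466 * (Yt 2 * Yt 1 * Yt 3 * Yt 1)"
    "J\<^sup>2 * (Psi 3 * Chi 2 - Chi 3 * Psi 2) = fps_X ^ 226 * (Yt 3 * Yt 2 * Yt 5 * Yt 1)"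
    "J\<^sup>2 * (Psi 3 * Chi 1 - Chi 3 * Psi 1) = fps_X ^ 250 * (Yt 3 * Yt 1 * Yt 4 * Yt 2)"
    unfolding J_def
    by (subst Psi_Chi_product, simp, simp, simp add: power2_eq_square, simp)+
  have lift: "J\<^sup>2 * (c * D) = fps_X ^ 10 * (c * (fps_X ^ f * Y))"
    if "J\<^sup>2 * D = fps_X ^ e * Y" "e = 10 + f" for c D Y e f
  proof -
    have "J\<^sup>2 * (c * D) = c * (J\<^sup>2 * D)" by (simp only: mult.left_commute)
    also have "\<dots> = fps_X ^ 10 * (c * (fps_X ^ f * Y))"
      unfolding that power_add by (simp only: ac_simps)
    finally show ?thesis .
  qed
  have JS: "J\<^sup>2 * S = fps_X ^ 10 * (fps_const (a5 * b2 - a2 * b5) * (fps_X ^ 0 * (Yt 5 * Yt 2 * Yt 7 * Yt 3))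
      + fps_const (a5 * b1 - a1 * b5) * (fps_X ^ 24 * (Yt 5 * Yt 1 * Yt 6 * Yt 4))
      + fps_const (a5 * b3 - a3 * b5) * (fps_X ^ 48 * (Yt 5 * Yt 3 * Yt 8 * Yt 2))
      + fps_const (a4 * b2 - a2 * b4) * (fps_X ^ 72 * (Yt 4 * Yt 2 * Yt 6 * Yt 2))
      + fps_const (a4 * b1 - a1 * b4) * (fps_X ^ 96 * (Yt 4 * Yt 1 * Yt 5 * Yt 3))
      + fps_const (a4 * b3 - a3 * b4) * (fps_X ^ 120 * (Yt 4 * Yt 3 * Yt 7 * Yt 1))
      + fps_const (a5 * b4 - a4 * b5) * (fps_X ^ 168 * (Yt 5 * Yt 4 * Yt 9 * Yt 1))
      + fps_const (a2 * b1 - a1 * b2) * (fps_X ^ 456 * (Yt 2 * Yt 1 * Yt 3 * Yt 1))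
      + fps_const (a3 * b2 - a2 * b3) * (fps_X ^ 216 * (Yt 3 * Yt 2 * Yt 5 * Yt 1))
      + fps_const (a3 * b1 - a1 * b3) * (fps_X ^ 240 * (Yt 3 * Yt 1 * Yt 4 * Yt 2)))"
    unfolding S distrib_left
    by (intro arg_cong2[where f = "(+)"]; rule lift, rule pr, simp)
  note phi = sum_powers_11_eq_0[OF z]
  have k: "z ^ 3 * (a5 * b2 - a2 * b5) = K * (1)"
    "z ^ 3 * (a5 * b1 - a1 * b5) = K * (- (1) + z + z ^ 10)"
    "z ^ 3 * (a5 * b3 - a3 * b5) = K * (z ^ 2 + z ^ 9)"
    "z ^ 3 * (a4 * b2 - a2 * b4) = K * (1 + z ^ 3 + z ^ 8)"
    "z ^ 3 * (a4 * b1 - a1 * b4) = K * (1 + z ^ 2 + z ^ 4 + z ^ 7 + z ^ 9)"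
    "z ^ 3 * (a4 * b3 - a3 * b4) = K * (- (z ^ 2) - z ^ 4 - z ^ 7 - z ^ 9)"
    "z ^ 3 * (a5 * b4 - a4 * b5) = K * (z + z ^ 4 + z ^ 7 + z ^ 10)"
    "z ^ 3 * (a2 * b1 - a1 * b2) = K * (z + z ^ 3 + z ^ 4 + z ^ 7 + z ^ 8 + z ^ 10)"
    "z ^ 3 * (a3 * b2 - a2 * b3) = K * (- (1) - z ^ 4 - z ^ 7)"
    "z ^ 3 * (a3 * b1 - a1 * b3) = K * (- (z ^ 3) - z ^ 8)"
  proof -
    \<comment> \<open>In each of the ten identities the last factor is the quotient of the
      difference by the cyclotomic polynomial, which vanishes at \<open>z\<close>.\<close>
    have "K * (1) - z ^ 3 * (a5 * b2 - a2 * b5)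
        = (1 + z + z ^ 2 + z ^ 3 + z ^ 4 + z ^ 5 + z ^ 6 + z ^ 7 + z ^ 8 + z ^ 9 + z ^ 10) * (1 - z - z ^ 2 + z ^ 4 - z ^ 6 + z ^ 7 + z ^ 8 - z ^ 9 + z ^ 11 - z ^ 12)"
      unfolding K_def a5_def a2_def b5_def b2_def by algebra
    then show "z ^ 3 * (a5 * b2 - a2 * b5) = K * (1)"
      unfolding phi by simp
    have "K * (- (1) + z + z ^ 10) - z ^ 3 * (a5 * b1 - a1 * b5)
        = (1 + z + z ^ 2 + z ^ 3 + z ^ 4 + z ^ 5 + z ^ 6 + z ^ 7 + z ^ 8 + z ^ 9 + z ^ 10) * (- (1) + 2 * z - z ^ 3 - z ^ 4 + z ^ 5 - z ^ 8 + z ^ 9 + z ^ 13 - z ^ 15 - z ^ 16 + z ^ 17)"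
      unfolding K_def a5_def a1_def b5_def b1_def by algebra
    then show "z ^ 3 * (a5 * b1 - a1 * b5) = K * (- (1) + z + z ^ 10)"
      unfolding phi by simp
    have "K * (z ^ 2 + z ^ 9) - z ^ 3 * (a5 * b3 - a3 * b5)
        = (1 + z + z ^ 2 + z ^ 3 + z ^ 4 + z ^ 5 + z ^ 6 + z ^ 7 + z ^ 8 + z ^ 9 + z ^ 10) * (z ^ 2 - z ^ 3 - z ^ 4 + z ^ 6 - z ^ 7 + z ^ 8 + z ^ 10 - z ^ 11 + z ^ 12 - z ^ 14 - z ^ 15 + z ^ 16)"
      unfolding K_def a5_def a3_def b5_def b3_def by algebra
    then show "z ^ 3 * (a5 * b3 - a3 * b5) = K * (z ^ 2 + z ^ 9)"
      unfolding phi by simp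
    have "K * (1 + z ^ 3 + z ^ 8) - z ^ 3 * (a4 * b2 - a2 * b4)
        = (1 + z + z ^ 2 + z ^ 3 + z ^ 4 + z ^ 5 + z ^ 6 + z ^ 7 + z ^ 8 + z ^ 9 + z ^ 10) * (1 - z - z ^ 2 + z ^ 3 - z ^ 5 + z ^ 7 + z ^ 8 - z ^ 9 + z ^ 11 - z ^ 13 - z ^ 14 + z ^ 15)"
      unfolding K_def a4_def a2_def b4_def b2_def by algebra
    then show "z ^ 3 * (a4 * b2 - a2 * b4) = K * (1 + z ^ 3 + z ^ 8)"
      unfolding phi by simp
    have "K * (1 + z ^ 2 + z ^ 4 + z ^ 7 + z ^ 9) - z ^ 3 * (a4 * b1 - a1 * b4)
        = (1 + z + z ^ 2 + z ^ 3 + z ^ 4 + z ^ 5 + z ^ 6 + z ^ 7 + z ^ 8 + z ^ 9 + z ^ 10) * (1 - z - z ^ 3 + z ^ 4 - z ^ 5 + z ^ 7 + z ^ 8 - z ^ 9 + z ^ 11 - z ^ 13 - z ^ 15 + z ^ 16)"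
      unfolding K_def a4_def a1_def b4_def b1_def by algebra
    then show "z ^ 3 * (a4 * b1 - a1 * b4) = K * (1 + z ^ 2 + z ^ 4 + z ^ 7 + z ^ 9)"
      unfolding phi by simp
    have "K * (- (z ^ 2) - z ^ 4 - z ^ 7 - z ^ 9) - z ^ 3 * (a4 * b3 - a3 * b4)
        = (1 + z + z ^ 2 + z ^ 3 + z ^ 4 + z ^ 5 + z ^ 6 + z ^ 7 + z ^ 8 + z ^ 9 + z ^ 10) * (- (z ^ 2) + z ^ 3 + z ^ 5 - z ^ 6 - z ^ 12 + z ^ 13 + z ^ 15 - z ^ 16)"
      unfolding K_def a4_def a3_def b4_def b3_def by algebra
    then show "z ^ 3 * (a4 * b3 - a3 * b4) = K * (- (z ^ 2) - z ^ 4 - z ^ 7 - z ^ 9)"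
      unfolding phi by simp
    have "K * (z + z ^ 4 + z ^ 7 + z ^ 10) - z ^ 3 * (a5 * b4 - a4 * b5)
        = (1 + z + z ^ 2 + z ^ 3 + z ^ 4 + z ^ 5 + z ^ 6 + z ^ 7 + z ^ 8 + z ^ 9 + z ^ 10) * (z - z ^ 2 - z ^ 3 + z ^ 4 - z ^ 6 + z ^ 8 + z ^ 10 - z ^ 12 + z ^ 14 - z ^ 15 - z ^ 16 + z ^ 17)"
      unfolding K_def a5_def a4_def b5_def b4_def by algebra
    then show "z ^ 3 * (a5 * b4 - a4 * b5) = K * (z + z ^ 4 + z ^ 7 + z ^ 10)"
      unfolding phi by simp
    have "K * (z + z ^ 3 + z ^ 4 + z ^ 7 + z ^ 8 + z ^ 10) - z ^ 3 * (a2 * b1 - a1 * b2)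
        = (1 + z + z ^ 2 + z ^ 3 + z ^ 4 + z ^ 5 + z ^ 6 + z ^ 7 + z ^ 8 + z ^ 9 + z ^ 10) * (z - z ^ 2 - z ^ 5 - z ^ 6 + 2 * z ^ 7 + 2 * z ^ 11 - z ^ 12 - z ^ 13 - z ^ 16 + z ^ 17)"
      unfolding K_def a2_def a1_def b2_def b1_def by algebra
    then show "z ^ 3 * (a2 * b1 - a1 * b2) = K * (z + z ^ 3 + z ^ 4 + z ^ 7 + z ^ 8 + z ^ 10)"
      unfolding phi by simp
    have "K * (- (1) - z ^ 4 - z ^ 7) - z ^ 3 * (a3 * b2 - a2 * b3)
        = (1 + z + z ^ 2 + z ^ 3 + z ^ 4 + z ^ 5 + z ^ 6 + z ^ 7 + z ^ 8 + z ^ 9 + z ^ 10) * (- (1) + z + z ^ 2 - 2 * z ^ 4 + 2 * z ^ 5 - z ^ 7 - z ^ 8 + z ^ 9 - z ^ 11 + 2 * z ^ 13 - z ^ 14)"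
      unfolding K_def a3_def a2_def b3_def b2_def by algebra
    then show "z ^ 3 * (a3 * b2 - a2 * b3) = K * (- (1) - z ^ 4 - z ^ 7)"
      unfolding phi by simp
    have "K * (- (z ^ 3) - z ^ 8) - z ^ 3 * (a3 * b1 - a1 * b3)
        = (1 + z + z ^ 2 + z ^ 3 + z ^ 4 + z ^ 5 + z ^ 6 + z ^ 7 + z ^ 8 + z ^ 9 + z ^ 10) * (- (z ^ 3) + z ^ 4 + z ^ 5 - z ^ 7 - z ^ 8 + 2 * z ^ 9 - z ^ 10 - z ^ 11 + z ^ 13 + z ^ 14 - z ^ 15)"
      unfolding K_def a3_def a1_def b3_def b1_def by algebra
    then show "z ^ 3 * (a3 * b1 - a1 * b3) = K * (- (z ^ 3) - z ^ 8)"
      unfolding phi by simp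
  qed
  have "fps_X ^ 10 * (fps_const K * (C * qprod 1 264 264 * J\<^sup>2)) = fps_const (z ^ 3) * (J\<^sup>2 * S)"
  proof -
    have "fps_X ^ 10 * (fps_const K * (C * qprod 1 264 264 * J\<^sup>2))
        = J\<^sup>2 * (fps_X ^ 10 * fps_const K * (C * qprod 1 264 264))"
      by (simp only: ac_simps)
    also have "\<dots> = fps_const (z ^ 3) * (J\<^sup>2 * S)"
      unfolding CS by (rule mult.left_commute)
    finally show ?thesis .
  qed
  also have "\<dots> = fps_X ^ 10 * (fps_const (z ^ 3 * (a5 * b2 - a2 * b5)) * (fps_X ^ 0 * (Yt 5 * Yt 2 * Yt 7 * Yt 3))
      + fps_const (z ^ 3 * (a5 * b1 - a1 * b5)) * (fps_X ^ 24 * (Yt 5 * Yt 1 * Yt 6 * Yt 4))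
      + fps_const (z ^ 3 * (a5 * b3 - a3 * b5)) * (fps_X ^ 48 * (Yt 5 * Yt 3 * Yt 8 * Yt 2))
      + fps_const (z ^ 3 * (a4 * b2 - a2 * b4)) * (fps_X ^ 72 * (Yt 4 * Yt 2 * Yt 6 * Yt 2))
      + fps_const (z ^ 3 * (a4 * b1 - a1 * b4)) * (fps_X ^ 96 * (Yt 4 * Yt 1 * Yt 5 * Yt 3))
      + fps_const (z ^ 3 * (a4 * b3 - a3 * b4)) * (fps_X ^ 120 * (Yt 4 * Yt 3 * Yt 7 * Yt 1))
      + fps_const (z ^ 3 * (a5 * b4 - a4 * b5)) * (fps_X ^ 168 * (Yt 5 * Yt 4 * Yt 9 * Yt 1))
      + fps_const (z ^ 3 * (a2 * b1 - a1 * b2)) * (fps_X ^ 456 * (Yt 2 * Yt 1 * Yt 3 * Yt 1))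
      + fps_const (z ^ 3 * (a3 * b2 - a2 * b3)) * (fps_X ^ 216 * (Yt 3 * Yt 2 * Yt 5 * Yt 1))
      + fps_const (z ^ 3 * (a3 * b1 - a1 * b3)) * (fps_X ^ 240 * (Yt 3 * Yt 1 * Yt 4 * Yt 2)))"
    unfolding JS mult.left_commute[of _ "fps_X ^ 10"] distrib_left[of "fps_const (z ^ 3)"] mult.assoc[symmetric, of "fps_const (z ^ 3)"] fps_const_mult ..
  finally have "fps_const K * (C * qprod 1 264 264 * J\<^sup>2) = fps_const (K * (1)) * (fps_X ^ 0 * (Yt 5 * Yt 2 * Yt 7 * Yt 3))
      + fps_const (K * (- (1) + z + z ^ 10)) * (fps_X ^ 24 * (Yt 5 * Yt 1 * Yt 6 * Yt 4))
      + fps_const (K * (z ^ 2 + z ^ 9)) * (fps_X ^ 48 * (Yt 5 * Yt 3 * Yt 8 * Yt 2))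
      + fps_const (K * (1 + z ^ 3 + z ^ 8)) * (fps_X ^ 72 * (Yt 4 * Yt 2 * Yt 6 * Yt 2))
      + fps_const (K * (1 + z ^ 2 + z ^ 4 + z ^ 7 + z ^ 9)) * (fps_X ^ 96 * (Yt 4 * Yt 1 * Yt 5 * Yt 3))
      + fps_const (K * (- (z ^ 2) - z ^ 4 - z ^ 7 - z ^ 9)) * (fps_X ^ 120 * (Yt 4 * Yt 3 * Yt 7 * Yt 1))
      + fps_const (K * (z + z ^ 4 + z ^ 7 + z ^ 10)) * (fps_X ^ 168 * (Yt 5 * Yt 4 * Yt 9 * Yt 1))
      + fps_const (K * (z + z ^ 3 + z ^ 4 + z ^ 7 + z ^ 8 + z ^ 10)) * (fps_X ^ 456 * (Yt 2 * Yt 1 * Yt 3 * Yt 1))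
      + fps_const (K * (- (1) - z ^ 4 - z ^ 7)) * (fps_X ^ 216 * (Yt 3 * Yt 2 * Yt 5 * Yt 1))
      + fps_const (K * (- (z ^ 3) - z ^ 8)) * (fps_X ^ 240 * (Yt 3 * Yt 1 * Yt 4 * Yt 2))"
    unfolding k by simp
  also have "\<dots> = fps_const K * (fps_const (1) * (fps_X ^ 0 * (Yt 5 * Yt 2 * Yt 7 * Yt 3))
      + fps_const (- (1) + z + z ^ 10) * (fps_X ^ 24 * (Yt 5 * Yt 1 * Yt 6 * Yt 4))
      + fps_const (z ^ 2 + z ^ 9) * (fps_X ^ 48 * (Yt 5 * Yt 3 * Yt 8 * Yt 2))
      + fps_const (1 + z ^ 3 + z ^ 8) * (fps_X ^ 72 * (Yt 4 * Yt 2 * Yt 6 * Yt 2))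
      + fps_const (1 + z ^ 2 + z ^ 4 + z ^ 7 + z ^ 9) * (fps_X ^ 96 * (Yt 4 * Yt 1 * Yt 5 * Yt 3))
      + fps_const (- (z ^ 2) - z ^ 4 - z ^ 7 - z ^ 9) * (fps_X ^ 120 * (Yt 4 * Yt 3 * Yt 7 * Yt 1))
      + fps_const (z + z ^ 4 + z ^ 7 + z ^ 10) * (fps_X ^ 168 * (Yt 5 * Yt 4 * Yt 9 * Yt 1))
      + fps_const (z + z ^ 3 + z ^ 4 + z ^ 7 + z ^ 8 + z ^ 10) * (fps_X ^ 456 * (Yt 2 * Yt 1 * Yt 3 * Yt 1))
      + fps_const (- (1) - z ^ 4 - z ^ 7) * (fps_X ^ 216 * (Yt 3 * Yt 2 * Yt 5 * Yt 1))
      + fps_const (- (z ^ 3) - z ^ 8) * (fps_X ^ 240 * (Yt 3 * Yt 1 * Yt 4 * Yt 2)))"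
    unfolding distrib_left[of "fps_const K"] by (simp only: fps_const_mult[symmetric] mult.assoc)
  finally show ?thesis
    using K0 unfolding J_def by simp
qed

section \<open>Inverting the discrete Fourier transform\<close>

text \<open>Denominators are cleared by J11 J^2: together with the prefactor J^2 it equals the
  product of \<open>Yt 1\<close> to \<open>Yt 5\<close>, in which each denominator of
  \<open>Q11\<close> cancels. The reflection s -> 11 - s brings indices 6 to 9 back into
  range.\<close>

lemma crank_gf_dissected:
  fixes z :: complex
  assumes z: "z ^ 11 = 1" "z \<noteq> 1"
  shows "Abs_fps (crank_poly z) oo fps_X ^ 24 = (qprod 1 2904 2904)\<^sup>2 * (fps_const (1) * Q11 0
      + fps_const (- (1) + z + z ^ 10) * Q11 1
      + fps_const (z ^ 2 + z ^ 9) * Q11 2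
      + fps_const (1 + z ^ 3 + z ^ 8) * Q11 3
      + fps_const (1 + z ^ 2 + z ^ 4 + z ^ 7 + z ^ 9) * Q11 4
      + fps_const (- (z ^ 2) - z ^ 4 - z ^ 7 - z ^ 9) * Q11 5
      + fps_const (z + z ^ 4 + z ^ 7 + z ^ 10) * Q11 6
      + fps_const (z + z ^ 3 + z ^ 4 + z ^ 7 + z ^ 8 + z ^ 10) * Q11 7
      + fps_const (- (1) - z ^ 4 - z ^ 7) * Q11 8
      + fps_const (- (z ^ 3) - z ^ 8) * Q11 9)"
proof -
  define J J11 where "J = qprod (1::complex) 2904 2904" and "J11 = qprod (1::complex) 264 264"
  have J0: "J \<noteq> 0" "J11 \<noteq> 0"
    using qprod_nth_0[of 2904 2904 "1::complex"] qprod_nth_0[of 264 264 "1::complex"] unfolding J_def J11_def by force+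
  define y w where "y i = Yt i" and "w i = inverse (Yt i)" for i
  have yw: "y 1 * w 1 = 1" "y 2 * w 2 = 1" "y 3 * w 3 = 1" "y 4 * w 4 = 1" "y 5 * w 5 = 1"
    by (simp_all add: y_def w_def inverse_mult_eq_1' Yt_nth_0)
  have refl: "Yt 6 = y 5" "Yt 7 = y 4" "Yt 8 = y 3" "Yt 9 = y 2"
    using Yt_reflect[of 5] Yt_reflect[of 4] Yt_reflect[of 3] Yt_reflect[of 2] by (simp_all add: y_def)
  have prod: "J\<^sup>2 * (J11 * J\<^sup>2) = y 1 * y 2 * y 3 * y 4 * y 5"
    using Yt_product by (simp add: J_def J11_def y_def power4_eq_xxxx power2_eq_square ac_simps)
  have trm: "J\<^sup>2 * Q11 0 * (J11 * J\<^sup>2) = fps_X ^ 0 * (Yt 5 * Yt 2 * Yt 7 * Yt 3)"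
    "J\<^sup>2 * Q11 1 * (J11 * J\<^sup>2) = fps_X ^ 24 * (Yt 5 * Yt 1 * Yt 6 * Yt 4)"
    "J\<^sup>2 * Q11 2 * (J11 * J\<^sup>2) = fps_X ^ 48 * (Yt 5 * Yt 3 * Yt 8 * Yt 2)"
    "J\<^sup>2 * Q11 3 * (J11 * J\<^sup>2) = fps_X ^ 72 * (Yt 4 * Yt 2 * Yt 6 * Yt 2)"
    "J\<^sup>2 * Q11 4 * (J11 * J\<^sup>2) = fps_X ^ 96 * (Yt 4 * Yt 1 * Yt 5 * Yt 3)"
    "J\<^sup>2 * Q11 5 * (J11 * J\<^sup>2) = fps_X ^ 120 * (Yt 4 * Yt 3 * Yt 7 * Yt 1)"
    "J\<^sup>2 * Q11 6 * (J11 * J\<^sup>2) = fps_X ^ 168 * (Yt 5 * Yt 4 * Yt 9 * Yt 1)"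
    "J\<^sup>2 * Q11 7 * (J11 * J\<^sup>2) = fps_X ^ 456 * (Yt 2 * Yt 1 * Yt 3 * Yt 1)"
    "J\<^sup>2 * Q11 8 * (J11 * J\<^sup>2) = fps_X ^ 216 * (Yt 3 * Yt 2 * Yt 5 * Yt 1)"
    "J\<^sup>2 * Q11 9 * (J11 * J\<^sup>2) = fps_X ^ 240 * (Yt 3 * Yt 1 * Yt 4 * Yt 2)"
  proof -
    have *: "J\<^sup>2 * Q * (J11 * J\<^sup>2) = (y 1 * y 2 * y 3 * y 4 * y 5) * Q" for Q
      unfolding prod[symmetric] by (simp only: ac_simps)
    have Q: "Q11 0 = fps_X ^ 0 * w 1"
      by (simp add: Q11_def y_def w_def fps_inverse_mult mult.assoc)
    have "y 1 * y 2 * y 3 * y 4 * y 5 * (fps_X ^ 0 * w 1) = (y 1 * w 1) * (fps_X ^ 0 * (y 5 * y 2 * y 4 * y 3))"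
      by (simp only: ac_simps)
    then show "J\<^sup>2 * Q11 0 * (J11 * J\<^sup>2) = fps_X ^ 0 * (Yt 5 * Yt 2 * Yt 7 * Yt 3)"
      unfolding refl unfolding y_def[symmetric] * Q yw by (simp only: mult_1_left)
    have Q: "Q11 1 = fps_X ^ 24 * y 5 * w 2 * w 3"
      by (simp add: Q11_def y_def w_def fps_inverse_mult mult.assoc)
    have "y 1 * y 2 * y 3 * y 4 * y 5 * (fps_X ^ 24 * y 5 * w 2 * w 3) = (y 2 * w 2) * (y 3 * w 3) * (fps_X ^ 24 * (y 5 * y 1 * y 5 * y 4))"
      by (simp only: ac_simps)
    then show "J\<^sup>2 * Q11 1 * (J11 * J\<^sup>2) = fps_X ^ 24 * (Yt 5 * Yt 1 * Yt 6 * Yt 4)"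
      unfolding refl unfolding y_def[symmetric] * Q yw by (simp only: mult_1_left)
    have Q: "Q11 2 = fps_X ^ 48 * y 3 * w 1 * w 4"
      by (simp add: Q11_def y_def w_def fps_inverse_mult mult.assoc)
    have "y 1 * y 2 * y 3 * y 4 * y 5 * (fps_X ^ 48 * y 3 * w 1 * w 4) = (y 1 * w 1) * (y 4 * w 4) * (fps_X ^ 48 * (y 5 * y 3 * y 3 * y 2))"
      by (simp only: ac_simps)
    then show "J\<^sup>2 * Q11 2 * (J11 * J\<^sup>2) = fps_X ^ 48 * (Yt 5 * Yt 3 * Yt 8 * Yt 2)"
      unfolding refl unfolding y_def[symmetric] * Q yw by (simp only: mult_1_left)
    have Q: "Q11 3 = fps_X ^ 72 * y 2 * w 1 * w 3"
      by (simp add: Q11_def y_def w_def fps_inverse_mult mult.assoc)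
    have "y 1 * y 2 * y 3 * y 4 * y 5 * (fps_X ^ 72 * y 2 * w 1 * w 3) = (y 1 * w 1) * (y 3 * w 3) * (fps_X ^ 72 * (y 4 * y 2 * y 5 * y 2))"
      by (simp only: ac_simps)
    then show "J\<^sup>2 * Q11 3 * (J11 * J\<^sup>2) = fps_X ^ 72 * (Yt 4 * Yt 2 * Yt 6 * Yt 2)"
      unfolding refl unfolding y_def[symmetric] * Q yw by (simp only: mult_1_left)
    have Q: "Q11 4 = fps_X ^ 96 * w 2"
      by (simp add: Q11_def y_def w_def fps_inverse_mult mult.assoc)
    have "y 1 * y 2 * y 3 * y 4 * y 5 * (fps_X ^ 96 * w 2) = (y 2 * w 2) * (fps_X ^ 96 * (y 4 * y 1 * y 5 * y 3))"
      by (simp only: ac_simps)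
    then show "J\<^sup>2 * Q11 4 * (J11 * J\<^sup>2) = fps_X ^ 96 * (Yt 4 * Yt 1 * Yt 5 * Yt 3)"
      unfolding refl unfolding y_def[symmetric] * Q yw by (simp only: mult_1_left)
    have Q: "Q11 5 = fps_X ^ 120 * y 4 * w 2 * w 5"
      by (simp add: Q11_def y_def w_def fps_inverse_mult mult.assoc)
    have "y 1 * y 2 * y 3 * y 4 * y 5 * (fps_X ^ 120 * y 4 * w 2 * w 5) = (y 2 * w 2) * (y 5 * w 5) * (fps_X ^ 120 * (y 4 * y 3 * y 4 * y 1))"
      by (simp only: ac_simps)
    then show "J\<^sup>2 * Q11 5 * (J11 * J\<^sup>2) = fps_X ^ 120 * (Yt 4 * Yt 3 * Yt 7 * Yt 1)"
      unfolding refl unfolding y_def[symmetric] * Q yw by (simp only: mult_1_left)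
    have Q: "Q11 6 = fps_X ^ 168 * w 3"
      by (simp add: Q11_def y_def w_def fps_inverse_mult mult.assoc)
    have "y 1 * y 2 * y 3 * y 4 * y 5 * (fps_X ^ 168 * w 3) = (y 3 * w 3) * (fps_X ^ 168 * (y 5 * y 4 * y 2 * y 1))"
      by (simp only: ac_simps)
    then show "J\<^sup>2 * Q11 6 * (J11 * J\<^sup>2) = fps_X ^ 168 * (Yt 5 * Yt 4 * Yt 9 * Yt 1)"
      unfolding refl unfolding y_def[symmetric] * Q yw by (simp only: mult_1_left)
    have Q: "Q11 7 = fps_X ^ 456 * y 1 * w 4 * w 5"
      by (simp add: Q11_def y_def w_def fps_inverse_mult mult.assoc)
    have "y 1 * y 2 * y 3 * y 4 * y 5 * (fps_X ^ 456 * y 1 * w 4 * w 5) = (y 4 * w 4) * (y 5 * w 5) * (fps_X ^ 456 * (y 2 * y 1 * y 3 * y 1))"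
      by (simp only: ac_simps)
    then show "J\<^sup>2 * Q11 7 * (J11 * J\<^sup>2) = fps_X ^ 456 * (Yt 2 * Yt 1 * Yt 3 * Yt 1)"
      unfolding refl unfolding y_def[symmetric] * Q yw by (simp only: mult_1_left)
    have Q: "Q11 8 = fps_X ^ 216 * w 4"
      by (simp add: Q11_def y_def w_def fps_inverse_mult mult.assoc)
    have "y 1 * y 2 * y 3 * y 4 * y 5 * (fps_X ^ 216 * w 4) = (y 4 * w 4) * (fps_X ^ 216 * (y 3 * y 2 * y 5 * y 1))"
      by (simp only: ac_simps)
    then show "J\<^sup>2 * Q11 8 * (J11 * J\<^sup>2) = fps_X ^ 216 * (Yt 3 * Yt 2 * Yt 5 * Yt 1)"
      unfolding refl unfolding y_def[symmetric] * Q yw by (simp only: mult_1_left)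
    have Q: "Q11 9 = fps_X ^ 240 * w 5"
      by (simp add: Q11_def y_def w_def fps_inverse_mult mult.assoc)
    have "y 1 * y 2 * y 3 * y 4 * y 5 * (fps_X ^ 240 * w 5) = (y 5 * w 5) * (fps_X ^ 240 * (y 3 * y 1 * y 4 * y 2))"
      by (simp only: ac_simps)
    then show "J\<^sup>2 * Q11 9 * (J11 * J\<^sup>2) = fps_X ^ 240 * (Yt 3 * Yt 1 * Yt 4 * Yt 2)"
      unfolding refl unfolding y_def[symmetric] * Q yw by (simp only: mult_1_left)
  qed
  have "(Abs_fps (crank_poly z) oo fps_X ^ 24) * (J11 * J\<^sup>2) = J\<^sup>2 * (fps_const (1) * Q11 0
      + fps_const (- (1) + z + z ^ 10) * Q11 1
      + fps_const (z ^ 2 + z ^ 9) * Q11 2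
      + fps_const (1 + z ^ 3 + z ^ 8) * Q11 3
      + fps_const (1 + z ^ 2 + z ^ 4 + z ^ 7 + z ^ 9) * Q11 4
      + fps_const (- (z ^ 2) - z ^ 4 - z ^ 7 - z ^ 9) * Q11 5
      + fps_const (z + z ^ 4 + z ^ 7 + z ^ 10) * Q11 6
      + fps_const (z + z ^ 3 + z ^ 4 + z ^ 7 + z ^ 8 + z ^ 10) * Q11 7
      + fps_const (- (1) - z ^ 4 - z ^ 7) * Q11 8
      + fps_const (- (z ^ 3) - z ^ 8) * Q11 9) * (J11 * J\<^sup>2)"
    using crank_dissection[OF z]
    unfolding J_def[symmetric] J11_def[symmetric] trm[symmetric]
    by (simp only: distrib_left distrib_right mult.assoc mult.left_commute[of "J\<^sup>2" "fps_const c" for c])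
  moreover have "J11 * J\<^sup>2 \<noteq> 0" using J0 by simp
  ultimately show ?thesis unfolding J_def[symmetric] by (simp only: mult_cancel_right) blast
qed

lemma dilate_inj:
  fixes f g :: "complex fps"
  assumes "f oo fps_X ^ 24 = g oo fps_X ^ 24"
  shows "f = g"
proof (rule fps_ext)
  fix n
  have "fps_nth (f oo fps_X ^ 24) (24 * n) = fps_nth (g oo fps_X ^ 24) (24 * n)"
    by (simp only: assms)
  then show "fps_nth f n = fps_nth g n"
    by (simp add: fps_nth_compose_X_power)
qed

section \<open>The deviations and their discrete Fourier transform\<close>

lemma num_partitions_0: "num_partitions 0 = 1"
proof -
  have "P = {#}" if "P \<in> partitions 0" for P
  proof -
    have P: "\<forall>x\<in>#P. 0 < x" "sum_mset P = 0" using that unfolding partitions_def by blast+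
    have "size P \<le> 0" using size_le_sum_mset[OF P(1)] unfolding P(2) .
    then show ?thesis by simp
  qed
  then have "partitions 0 = {{#}}"
    by (auto simp: partitions_def)
  then show ?thesis by (simp add: num_partitions_def)
qed

lemma num_partitions_1: "num_partitions 1 = 1"
proof -
  have "P = {#1#}" if "P \<in> partitions 1" for P
  proof -
    have P: "\<forall>x\<in>#P. 0 < x" "sum_mset P = 1" using that by (auto simp: partitions_def)
    then have "size P \<le> 1" "P \<noteq> {#}" using size_le_sum_mset[of P] by auto
    then have "size P = 1" by (metis le_antisym less_one linorder_le_less_linear size_eq_0_iff_empty)
    then obtain x where "P = {#x#}" by (metis size_1_singleton_mset)
    with P show ?thesis by simp
  qed
  then have "partitions 1 = {{#1#}}" by (auto simp: partitions_def)
  then show ?thesis by (simp add: num_partitions_def)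
qed

text \<open>The convention at n = 1 keeps the total right: -1 + 1 + 1 = 1.\<close>

lemma crank_poly_at_1: "crank_poly 1 n = of_nat (num_partitions n)"
proof -
  consider "n = 0" | "n = 1" | "2 \<le> n" by linarith
  then show ?thesis
  proof cases
    case 3
    then show ?thesis by (simp add: crank_poly_ge_2 num_partitions_def)
  qed (simp_all only: crank_poly_0 crank_poly_1 num_partitions_0 num_partitions_1, simp_all)
qed

text \<open>The finite crank support is grouped by residues modulo 11. The root z = 1 is included on
  purpose, and there the last sum is 11 instead of 0.\<close>

lemma DC_transform:
  fixes z :: complex
  assumes z: "z ^ 11 = 1"
  shows "(\<Sum>a<11. z ^ a * of_rat (fps_nth (DC (int a)) n))
    = crank_poly z n - of_nat (num_partitions n) / 11 * (\<Sum>a<11. z ^ a)"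
proof -
  have z0: "z \<noteq> 0" using z by auto
  have zm: "z powi m = z ^ nat (m mod 11)" for m
  proof -
    have "z powi m = z powi (11 * (m div 11) + m mod 11)" by simp
    also have "\<dots> = (z ^ 11) powi (m div 11) * z powi (m mod 11)"
      using z0 unfolding power_int_add[OF disjI1[OF z0]] power_int_mult by simp
    also have "\<dots> = z ^ nat (m mod 11)"
      using z by (simp add: power_int_def)
    finally show ?thesis .
  qed
  have lt: "nat (m mod 11) < 11" for m :: int
    using pos_mod_bound[of 11 m] by linarith
  have cr: "of_int (crankMr (int a) 11 n) = (\<Sum>m\<in>{m \<in> {m. crankM m n \<noteq> 0}. nat (m mod 11) = a}. of_int (crankM m n) :: complex)"
    if "a < 11" for a
  proof -
    have "{m. m mod 11 = int a mod 11 \<and> crankM m n \<noteq> 0} = {m \<in> {m. crankM m n \<noteq> 0}. nat (m mod 11) = a}"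
      using that by (auto simp: nat_eq_iff)
    then show ?thesis by (simp add: crankMr_def)
  qed
  have "crank_poly z n = (\<Sum>a<11. \<Sum>m\<in>{m \<in> {m. crankM m n \<noteq> 0}. nat (m mod 11) = a}. of_int (crankM m n) * z powi m)"
    unfolding crank_poly_def by (rule sum.group[symmetric]) (use finite_crank_support lt in auto)
  also have "\<dots> = (\<Sum>a<11. z ^ a * of_int (crankMr (int a) 11 n))"
    by (rule sum.cong) (auto simp: cr sum_distrib_left zm mult.commute intro!: sum.cong)
  finally have c: "crank_poly z n = (\<Sum>a<11. z ^ a * of_int (crankMr (int a) 11 n))" .
  have dc: "of_rat (fps_nth (DC (int a)) n) = of_int (crankMr (int a) 11 n) - of_nat (num_partitions n) / (11::complex)" for a
    by (simp add: DC_def of_rat_diff of_rat_divide)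
  have "(\<Sum>a<11. z ^ a * of_rat (fps_nth (DC (int a)) n))
      = (\<Sum>a<11. z ^ a * of_int (crankMr (int a) 11 n) - of_nat (num_partitions n) / 11 * z ^ a)"
    unfolding dc by (simp only: right_diff_distrib mult.commute)
  then show ?thesis
    unfolding c sum_subtractf sum_distrib_left .
qed

text \<open>Rows \<open>a\<close> and \<open>11 - a\<close> agree because the coefficients in
  \<open>crank_gf_dissected\<close> are invariant under z -> 1/z. Column \<open>j\<close> is 11
  times the integer coefficients of the j-th such polynomial in \<open>z\<close>, shifted by a
  constant so that its sum is 0.\<close>

definition dissection_coeff :: "nat \<Rightarrow> nat \<Rightarrow> int" where
  "dissection_coeff a j = [[10, - 12, - 2, 8, 6, 4, - 4, - 6, - 8, 2],
     [- 1, 10, - 2, - 3, - 5, 4, 7, 5, 3, 2],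
     [- 1, - 1, 9, - 3, 6, - 7, - 4, - 6, 3, 2],
     [- 1, - 1, - 2, 8, - 5, 4, - 4, 5, 3, - 9],
     [- 1, - 1, - 2, - 3, 6, - 7, 7, 5, - 8, 2],
     [- 1, - 1, - 2, - 3, - 5, 4, - 4, - 6, 3, 2],
     [- 1, - 1, - 2, - 3, - 5, 4, - 4, - 6, 3, 2],
     [- 1, - 1, - 2, - 3, 6, - 7, 7, 5, - 8, 2],
     [- 1, - 1, - 2, 8, - 5, 4, - 4, 5, 3, - 9],
     [- 1, - 1, 9, - 3, 6, - 7, - 4, - 6, 3, 2],
     [- 1, 10, - 2, - 3, - 5, 4, 7, 5, 3, 2]] ! a ! j"

definition dissected_row :: "nat \<Rightarrow> rat fps" where
  "dissected_row a = (let c = dissection_coeff a in v11 (c 0) (c 1) (c 2) (c 3) (c 4) (c 5) (c 6) (c 7) (c 8) (c 9))"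

lemma sum_lessThan_10: "(\<Sum>i<10. f i) = f 0 + f 1 + f 2 + f 3 + f 4 + f 5 + f 6 + f 7 + f 8 + f (9::nat)"
  by (simp add: eval_nat_numeral)

lemma dil_dissected_row:
  "(\<Sum>a<11. fps_const (z ^ a) * dil (dissected_row a))
    = (qprod 1 2904 2904)\<^sup>2 * (\<Sum>j<10. fps_const ((\<Sum>a<11. z ^ a * of_int (dissection_coeff a j)) / 11) * Q11 j)"
proof -
  define J where "J = qprod (1::complex) 2904 2904"
  have row: "dil (dissected_row a) = fps_const (1 / 11) * J\<^sup>2 * (\<Sum>j<10. fps_const (of_int (dissection_coeff a j)) * Q11 j)" for a
    unfolding dissected_row_def Let_def dil_v11 sum_lessThan_10 J_def ..
  have cs: "(\<Sum>a<11. fps_const (z ^ a * of_int (dissection_coeff a j) / 11))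
      = fps_const ((\<Sum>a<11. z ^ a * of_int (dissection_coeff a j)) / 11)" for j
    by (simp add: fps_eq_iff fps_sum_nth sum_divide_distrib)
  have coll: "fps_const b * (fps_const (1 / 11) * J\<^sup>2 * (fps_const t * Q)) = J\<^sup>2 * (fps_const (b * t / 11) * Q)" for b t :: complex and Q
  proof -
    have "fps_const (b * t / 11) = fps_const b * (fps_const (1 / 11) * fps_const t)" by simp
    then show ?thesis by (simp only: ac_simps)
  qed
  have "(\<Sum>a<11. fps_const (z ^ a) * dil (dissected_row a))
      = (\<Sum>a<11. \<Sum>j<10. J\<^sup>2 * (fps_const (z ^ a * of_int (dissection_coeff a j) / 11) * Q11 j))"
    unfolding row sum_distrib_left coll ..
  also have "\<dots> = (\<Sum>j<10. \<Sum>a<11. J\<^sup>2 * (fps_const (z ^ a * of_int (dissection_coeff a j) / 11) * Q11 j))"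
    by (rule sum.swap)
  also have "\<dots> = J\<^sup>2 * (\<Sum>j<10. (\<Sum>a<11. fps_const (z ^ a * of_int (dissection_coeff a j) / 11)) * Q11 j)"
    by (simp add: sum_distrib_left sum_distrib_right)
  finally show ?thesis unfolding J_def cs .
qed

lemma dissection_coeff_sum:
  fixes z :: complex
  assumes "z ^ 11 = 1" "z \<noteq> 1"
  shows "(\<Sum>a<11. z ^ a * of_int (dissection_coeff a 0)) / 11 = 1"
    "(\<Sum>a<11. z ^ a * of_int (dissection_coeff a 1)) / 11 = - (1) + z + z ^ 10"
    "(\<Sum>a<11. z ^ a * of_int (dissection_coeff a 2)) / 11 = z ^ 2 + z ^ 9"
    "(\<Sum>a<11. z ^ a * of_int (dissection_coeff a 3)) / 11 = 1 + z ^ 3 + z ^ 8"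
    "(\<Sum>a<11. z ^ a * of_int (dissection_coeff a 4)) / 11 = 1 + z ^ 2 + z ^ 4 + z ^ 7 + z ^ 9"
    "(\<Sum>a<11. z ^ a * of_int (dissection_coeff a 5)) / 11 = - (z ^ 2) - z ^ 4 - z ^ 7 - z ^ 9"
    "(\<Sum>a<11. z ^ a * of_int (dissection_coeff a 6)) / 11 = z + z ^ 4 + z ^ 7 + z ^ 10"
    "(\<Sum>a<11. z ^ a * of_int (dissection_coeff a 7)) / 11 = z + z ^ 3 + z ^ 4 + z ^ 7 + z ^ 8 + z ^ 10"
    "(\<Sum>a<11. z ^ a * of_int (dissection_coeff a 8)) / 11 = - (1) - z ^ 4 - z ^ 7"
    "(\<Sum>a<11. z ^ a * of_int (dissection_coeff a 9)) / 11 = - (z ^ 3) - z ^ 8"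
proof -
  note phi = sum_powers_11_eq_0[OF assms]
  have "(\<Sum>a<11. z ^ a * of_int (dissection_coeff a 0)) = 11 * (1) + (-1) * (1 + z + z ^ 2 + z ^ 3 + z ^ 4 + z ^ 5 + z ^ 6 + z ^ 7 + z ^ 8 + z ^ 9 + z ^ 10)"
    unfolding sum_lessThan_11 dissection_coeff_def by simp
  then show "(\<Sum>a<11. z ^ a * of_int (dissection_coeff a 0)) / 11 = 1"
    unfolding phi by simp
  have "(\<Sum>a<11. z ^ a * of_int (dissection_coeff a 1)) = 11 * (- (1) + z + z ^ 10) + (-1) * (1 + z + z ^ 2 + z ^ 3 + z ^ 4 + z ^ 5 + z ^ 6 + z ^ 7 + z ^ 8 + z ^ 9 + z ^ 10)"
    unfolding sum_lessThan_11 dissection_coeff_def by simp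
  then show "(\<Sum>a<11. z ^ a * of_int (dissection_coeff a 1)) / 11 = - (1) + z + z ^ 10"
    unfolding phi by simp
  have "(\<Sum>a<11. z ^ a * of_int (dissection_coeff a 2)) = 11 * (z ^ 2 + z ^ 9) + (-2) * (1 + z + z ^ 2 + z ^ 3 + z ^ 4 + z ^ 5 + z ^ 6 + z ^ 7 + z ^ 8 + z ^ 9 + z ^ 10)"
    unfolding sum_lessThan_11 dissection_coeff_def by simp
  then show "(\<Sum>a<11. z ^ a * of_int (dissection_coeff a 2)) / 11 = z ^ 2 + z ^ 9"
    unfolding phi by simp
  have "(\<Sum>a<11. z ^ a * of_int (dissection_coeff a 3)) = 11 * (1 + z ^ 3 + z ^ 8) + (-3) * (1 + z + z ^ 2 + z ^ 3 + z ^ 4 + z ^ 5 + z ^ 6 + z ^ 7 + z ^ 8 + z ^ 9 + z ^ 10)"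
    unfolding sum_lessThan_11 dissection_coeff_def by simp
  then show "(\<Sum>a<11. z ^ a * of_int (dissection_coeff a 3)) / 11 = 1 + z ^ 3 + z ^ 8"
    unfolding phi by simp
  have "(\<Sum>a<11. z ^ a * of_int (dissection_coeff a 4)) = 11 * (1 + z ^ 2 + z ^ 4 + z ^ 7 + z ^ 9) + (-5) * (1 + z + z ^ 2 + z ^ 3 + z ^ 4 + z ^ 5 + z ^ 6 + z ^ 7 + z ^ 8 + z ^ 9 + z ^ 10)"
    unfolding sum_lessThan_11 dissection_coeff_def by simp
  then show "(\<Sum>a<11. z ^ a * of_int (dissection_coeff a 4)) / 11 = 1 + z ^ 2 + z ^ 4 + z ^ 7 + z ^ 9"
    unfolding phi by simp
  have "(\<Sum>a<11. z ^ a * of_int (dissection_coeff a 5)) = 11 * (- (z ^ 2) - z ^ 4 - z ^ 7 - z ^ 9) + 4 * (1 + z + z ^ 2 + z ^ 3 + z ^ 4 + z ^ 5 + z ^ 6 + z ^ 7 + z ^ 8 + z ^ 9 + z ^ 10)"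
    unfolding sum_lessThan_11 dissection_coeff_def by simp
  then show "(\<Sum>a<11. z ^ a * of_int (dissection_coeff a 5)) / 11 = - (z ^ 2) - z ^ 4 - z ^ 7 - z ^ 9"
    unfolding phi by simp
  have "(\<Sum>a<11. z ^ a * of_int (dissection_coeff a 6)) = 11 * (z + z ^ 4 + z ^ 7 + z ^ 10) + (-4) * (1 + z + z ^ 2 + z ^ 3 + z ^ 4 + z ^ 5 + z ^ 6 + z ^ 7 + z ^ 8 + z ^ 9 + z ^ 10)"
    unfolding sum_lessThan_11 dissection_coeff_def by simp
  then show "(\<Sum>a<11. z ^ a * of_int (dissection_coeff a 6)) / 11 = z + z ^ 4 + z ^ 7 + z ^ 10"
    unfolding phi by simp
  have "(\<Sum>a<11. z ^ a * of_int (dissection_coeff a 7)) = 11 * (z + z ^ 3 + z ^ 4 + z ^ 7 + z ^ 8 + z ^ 10) + (-6) * (1 + z + z ^ 2 + z ^ 3 + z ^ 4 + z ^ 5 + z ^ 6 + z ^ 7 + z ^ 8 + z ^ 9 + z ^ 10)"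
    unfolding sum_lessThan_11 dissection_coeff_def by simp
  then show "(\<Sum>a<11. z ^ a * of_int (dissection_coeff a 7)) / 11 = z + z ^ 3 + z ^ 4 + z ^ 7 + z ^ 8 + z ^ 10"
    unfolding phi by simp
  have "(\<Sum>a<11. z ^ a * of_int (dissection_coeff a 8)) = 11 * (- (1) - z ^ 4 - z ^ 7) + 3 * (1 + z + z ^ 2 + z ^ 3 + z ^ 4 + z ^ 5 + z ^ 6 + z ^ 7 + z ^ 8 + z ^ 9 + z ^ 10)"
    unfolding sum_lessThan_11 dissection_coeff_def by simp
  then show "(\<Sum>a<11. z ^ a * of_int (dissection_coeff a 8)) / 11 = - (1) - z ^ 4 - z ^ 7"
    unfolding phi by simp
  have "(\<Sum>a<11. z ^ a * of_int (dissection_coeff a 9)) = 11 * (- (z ^ 3) - z ^ 8) + 2 * (1 + z + z ^ 2 + z ^ 3 + z ^ 4 + z ^ 5 + z ^ 6 + z ^ 7 + z ^ 8 + z ^ 9 + z ^ 10)"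
    unfolding sum_lessThan_11 dissection_coeff_def by simp
  then show "(\<Sum>a<11. z ^ a * of_int (dissection_coeff a 9)) / 11 = - (z ^ 3) - z ^ 8"
    unfolding phi by simp
qed

lemma dissection_coeff_sum_1:
  assumes "j < 10"
  shows "(\<Sum>a<11. dissection_coeff a j) = 0"
proof -
  have "j \<in> {0, 1, 2, 3, 4, 5, 6, 7, 8, 9}" using assms by auto
  then show ?thesis
    unfolding sum_lessThan_11 dissection_coeff_def by auto
qed

text \<open>For fixed \<open>n\<close>, the eleven differences are the coefficients of a polynomial
  of degree at most 10 that vanishes at all eleven roots of unity, hence is zero.\<close>

lemma DC_eq_dissected_row:
  assumes b: "b < 11"
  shows "DC (int b) = dissected_row b"
proof (rule fps_ext)
  fix n
  define x :: "nat \<Rightarrow> complex" where "x a = of_rat (fps_nth (DC (int a)) n - fps_nth (dissected_row a) n)" for a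
  have "(\<Sum>a<11. z ^ a * x a) = 0" if z: "z ^ 11 = 1" for z
  proof -
    define F where "F = (\<Sum>a<11. fps_const (z ^ a) * fps_of_rat (dissected_row a))"
    have Fd: "F oo fps_X ^ 24 = (\<Sum>a<11. fps_const (z ^ a) * dil (dissected_row a))"
      unfolding F_def fps_compose_sum_distrib dil_def by (simp add: fps_compose_mult_distrib[OF X24])
    have Fn: "fps_nth F n = (\<Sum>a<11. z ^ a * of_rat (fps_nth (dissected_row a) n))"
      by (simp add: F_def fps_sum_nth)
    have "fps_nth F n = (\<Sum>a<11. z ^ a * of_rat (fps_nth (DC (int a)) n))"
    proof (cases "z = 1")
      \<comment> \<open>At z = 1 the table contributes zero column sums, and the crank polynomial
        p(n) cancels against the subtracted average.\<close>
      case True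
      then have "F oo fps_X ^ 24 = 0 oo fps_X ^ 24"
        unfolding Fd dil_dissected_row by (simp add: dissection_coeff_sum_1 flip: of_int_sum)
      then have "F = 0" by (rule dilate_inj)
      then show ?thesis
        using DC_transform[OF z, of n] True by (simp add: crank_poly_at_1)
    next
      case False
      note phi = sum_powers_11_eq_0[OF z False]
      have "F oo fps_X ^ 24 = Abs_fps (crank_poly z) oo fps_X ^ 24"
        unfolding Fd dil_dissected_row crank_gf_dissected[OF z False] sum_lessThan_10 dissection_coeff_sum[OF z False] ..
      then have "F = Abs_fps (crank_poly z)" by (rule dilate_inj)
      moreover have "(\<Sum>a<11. z ^ a) = 0" using phi unfolding sum_lessThan_11 by simp
      ultimately show ?thesis
        using DC_transform[OF z, of n] by simp
    qed
    then show ?thesis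
      unfolding Fn x_def of_rat_diff right_diff_distrib sum_subtractf by simp
  qed
  then have poly0: "poly (\<Sum>a<11. monom (x a) a) z = poly 0 z" if "z \<in> {z. z ^ 11 = 1}" for z
    using that by (simp add: poly_sum poly_monom mult.commute)
  have "degree (\<Sum>a<11. monom (x a) a) \<le> 10"
    by (rule degree_sum_le) (auto intro: order.trans[OF degree_monom_le])
  then have "(\<Sum>a<11. monom (x a) a) = 0"
    by (intro poly_eqI_degree[where A = "{z. z ^ 11 = 1}", OF poly0]) (auto simp: card_roots_unity_eq)
  then have "coeff (\<Sum>a<11. monom (x a) a) b = 0" by simp
  then have "x b = 0" using b by (simp add: coeff_sum)
  then show "fps_nth (DC (int b)) n = fps_nth (dissected_row b) n"
    by (simp add: x_def)
qed

theorem theorem1p1: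
  shows "(DC 0 = v11 10 (-12) (-2) 8 6 4 (-4) (-6) (-8) 2) \<and>
    (DC 1 = v11 (-1) 10 (-2) (-3) (-5) 4 7 5 3 2) \<and>
    (DC 2 = v11 (-1) (-1) 9 (-3) 6 (-7) (-4) (-6) 3 2) \<and>
    (DC 3 = v11 (-1) (-1) (-2) 8 (-5) 4 (-4) 5 3 (-9)) \<and>
    (DC 4 = v11 (-1) (-1) (-2) (-3) 6 (-7) 7 5 (-8) 2) \<and>
    (DC 5 = v11 (-1) (-1) (-2) (-3) (-5) 4 (-4) (-6) 3 2)"
  using DC_eq_dissected_row[of 0] DC_eq_dissected_row[of 1] DC_eq_dissected_row[of 2]
    DC_eq_dissected_row[of 3] DC_eq_dissected_row[of 4] DC_eq_dissected_row[of 5]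
  by (simp add: dissected_row_def dissection_coeff_def)

end
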